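(* Let $(X,f)$ be a topological dynamical system with $h_{\mathrm{top}}(f)<+\infty$, and let $\varphi,\psi\in C(X,\mathbb{R})$ with $\psi>0$. The following properties hold: (i) $\mathcal{M}_{\psi,\varphi}(X,f)$ is convex; (ii) the extreme points of $\mathcal{M}_{\psi,\varphi}(X,f)$ are exactly the ergodic measures in $\mathcal{M}_{\psi,\varphi}(X,f)$; (iii) if $\mathcal{M}_{\psi,\varphi}(X,f)\ne\emptyset$, then $\mathcal{M}_{\psi,\varphi}(X,f)$ contains an ergodic measure.
   Context: A topological dynamical system (TDS) $(X,f)$ is a continuous map $f:X\to X$ on a compact metric space $(X,d)$; $h_{\mathrm{top}}(f)$ is its topological entropy. $C(X,\mathbb{R})$ is the space of continuous real functions on $X$; $S_n\varphi=\sum_{i=0}^{n-1}\varphi\circ f^i$; $\mathbb{N}$ denotes the positive integers; $\mathcal{M}(X,f)$ is the set of $f$-invariant Borel probability measures and $h_\mu(f)$ the measure-theoretic entropy. Let $d_n(x,y)=\max\{d(f^ix,f^iy):0\le i\le n-1\}$. For nonempty $Z\subset X$, a set $F_n\subset X$ is an $(n,\varepsilon)$-spanning set of $Z$ if for each $y\in Z$ there is $x\in F_n$ with $d_n(x,y)\le\varepsilon$. For $\psi>0$ and $T>0$ let $S_T=\{n\in\mathbb{N}:\exists x\in X,\ S_n\psi(x)\le T\text{ and }S_{n+1}\psi(x)>T\}$, and for $n\in S_T$ let $X_n=\{x\in X:S_n\psi(x)\le T\text{ and }S_{n+1}\psi(x)>T\}$. Put $$Q_{\psi,T}(f,\varphi,\varepsilon)=\inf\Big\{\sum_{n\in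 S_T}\sum_{x\in F_n}e^{S_n\varphi(x)}:F_n\text{ is an }(n,\varepsilon)\text{-spanning set of }X_n,\ n\in S_T\Big\}.$$ The $\psi$-induced topological pressure of $\varphi$ is $P_\psi(\varphi)=\lim_{\varepsilon\to0}\limsup_{T\to\infty}\frac1T\log Q_{\psi,T}(f,\varphi,\varepsilon)$. A measure $\mu\in\mathcal{M}(X,f)$ is an equilibrium state of $P_\psi(\varphi)$ if $P_\psi(\varphi)=\frac{h_\mu(f)+\int\varphi\,d\mu}{\int\psi\,d\mu}$; $\mathcal{M}_{\psi,\varphi}(X,f)$ is the set of all equilibrium states of $P_\psi(\varphi)$. *)

theory Defs
  imports "HOL-Probability.Probability"
begin

text \<open>
  The space \<open>X\<close> is the universe of a type of class \<^class>\<open>metric_space\<close>, assumed compact where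
  needed, with the Borel sigma-algebra \<^const>\<open>borel\<close>.
\<close>

definition birkhoff_sum :: "('a \<Rightarrow> 'a) \<Rightarrow> ('a \<Rightarrow> real) \<Rightarrow> nat \<Rightarrow> 'a \<Rightarrow> real" where
  "birkhoff_sum f \<phi> n x = (\<Sum>i<n. \<phi> ((f ^^ i) x))"

text \<open>Only used for \<open>n \<ge> 1\<close>; the maximum over the empty set is unspecified.\<close>

definition bowen_dist :: "('a::metric_space \<Rightarrow> 'a) \<Rightarrow> nat \<Rightarrow> 'a \<Rightarrow> 'a \<Rightarrow> real" where
  "bowen_dist f n x y = (MAX i\<in>{..<n}. dist ((f ^^ i) x) ((f ^^ i) y))"

definition spanning_set :: "('a::metric_space \<Rightarrow> 'a) \<Rightarrow> nat \<Rightarrow> real \<Rightarrow> 'a set \<Rightarrow> 'a set \<Rightarrow> bool" where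
  "spanning_set f n \<epsilon> Z F \<longleftrightarrow> (\<forall>y\<in>Z. \<exists>x\<in>F. bowen_dist f n x y \<le> \<epsilon>)"

subsection \<open>Topological entropy\<close>

definition min_spanning_card :: "('a::metric_space \<Rightarrow> 'a) \<Rightarrow> nat \<Rightarrow> real \<Rightarrow> nat" where
  "min_spanning_card f n \<epsilon> = Inf {card F | F. finite F \<and> spanning_set f n \<epsilon> UNIV F}"

definition top_entropy :: "('a::metric_space \<Rightarrow> 'a) \<Rightarrow> ereal" where
  "top_entropy f =
     Lim (at_right (0::real))
       (\<lambda>\<epsilon>. limsup (\<lambda>n. ereal (ln (real (min_spanning_card f n \<epsilon>)) / real n)))"

subsection \<open>Invariant and ergodic measures, measure-theoretic entropy\<close>

definition invariant_measures :: "('a::topological_space \<Rightarrow> 'a) \<Rightarrow> 'a measure set" where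
  "invariant_measures f = {\<mu>. prob_space \<mu> \<and> sets \<mu> = sets borel \<and> distr \<mu> borel f = \<mu>}"

definition ergodic :: "('a::topological_space \<Rightarrow> 'a) \<Rightarrow> 'a measure \<Rightarrow> bool" where
  "ergodic f \<mu> \<longleftrightarrow> \<mu> \<in> invariant_measures f \<and>
     (\<forall>A\<in>sets borel. f -` A = A \<longrightarrow> measure \<mu> A = 0 \<or> measure \<mu> A = 1)"

text \<open>Since \<open>ln 0 = 0\<close>, null cells contribute \<open>0\<close>.\<close>

definition partition_entropy :: "'a measure \<Rightarrow> 'a set set \<Rightarrow> real" where
  "partition_entropy \<mu> \<xi> = - (\<Sum>A\<in>\<xi>. measure \<mu> A * ln (measure \<mu> A))"

text \<open>The join of \<open>f\<^sup>-\<^sup>i \<xi>\<close> over \<open>0 \<le> i < n\<close>.\<close>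

definition iterated_join :: "('a \<Rightarrow> 'a) \<Rightarrow> nat \<Rightarrow> 'a set set \<Rightarrow> 'a set set" where
  "iterated_join f n \<xi> = common_refinement ((\<lambda>i. (\<lambda>A. (f ^^ i) -` A) ` \<xi>) ` {..<n})"

definition partition_rate :: "('a \<Rightarrow> 'a) \<Rightarrow> 'a measure \<Rightarrow> 'a set set \<Rightarrow> ereal" where
  "partition_rate f \<mu> \<xi> =
     lim (\<lambda>n. ereal (partition_entropy \<mu> (iterated_join f n \<xi>) / real n))"

definition measure_entropy :: "('a::topological_space \<Rightarrow> 'a) \<Rightarrow> 'a measure \<Rightarrow> ereal" where
  "measure_entropy f \<mu> =
     (SUP \<xi>\<in>{\<xi>. finite \<xi> \<and> \<xi> \<subseteq> sets borel \<and> partition_on UNIV \<xi>}. partition_rate f \<mu> \<xi>)"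

subsection \<open>Induced pressure\<close>

definition level_set :: "('a \<Rightarrow> 'a) \<Rightarrow> ('a \<Rightarrow> real) \<Rightarrow> real \<Rightarrow> nat \<Rightarrow> 'a set" where
  "level_set f \<psi> T n = {x. birkhoff_sum f \<psi> n x \<le> T \<and> birkhoff_sum f \<psi> (n + 1) x > T}"

definition level_times :: "('a \<Rightarrow> 'a) \<Rightarrow> ('a \<Rightarrow> real) \<Rightarrow> real \<Rightarrow> nat set" where
  "level_times f \<psi> T =
     {n. n \<ge> 1 \<and> (\<exists>x. birkhoff_sum f \<psi> n x \<le> T \<and> birkhoff_sum f \<psi> (n + 1) x > T)}"

text \<open>
  The spanning sets \<open>F n\<close> may be infinite, so the sums are unordered sums with values in
  \<^typ>\<open>ennreal\<close>.
\<close>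

definition induced_Q ::
  "('a::metric_space \<Rightarrow> 'a) \<Rightarrow> ('a \<Rightarrow> real) \<Rightarrow> ('a \<Rightarrow> real) \<Rightarrow> real \<Rightarrow> real \<Rightarrow> ennreal" where
  "induced_Q f \<psi> \<phi> T \<epsilon> =
     (INF F\<in>{F. \<forall>n\<in>level_times f \<psi> T. spanning_set f n \<epsilon> (level_set f \<psi> T n) (F n)}.
        \<Sum>\<^sub>\<infinity>n\<in>level_times f \<psi> T. \<Sum>\<^sub>\<infinity>x\<in>F n. ennreal (exp (birkhoff_sum f \<phi> n x)))"

definition ln_ennreal :: "ennreal \<Rightarrow> ereal" where
  "ln_ennreal x = (if x = 0 then -\<infinity> else if x = \<infinity> then \<infinity> else ereal (ln (enn2real x)))"

definition induced_pressure ::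
  "('a::metric_space \<Rightarrow> 'a) \<Rightarrow> ('a \<Rightarrow> real) \<Rightarrow> ('a \<Rightarrow> real) \<Rightarrow> ereal" where
  "induced_pressure f \<psi> \<phi> =
     Lim (at_right (0::real))
       (\<lambda>\<epsilon>. Limsup (at_top :: real filter) (\<lambda>T. ln_ennreal (induced_Q f \<psi> \<phi> T \<epsilon>) / ereal T))"

definition equilibrium_states ::
  "('a::metric_space \<Rightarrow> 'a) \<Rightarrow> ('a \<Rightarrow> real) \<Rightarrow> ('a \<Rightarrow> real) \<Rightarrow> 'a measure set" where
  "equilibrium_states f \<psi> \<phi> =
     {\<mu> \<in> invariant_measures f.
        induced_pressure f \<psi> \<phi> =
          (measure_entropy f \<mu> + ereal (\<integral>x. \<phi> x \<partial>\<mu>)) / ereal (\<integral>x. \<psi> x \<partial>\<mu>)}"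

subsection \<open>Convexity for sets of measures\<close>

text \<open>
  The type \<^typ>\<open>'a measure\<close> is not a real vector space, so \<^const>\<open>convex\<close> and
  \<^const>\<open>extreme_point_of\<close> do not apply to it directly.
\<close>

definition mix_measure :: "real \<Rightarrow> 'a measure \<Rightarrow> 'a measure \<Rightarrow> 'a measure" where
  "mix_measure t \<mu> \<nu> = measure_of (space \<mu>) (sets \<mu>)
     (\<lambda>A. ennreal (1 - t) * emeasure \<mu> A + ennreal t * emeasure \<nu> A)"

lemma sets_mix_measure: "sets (mix_measure t \<mu> \<nu>) = sets \<mu>"
  by (simp add: mix_measure_def)

lemma emeasure_mix_measure:
  assumes "sets \<mu> = sets \<nu>" "A \<in> sets \<mu>"
  shows "emeasure (mix_measure t \<mu> \<nu>) A = ennreal (1 - t) * emeasure \<mu> A + ennreal t * emeasure \<nu> A"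
  unfolding mix_measure_def
proof (rule emeasure_measure_of_sigma)
  show "sigma_algebra (space \<mu>) (sets \<mu>)" by (rule sets.sigma_algebra_axioms)
  show "positive (sets \<mu>) (\<lambda>A. ennreal (1 - t) * emeasure \<mu> A + ennreal t * emeasure \<nu> A)"
    by (simp add: positive_def)
  show "countably_additive (sets \<mu>) (\<lambda>A. ennreal (1 - t) * emeasure \<mu> A + ennreal t * emeasure \<nu> A)"
  proof (rule countably_additiveI)
    fix B :: "nat \<Rightarrow> 'a set"
    assume B: "range B \<subseteq> sets \<mu>" "disjoint_family B"
    then have "(\<Sum>i. emeasure \<mu> (B i)) = emeasure \<mu> (\<Union>i. B i)"
      "(\<Sum>i. emeasure \<nu> (B i)) = emeasure \<nu> (\<Union>i. B i)"
      using assms(1) by (auto intro!: suminf_emeasure)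
    then show "(\<Sum>i. ennreal (1 - t) * emeasure \<mu> (B i) + ennreal t * emeasure \<nu> (B i)) =
      ennreal (1 - t) * emeasure \<mu> (\<Union>i. B i) + ennreal t * emeasure \<nu> (\<Union>i. B i)"
      by (simp add: suminf_add[symmetric])
  qed
  show "A \<in> sets \<mu>" by fact
qed

definition convex_measures :: "'a measure set \<Rightarrow> bool" where
  "convex_measures S \<longleftrightarrow> (\<forall>\<mu>\<in>S. \<forall>\<nu>\<in>S. \<forall>t\<in>{0..1}. mix_measure t \<mu> \<nu> \<in> S)"

definition extreme_measures :: "'a measure set \<Rightarrow> 'a measure set" where
  "extreme_measures S =
     {\<mu> \<in> S. \<forall>\<nu>\<^sub>1\<in>S. \<forall>\<nu>\<^sub>2\<in>S. \<forall>t\<in>{0<..<1}. \<nu>\<^sub>1 \<noteq> \<nu>\<^sub>2 \<longrightarrow> \<mu> \<noteq> mix_measure t \<nu>\<^sub>1 \<nu>\<^sub>2}"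

end

theory Submission
  imports Defs
begin

text \<open>
  Comparing spanning sets at the levels of the induced pressure \<open>P\<close> with spanning sets of the whole
  space, Misiurewicz's argument gives \<open>h\<^sub>\<nu> + \<integral>(\<phi> - P \<psi>) d\<nu> \<le> 0\<close> for every invariant \<open>\<nu>\<close>, and the
  equilibrium states are exactly the measures for which equality holds. Entropy is affine, so they form
  a face of the convex set of invariant measures, whose extreme points are the ergodic measures by
  Birkhoff's theorem. For an equilibrium state \<open>\<mu>\<close>, let \<open>\<kappa>\<^sub>x\<close> be its conditional measures given the
  invariant sets, which are almost surely invariant and ergodic. Entropy need not be upper
  semicontinuous, but \<open>h\<^sub>\<mu>(\<xi>) \<le> \<integral> h\<^bsub>\<kappa>\<^sub>x\<^esub>(\<xi>) d\<mu>(x)\<close> for every finite partition \<open>\<xi>\<close>. Taking partitions that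
  exhaust \<open>h\<^sub>\<mu>\<close>, the nonpositive function \<open>x \<mapsto> h\<^bsub>\<kappa>\<^sub>x\<^esub> + \<integral>(\<phi> - P \<psi>) d\<kappa>\<^sub>x\<close> has nonnegative integral, so almost
  every \<open>\<kappa>\<^sub>x\<close> is an ergodic equilibrium state.
\<close>

subsection \<open>Entropy of finite-valued functions\<close>

text \<open>The quotient that defines an equilibrium state is not affine in the measure; multiplying
  out by \<open>\<integral>\<psi> > 0\<close> turns it into an affine condition. Finite topological
  entropy bounds every measure entropy, so all sums and mixtures of entropies are formed in the
  reals. The entropy of \<open>\<kappa> x\<close> is a supremum over uncountably many partitions, so
  its measurability in x is unclear. Hence only the rates of one sequence of partitions are ever
  integrated. The conditional measures must satisfy uncountably many requirements (every Borel set,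
  every invariant set) outside a single null set. Coding X in the real line reduces them to
  countably many sets given by rational bounds. Partitions are replaced by finite-valued functions:
  refinement becomes factorisation, a join becomes a pair, an iterated join becomes the word read
  along the orbit, and entropy inequalities become inequalities for random variables.\<close>

definition ent :: "'a measure \<Rightarrow> ('a \<Rightarrow> 'b) \<Rightarrow> real" where
  "ent \<mu> X = - (\<Sum>l\<in>range X. measure \<mu> (X -` {l}) * ln (measure \<mu> (X -` {l})))"

text \<open>Since the space is the whole type, a fibre is a plain preimage. Base
  \<open>exp 1\<close> turns the information-theoretic logarithm into the \<open>ln\<close> of
  \<open>partition_entropy\<close>.\<close>

locale full_prob = prob_space \<mu> for \<mu> :: "'a measure" +
  assumes space_UNIV: "space \<mu> = UNIV"
begin

sublocale info: information_space \<mu> "exp 1"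
  by unfold_locales (auto)

lemma ent_eq_entropy:
  assumes "simple_function \<mu> X"
  shows "ent \<mu> X = info.entropy_Pow X"
proof -
  have "info.entropy_Pow X = - (\<Sum>x\<in>X`space \<mu>. prob (X -` {x} \<inter> space \<mu>) * log (exp 1) (prob (X -` {x} \<inter> space \<mu>)))"
    by (rule info.entropy_simple_distributed) (rule simple_distributedI[OF assms], auto)
  then show ?thesis
    by (simp add: ent_def space_UNIV log_def)
qed

lemma ent_comp_le:
  assumes "simple_function \<mu> X"
  shows "ent \<mu> (g \<circ> X) \<le> ent \<mu> X"
  using info.entropy_data_processing[OF assms, of g]
  unfolding ent_eq_entropy[OF assms] ent_eq_entropy[OF simple_function_compose[OF assms]] .

lemma simple_function_factor:
  assumes "simple_function \<mu> Y" "\<And>x y. Y x = Y y \<Longrightarrow> X x = X y"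
  shows "simple_function \<mu> X" "X = (X \<circ> inv Y) \<circ> Y"
proof -
  show *: "X = (X \<circ> inv Y) \<circ> Y"
  proof
    fix x
    have "Y (inv Y (Y x)) = Y x" by (simp add: f_inv_into_f)
    from assms(2)[OF this] show "X x = ((X \<circ> inv Y) \<circ> Y) x" by simp
  qed
  have "simple_function \<mu> ((X \<circ> inv Y) \<circ> Y)" by (rule simple_function_compose[OF assms(1)])
  then show "simple_function \<mu> X" using * by simp
qed

text \<open>A function that is constant on the fibres of Y factors through Y, so this is the data
  processing inequality. In terms of partitions: refining does not lower entropy.\<close>

lemma ent_mono:
  assumes "simple_function \<mu> Y" "\<And>x y. Y x = Y y \<Longrightarrow> X x = X y"
  shows "ent \<mu> X \<le> ent \<mu> Y"
  using ent_comp_le[OF assms(1), of "X \<circ> inv Y"] simple_function_factor(2)[OF assms] by simp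

lemma ent_cong_fibres:
  assumes "simple_function \<mu> Y" "\<And>x y. Y x = Y y \<longleftrightarrow> X x = X y"
  shows "ent \<mu> X = ent \<mu> Y"
  using ent_mono[of Y X] ent_mono[of X Y] simple_function_factor(1)[OF assms(1), of X] assms
  by (meson antisym)

text \<open>All four entropies in \<open>ent_submodular\<close> belong to functions of one joint
  variable W. Summing over the values of W gives them a common index set, so that they can be
  compared term by term.\<close>

lemma ent_comp_sum:
  assumes W: "simple_function \<mu> W"
  shows "ent \<mu> (\<lambda>x. g (W x)) =
    - (\<Sum>w\<in>range W. prob (W -` {w}) * ln (prob ((\<lambda>x. g (W x)) -` {g w})))"
proof -
  let ?V = "\<lambda>x. g (W x)"
  have fin: "finite (range W)" using simple_functionD(1)[OF W] by (simp add: space_UNIV)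
  have fib: "prob (?V -` {v}) = (\<Sum>w\<in>{w\<in>range W. g w = v}. prob (W -` {w}))" for v
  proof -
    have "prob (\<Union>w\<in>{w\<in>range W. g w = v}. W -` {w}) = (\<Sum>w\<in>{w\<in>range W. g w = v}. prob (W -` {w}))"
    proof (rule finite_measure_finite_Union)
      show "(\<lambda>w. W -` {w}) ` {w\<in>range W. g w = v} \<subseteq> events"
        using simple_functionD(2)[OF W] by (auto simp: space_UNIV)
    qed (use fin in \<open>auto simp: disjoint_family_on_def\<close>)
    moreover have "(\<Union>w\<in>{w\<in>range W. g w = v}. W -` {w}) = ?V -` {v}" by auto
    ultimately show ?thesis by simp
  qed
  have "(\<Sum>w\<in>range W. prob (W -` {w}) * ln (prob (?V -` {g w})))
      = (\<Sum>v\<in>g ` range W. \<Sum>w\<in>{w\<in>range W. g w = v}. prob (W -` {w}) * ln (prob (?V -` {g w})))"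
    by (rule sum.image_gen[OF fin])
  also have "\<dots> = (\<Sum>v\<in>range ?V. prob (?V -` {v}) * ln (prob (?V -` {v})))"
  proof (rule sum.cong)
    fix v assume "v \<in> range ?V"
    have "(\<Sum>w\<in>{w\<in>range W. g w = v}. prob (W -` {w}) * ln (prob (?V -` {g w})))
        = (\<Sum>w\<in>{w\<in>range W. g w = v}. prob (W -` {w})) * ln (prob (?V -` {v}))"
      by (simp add: sum_distrib_right)
    then show "(\<Sum>w\<in>{w\<in>range W. g w = v}. prob (W -` {w}) * ln (prob (?V -` {g w})))
        = prob (?V -` {v}) * ln (prob (?V -` {v}))"
      by (simp only: fib)
  qed auto
  finally show ?thesis unfolding ent_def by simp
qed

text \<open>Conditional mutual information is nonnegative. Writing \<open>H(U|V)\<close> for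
  \<open>ent (U,V) - ent V\<close>, this reads \<open>H(X,Y|Z) \<le> H(X|Z) + H(Y|Z)\<close>;
  equivalently, conditioning on more does not raise entropy.\<close>

lemma ent_submodular:
  assumes "simple_function \<mu> X" "simple_function \<mu> Y" "simple_function \<mu> Z"
  shows "ent \<mu> (\<lambda>x. (X x, Y x, Z x)) + ent \<mu> Z \<le> ent \<mu> (\<lambda>x. (X x, Z x)) + ent \<mu> (\<lambda>x. (Y x, Z x))"
proof -
  let ?W = "\<lambda>x. (X x, Y x, Z x)"
  let ?p = "\<lambda>U u. prob (U -` {u} \<inter> space \<mu>)"
  have W: "simple_function \<mu> ?W" using assms by (intro simple_function_Pair)
  have "0 \<le> info.conditional_mutual_information_Pow X Y Z"
    by (rule info.conditional_mutual_information_nonneg[OF assms])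
  also have "\<dots> = (\<Sum>(x, y, z)\<in>?W ` space \<mu>. ?p ?W (x, y, z) * log (exp 1) (?p ?W (x, y, z) /
      (?p (\<lambda>x. (X x, Z x)) (x, z) * (?p (\<lambda>x. (Y x, Z x)) (y, z) / ?p Z z))))"
    by (intro info.conditional_mutual_information_eq simple_distributedI refl simple_function_Pair assms measure_nonneg)
  also have "\<dots> = (\<Sum>w\<in>range ?W. prob (?W -` {w}) * ln (prob ((\<lambda>x. ?W x) -` {w}))
     + prob (?W -` {w}) * ln (prob ((\<lambda>x. snd (snd (?W x))) -` {snd (snd w)}))
     - prob (?W -` {w}) * ln (prob ((\<lambda>x. (fst (?W x), snd (snd (?W x)))) -` {(fst w, snd (snd w))}))
     - prob (?W -` {w}) * ln (prob ((\<lambda>x. (fst (snd (?W x)), snd (snd (?W x)))) -` {(fst (snd w), snd (snd w))})))"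
  proof (rule sum.cong, simp add: space_UNIV, clarify)
    fix u
    let ?a = "prob (?W -` {?W u})" and ?b = "prob (Z -` {Z u})"
      and ?c = "prob ((\<lambda>x. (X x, Z x)) -` {(X u, Z u)})" and ?d = "prob ((\<lambda>x. (Y x, Z x)) -` {(Y u, Z u)})"
    have "Z -` {Z u} \<in> events" "(\<lambda>x. (X x, Z x)) -` {(X u, Z u)} \<in> events" "(\<lambda>x. (Y x, Z x)) -` {(Y u, Z u)} \<in> events"
      using simple_functionD(2)[OF assms(3), of "{Z u}"]
        simple_functionD(2)[OF simple_function_Pair[OF assms(1,3)], of "{(X u, Z u)}"]
        simple_functionD(2)[OF simple_function_Pair[OF assms(2,3)], of "{(Y u, Z u)}"]
      by (simp_all add: space_UNIV)
    then have le: "?a \<le> ?b" "?a \<le> ?c" "?a \<le> ?d"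
      by (auto intro!: finite_measure_mono)
    show "?p ?W (X u, Y u, Z u) * log (exp 1) (?p ?W (X u, Y u, Z u) /
      (?p (\<lambda>x. (X x, Z x)) (X u, Z u) * (?p (\<lambda>x. (Y x, Z x)) (Y u, Z u) / ?p Z (Z u)))) =
      ?a * ln (prob ((\<lambda>x. ?W x) -` {?W u}))
     + ?a * ln (prob ((\<lambda>x. snd (snd (?W x))) -` {snd (snd (?W u))}))
     - ?a * ln (prob ((\<lambda>x. (fst (?W x), snd (snd (?W x)))) -` {(fst (?W u), snd (snd (?W u)))}))
     - ?a * ln (prob ((\<lambda>x. (fst (snd (?W x)), snd (snd (?W x)))) -` {(fst (snd (?W u)), snd (snd (?W u)))}))"
    \<comment> \<open>A null value contributes 0 on both sides. A value of positive probability has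
      positive marginals, so the logarithm of the quotient splits into four terms.\<close>
    proof (cases "?a = 0")
      case False
      then have "?a > 0" using measure_nonneg[of \<mu> "?W -` {?W u}"] by linarith
      with le have "?b > 0" "?c > 0" "?d > 0" by auto
      with \<open>?a > 0\<close> have eq: "ln (?a / (?c * (?d / ?b))) = ln ?a + ln ?b - ln ?c - ln ?d"
        by (simp add: ln_div ln_mult)
      have "?a * ln (?a / (?c * (?d / ?b))) = ?a * ln ?a + ?a * ln ?b - ?a * ln ?c - ?a * ln ?d"
        unfolding eq by (simp add: algebra_simps)
      then show ?thesis by (simp add: space_UNIV log_def)
    qed (simp add: space_UNIV)
  qed
  also have "\<dots> = - ent \<mu> ?W - ent \<mu> Z + ent \<mu> (\<lambda>x. (X x, Z x)) + ent \<mu> (\<lambda>x. (Y x, Z x))"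
    using ent_comp_sum[OF W, of "\<lambda>w. w"] ent_comp_sum[OF W, of "\<lambda>w. snd (snd w)"]
      ent_comp_sum[OF W, of "\<lambda>w. (fst w, snd (snd w))"] ent_comp_sum[OF W, of "\<lambda>w. (fst (snd w), snd (snd w))"]
    by (simp add: sum.distrib sum_subtractf)
  finally show ?thesis by simp
qed

lemma ent_le_card:
  assumes "simple_function \<mu> X"
  shows "ent \<mu> X \<le> ln (card (range X))"
  using info.entropy_le_card[OF simple_distributedI[OF assms measure_nonneg refl]] assms
  by (simp add: ent_eq_entropy log_def space_UNIV)

lemma ent_nonneg: "ent \<mu> X \<ge> 0"
proof -
  have "p * ln p \<le> 0" if "p = prob A" for p A
    using that prob_le_1[of A] measure_nonneg[of \<mu> A]
    by (cases "p = 0") (auto intro!: mult_nonneg_nonpos simp: ln_le_zero_iff order.strict_iff_order)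
  then show ?thesis unfolding ent_def by (simp add: sum_nonpos)
qed

lemma ent_const: "ent \<mu> (\<lambda>_. c) = 0"
  using prob_space by (simp add: ent_def space_UNIV)

text \<open>Submodularity over the trivial variable \<open>()\<close>, whose entropy is 0.\<close>

lemma ent_pair_le:
  assumes "simple_function \<mu> X" "simple_function \<mu> Y"
  shows "ent \<mu> (\<lambda>x. (X x, Y x)) \<le> ent \<mu> X + ent \<mu> Y"
proof -
  have p: "simple_function \<mu> (\<lambda>x. (X x, Y x))" using assms by (auto intro!: simple_function_Pair)
  have p': "simple_function \<mu> (\<lambda>x. (X x, ()))" "simple_function \<mu> (\<lambda>x. (Y x, ()))"
    "simple_function \<mu> (\<lambda>x. (X x, Y x, ()))" using assms by (auto intro!: simple_function_Pair)
  have "ent \<mu> (\<lambda>x. (X x, Y x, ())) + ent \<mu> (\<lambda>_. ()) \<le> ent \<mu> (\<lambda>x. (X x, ())) + ent \<mu> (\<lambda>x. (Y x, ()))"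
    by (rule ent_submodular) (use assms in auto)
  moreover have "ent \<mu> (\<lambda>x. (X x, Y x, ())) = ent \<mu> (\<lambda>x. (X x, Y x))"
    by (rule ent_cong_fibres) (use p in auto)
  moreover have "ent \<mu> (\<lambda>x. (X x, ())) = ent \<mu> X"
    by (rule ent_cong_fibres) (use assms in auto)
  moreover have "ent \<mu> (\<lambda>x. (Y x, ())) = ent \<mu> Y"
    by (rule ent_cong_fibres) (use assms in auto)
  ultimately show ?thesis by (simp add: ent_const)
qed

end

section \<open>Words along orbits and entropy rates\<close>

definition word :: "('a \<Rightarrow> 'a) \<Rightarrow> nat \<Rightarrow> ('a \<Rightarrow> 'b) \<Rightarrow> 'a \<Rightarrow> 'b list" where
  "word f n X x = map (\<lambda>i. X ((f ^^ i) x)) [0..<n]"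

lemma word_eq_iff: "word f n X x = word f n X y \<longleftrightarrow> (\<forall>i<n. X ((f ^^ i) x) = X ((f ^^ i) y))"
  by (auto simp: word_def list_eq_iff_nth_eq)

text \<open>As an infimum over countably many n, the rate lies below each quotient at once and
  depends measurably on the measure whenever the entropies of words do. For invariant measures
  Fekete's lemma identifies it with the limit in \<open>partition_rate\<close>.\<close>

definition rate :: "('a \<Rightarrow> 'a) \<Rightarrow> 'a measure \<Rightarrow> ('a \<Rightarrow> 'b) \<Rightarrow> real" where
  "rate f \<mu> X = (INF n\<in>{1..}. ent \<mu> (word f n X) / real n)"

text \<open>For a near-optimal N, write \<open>n = (n div N) * N + n mod N\<close>. The full blocks
  cost at most \<open>a N / N\<close> per step, and the remainder costs at most the constant B,
  which vanishes after division by n.\<close>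

lemma fekete:
  fixes a :: "nat \<Rightarrow> real"
  assumes nn: "\<And>n. a n \<ge> 0" and sub: "\<And>m n. a (m + n) \<le> a m + a n"
  shows "(\<lambda>n. a n / real n) \<longlonglongrightarrow> (INF n\<in>{1..}. a n / real n)"
proof (rule LIMSEQ_I)
  let ?L = "INF n\<in>{1..}. a n / real n"
  fix r :: real assume r: "r > 0"
  have bdd: "bdd_below ((\<lambda>n. a n / real n) ` {1..})"
    using nn by (intro bdd_belowI[of _ 0]) auto
  have low: "?L \<le> a n / real n" if "n \<ge> 1" for n
    using that by (intro cINF_lower[OF bdd]) auto
  obtain N where N: "N \<ge> 1" "a N / real N < ?L + r/2"
    using cINF_less_iff[OF _ bdd, of "?L + r/2"] r by fastforce
  define B where "B = (\<Sum>j<N. a j)"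
  have aB: "a j \<le> B" if "j < N" for j
    unfolding B_def using that nn by (intro member_le_sum) auto
  have mult: "a (q * N) \<le> real q * a N" if "q \<ge> 1" for q
    using that
  proof (induction q rule: dec_induct)
    case base then show ?case by simp
  next
    case (step q)
    have "a (N + q * N) \<le> a N + a (q * N)" by (rule sub)
    with step show ?case by (simp add: algebra_simps)
  qed
  have mult0: "a (q * N + j) \<le> real q * a N + B" if "j < N" for q j
  proof (cases "q = 0")
    case False
    then show ?thesis using mult[of q] sub[of "q * N" j] aB[OF that] by simp
  qed (use aB[OF that] in simp)
  have up: "a n / real n \<le> a N / real N + B / real n" if "n \<ge> 1" for n
  proof -
    have "a n = a (n div N * N + n mod N)" by simp
    also have "\<dots> \<le> real (n div N) * a N + B"
      by (rule mult0) (use N in auto)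
    also have "real (n div N) * a N \<le> (real n / real N) * a N"
      by (intro mult_right_mono nn) (simp add: of_nat_div_le_of_nat)
    finally show ?thesis using that by (simp add: field_simps)
  qed
  have "(\<lambda>n. B / real n) \<longlonglongrightarrow> 0" by (rule lim_const_over_n)
  then have "\<forall>\<^sub>F n in sequentially. B / real n < r/2"
    by (rule order_tendstoD) (use r in simp)
  then obtain n0 where n0: "\<And>n. n \<ge> n0 \<Longrightarrow> B / real n < r/2"
    by (auto simp: eventually_sequentially)
  show "\<exists>no. \<forall>n\<ge>no. norm (a n / real n - ?L) < r"
  proof (intro exI[of _ "max 1 n0"] allI impI)
    fix n assume "n \<ge> max 1 n0"
    then have "?L \<le> a n / real n" "a n / real n \<le> a N / real N + B / real n" "B / real n < r / 2"
      using low[of n] up[of n] n0[of n] by auto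
    with N(2) r show "norm (a n / real n - ?L) < r"
      unfolding real_norm_def by linarith
  qed
qed

lemma measurable_funpow:
  assumes "f \<in> measurable M M"
  shows "f ^^ n \<in> measurable M M"
proof (induction n)
  case 0
  show ?case by (simp add: id_def)
next
  case (Suc n)
  show ?case unfolding funpow.simps by (rule measurable_comp[OF Suc assms])
qed

lemma simple_function_comp_measurable:
  assumes "simple_function \<mu> X" "g \<in> measurable \<mu> \<mu>"
  shows "simple_function \<mu> (\<lambda>x. X (g x))"
proof -
  have "(\<lambda>x. X (g x)) ` space \<mu> \<subseteq> X ` space \<mu>"
    using measurable_space[OF assms(2)] by auto
  moreover have "(\<lambda>x. X (g x)) -` {y} \<inter> space \<mu> \<in> sets \<mu>" for y
  proof -
    have "X -` {y} \<inter> space \<mu> \<in> sets \<mu>"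
      using simple_functionD(2)[OF assms(1), of "{y}"] by simp
    from measurable_sets[OF assms(2) this]
    have "g -` (X -` {y} \<inter> space \<mu>) \<inter> space \<mu> \<in> sets \<mu>" .
    also have "g -` (X -` {y} \<inter> space \<mu>) \<inter> space \<mu> = (\<lambda>x. X (g x)) -` {y} \<inter> space \<mu>"
      using measurable_space[OF assms(2)] by auto
    finally show ?thesis .
  qed
  ultimately show ?thesis
    using simple_functionD(1)[OF assms(1)] by (auto simp: simple_function_def intro: finite_subset)
qed

lemma simple_function_word:
  assumes "simple_function \<mu> X" "f \<in> measurable \<mu> \<mu>"
  shows "simple_function \<mu> (word f n X)"
proof (induction n)
  case 0
  then show ?case by (simp add: word_def simple_function_const)
next
  case (Suc n)
  have "simple_function \<mu> (\<lambda>x. (word f n X x, X ((f ^^ n) x)))"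
    by (rule simple_function_Pair[OF Suc simple_function_comp_measurable[OF assms(1) measurable_funpow[OF assms(2)]]])
  from simple_function_compose[OF this, of "\<lambda>(w, l). w @ [l]"]
  show ?case by (simp add: word_def[abs_def] comp_def)
qed

locale inv_sys =
  fixes f :: "'a::topological_space \<Rightarrow> 'a" and \<mu> :: "'a measure"
  assumes f_borel: "f \<in> borel \<rightarrow>\<^sub>M borel" and inv: "\<mu> \<in> invariant_measures f"
begin

lemma sets_\<mu>: "sets \<mu> = sets borel"
  using inv by (auto simp: invariant_measures_def)

lemma meas_cong: "measurable \<mu> M = measurable borel M" "measurable N \<mu> = measurable N borel"
  by (auto intro!: measurable_cong_sets simp: sets_\<mu>)

lemma f_meas: "f \<in> measurable \<mu> \<mu>"
  using f_borel by (simp add: meas_cong)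

sublocale full_prob \<mu>
proof -
  interpret prob_space \<mu> using inv by (auto simp: invariant_measures_def)
  show "full_prob \<mu>"
    by unfold_locales (use sets_eq_imp_space_eq[OF sets_\<mu>] in simp)
qed

lemma distr_f: "distr \<mu> \<mu> f = \<mu>"
proof -
  have "distr \<mu> \<mu> f = distr \<mu> borel f" by (rule distr_cong) (auto simp: sets_\<mu>)
  then show ?thesis using inv by (auto simp: invariant_measures_def)
qed

lemma distr_funpow: "distr \<mu> \<mu> (f ^^ n) = \<mu>"
proof (induction n)
  case 0
  show ?case by (simp add: distr_id2 id_def)
next
  case (Suc n)
  have "distr \<mu> \<mu> (f \<circ> (f ^^ n)) = distr (distr \<mu> \<mu> (f ^^ n)) \<mu> f"
    by (rule distr_distr[symmetric]) (auto intro: f_meas measurable_funpow)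
  then show ?case by (simp add: Suc distr_f comp_def)
qed

lemma prob_funpow:
  assumes "A \<in> sets borel"
  shows "prob ((f ^^ n) -` A) = prob A"
proof -
  have "prob A = measure (distr \<mu> \<mu> (f ^^ n)) A" by (simp add: distr_funpow)
  also have "\<dots> = prob ((f ^^ n) -` A \<inter> space \<mu>)"
    by (rule measure_distr) (auto intro: measurable_funpow f_meas simp: sets_\<mu> assms)
  finally show ?thesis by (simp add: space_UNIV)
qed

lemma ent_funpow:
  assumes X: "simple_function \<mu> X"
  shows "ent \<mu> (\<lambda>x. X ((f ^^ n) x)) = ent \<mu> X"
proof -
  let ?Y = "\<lambda>x. X ((f ^^ n) x)"
  have p: "prob (?Y -` {l}) = prob (X -` {l})" for l
  proof -
    have "X -` {l} \<in> sets borel"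
      using simple_functionD(2)[OF X, of "{l}"] by (simp add: space_UNIV sets_\<mu>)
    moreover have "?Y -` {l} = (f ^^ n) -` (X -` {l})" by auto
    ultimately show ?thesis using prob_funpow by simp
  qed
  \<comment> \<open>\<open>f ^^ n\<close> need not be surjective, so some labels of X may be missed.
    Their fibres are empty and contribute 0.\<close>
  have "(\<Sum>l\<in>range X. prob (?Y -` {l}) * ln (prob (?Y -` {l})))
      = (\<Sum>l\<in>range ?Y. prob (?Y -` {l}) * ln (prob (?Y -` {l})))"
  proof (rule sum.mono_neutral_right)
    show "finite (range X)" using simple_functionD(1)[OF X] by (simp add: space_UNIV)
    show "\<forall>l\<in>range X - range ?Y. prob (?Y -` {l}) * ln (prob (?Y -` {l})) = 0"
    proof
      fix l assume "l \<in> range X - range ?Y"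
      then have "?Y z \<noteq> l" for z by blast
      then have "?Y -` {l} = {}" by blast
      then show "prob (?Y -` {l}) * ln (prob (?Y -` {l})) = 0" by simp
    qed
  qed auto
  then show ?thesis unfolding ent_def p by simp
qed

lemma simple_word: "simple_function \<mu> X \<Longrightarrow> simple_function \<mu> (word f n X)"
  by (rule simple_function_word[OF _ f_meas])

text \<open>A word of length m + n is a word of length m followed by one of length n read from
  \<open>(f ^^ m) x\<close>; by invariance the shift of the starting point leaves the entropy of the
  second word unchanged. This is the subadditivity required by \<open>fekete\<close>.\<close>

lemma ent_word_add:
  assumes X: "simple_function \<mu> X"
  shows "ent \<mu> (word f (m + n) X) \<le> ent \<mu> (word f m X) + ent \<mu> (word f n X)"
proof -
  let ?P = "\<lambda>x. (word f m X x, word f n X ((f ^^ m) x))"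
  have s: "simple_function \<mu> (\<lambda>x. word f n X ((f ^^ m) x))"
    by (rule simple_function_comp_measurable[OF simple_word[OF X] measurable_funpow[OF f_meas]])
  have "ent \<mu> (word f (m + n) X) \<le> ent \<mu> ?P"
  proof (rule ent_mono)
    show "simple_function \<mu> ?P" by (intro simple_function_Pair simple_word X s)
    fix x y assume "?P x = ?P y"
    then have "\<And>i. i < m \<Longrightarrow> X ((f ^^ i) x) = X ((f ^^ i) y)"
       and 2: "\<And>i. i < n \<Longrightarrow> X ((f ^^ (i + m)) x) = X ((f ^^ (i + m)) y)"
      by (auto simp: word_eq_iff funpow_add)
    moreover have "X ((f ^^ i) x) = X ((f ^^ i) y)" if "i < m + n" "\<not> i < m" for i
      using 2[of "i - m"] that by simp
    ultimately show "word f (m + n) X x = word f (m + n) X y"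
      unfolding word_eq_iff by blast
  qed
  also have "\<dots> \<le> ent \<mu> (word f m X) + ent \<mu> (\<lambda>x. word f n X ((f ^^ m) x))"
    by (intro ent_pair_le simple_word X s)
  also have "ent \<mu> (\<lambda>x. word f n X ((f ^^ m) x)) = ent \<mu> (word f n X)"
    by (intro ent_funpow simple_word X)
  finally show ?thesis by simp
qed

lemma rate_tendsto:
  assumes X: "simple_function \<mu> X"
  shows "(\<lambda>n. ent \<mu> (word f n X) / real n) \<longlonglongrightarrow> rate f \<mu> X"
  unfolding rate_def by (rule fekete) (auto intro: ent_nonneg ent_word_add X)

lemma rate_le:
  assumes "n \<ge> 1"
  shows "rate f \<mu> X \<le> ent \<mu> (word f n X) / real n"
  unfolding rate_def using assms
  by (intro cINF_lower bdd_belowI[of _ 0]) (auto simp: ent_nonneg)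

lemma rate_mono:
  assumes "simple_function \<mu> Y" "\<And>x y. Y x = Y y \<Longrightarrow> X x = X y"
  shows "rate f \<mu> X \<le> rate f \<mu> Y"
  unfolding rate_def
proof (rule cINF_mono)
  show "bdd_below ((\<lambda>n. ent \<mu> (word f n X) / real n) ` {1..})"
    by (intro bdd_belowI[of _ 0]) (auto simp: ent_nonneg)
  fix n :: nat assume "n \<in> {1..}"
  moreover have "ent \<mu> (word f n X) \<le> ent \<mu> (word f n Y)"
    by (rule ent_mono[OF simple_word[OF assms(1)]]) (unfold word_eq_iff, blast intro: assms(2))
  ultimately show "\<exists>m\<in>{1..}. ent \<mu> (word f m X) / real m \<le> ent \<mu> (word f n Y) / real n"
    by (auto intro!: bexI[of _ n] divide_right_mono)
qed auto

end

section \<open>Partitions as fibres of finite-valued functions\<close>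

definition cell :: "'a set set \<Rightarrow> 'a \<Rightarrow> 'a set" where
  "cell \<xi> x = (THE A. A \<in> \<xi> \<and> x \<in> A)"

lemma cell_eqI:
  assumes "partition_on UNIV \<xi>" "A \<in> \<xi>" "x \<in> A"
  shows "cell \<xi> x = A"
  unfolding cell_def
  by (rule the_equality) (use assms in \<open>auto simp: partition_on_def disjoint_def\<close>)

lemma cell_props:
  assumes "partition_on UNIV \<xi>"
  shows "cell \<xi> x \<in> \<xi>" "x \<in> cell \<xi> x"
proof -
  obtain A where "A \<in> \<xi>" "x \<in> A" using assms by (auto simp: partition_on_def)
  with cell_eqI[OF assms this] show "cell \<xi> x \<in> \<xi>" "x \<in> cell \<xi> x" by auto
qed

text \<open>A block of the join is an intersection of chosen blocks, and any point of it determines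
  all the choices. Empty intersections are discarded on both sides: by
  \<open>common_refinement\<close>, and because only words that occur are used.\<close>

lemma iterated_join_eq:
  assumes \<xi>: "partition_on UNIV \<xi>"
  shows "iterated_join f n \<xi> = (\<lambda>l. word f n (cell \<xi>) -` {l}) ` range (word f n (cell \<xi>))"
proof -
  let ?P = "\<lambda>i. (\<lambda>A. (f ^^ i) -` A) ` \<xi>"
  let ?w = "word f n (cell \<xi>)"
  have fib: "?w -` {?w x} = (\<Inter>i<n. (f ^^ i) -` cell \<xi> ((f ^^ i) x))" for x
  proof -
    have "cell \<xi> b = cell \<xi> a \<longleftrightarrow> b \<in> cell \<xi> a" for a b
      using cell_props[OF \<xi>] cell_eqI[OF \<xi>] by metis
    then show ?thesis by (auto simp: word_eq_iff)
  qed
  have sub: "C \<in> common_refinement (?P ` {..<n}) \<longleftrightarrow> (\<exists>x. C = ?w -` {?w x})" for C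
  proof
    assume "C \<in> common_refinement (?P ` {..<n})"
    then obtain F where F: "F \<in> (\<Pi> P\<in>?P ` {..<n}. P)" and C: "C = \<Inter> (F ` ?P ` {..<n})" and "C \<noteq> {}"
      by (auto simp: common_refinement)
    then obtain x where x: "x \<in> C" by auto
    have "F (?P i) = (f ^^ i) -` cell \<xi> ((f ^^ i) x)" if "i < n" for i
    proof -
      have "F (?P i) \<in> ?P i" using F that by auto
      moreover have "x \<in> F (?P i)" using x C that by auto
      ultimately show ?thesis using cell_eqI[OF \<xi>] by fastforce
    qed
    then have "C = ?w -` {?w x}" unfolding C fib by auto
    then show "\<exists>x. C = ?w -` {?w x}" by blast
  next
    assume "\<exists>x. C = ?w -` {?w x}"
    then obtain x where C: "C = ?w -` {?w x}" by blast
    \<comment> \<open>Choice functions take a partition, not a time, as argument, and different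
      times may give the same partition. Picking the block around x depends on the partition alone,
      so it is consistent.\<close>
    define F where "F P = (THE B. B \<in> P \<and> x \<in> B)" for P
    have F: "F (?P i) = (f ^^ i) -` cell \<xi> ((f ^^ i) x)" if "i < n" for i
      unfolding F_def
    proof (rule the_equality)
      show "(f ^^ i) -` cell \<xi> ((f ^^ i) x) \<in> ?P i \<and> x \<in> (f ^^ i) -` cell \<xi> ((f ^^ i) x)"
        using cell_props[OF \<xi>] by auto
      fix B assume "B \<in> ?P i \<and> x \<in> B"
      then obtain A where A: "A \<in> \<xi>" "B = (f ^^ i) -` A" "(f ^^ i) x \<in> A" by auto
      then show "B = (f ^^ i) -` cell \<xi> ((f ^^ i) x)" using cell_eqI[OF \<xi> A(1,3)] by simp
    qed
    have "F \<in> (\<Pi> P\<in>?P ` {..<n}. P)" using F cell_props[OF \<xi>] by auto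
    moreover have "C = \<Inter> (F ` ?P ` {..<n})" unfolding C fib using F by auto
    moreover have "C \<noteq> {}" using C by auto
    ultimately show "C \<in> common_refinement (?P ` {..<n})"
      unfolding common_refinement by blast
  qed
  show ?thesis unfolding iterated_join_def using sub by (auto simp: set_eq_iff image_iff)
qed

lemma partition_entropy_fibres:
  "partition_entropy \<mu> ((\<lambda>l. X -` {l}) ` range X) = ent \<mu> X"
proof -
  have "inj_on (\<lambda>l. X -` {l}) (range X)" by (auto simp: inj_on_def)
  then show ?thesis unfolding partition_entropy_def ent_def by (simp add: sum.reindex)
qed

context inv_sys
begin

lemma simple_cell:
  assumes "finite \<xi>" "\<xi> \<subseteq> sets borel" "partition_on UNIV \<xi>"
  shows "simple_function \<mu> (cell \<xi>)"
proof -
  have "cell \<xi> -` {A} \<in> sets borel" for A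
  proof (cases "A \<in> \<xi>")
    case True
    then have "cell \<xi> -` {A} = A" using cell_props[OF assms(3)] cell_eqI[OF assms(3)] by auto
    then show ?thesis using True assms by auto
  next
    case False
    then have "cell \<xi> -` {A} = {}" using cell_props[OF assms(3)] by auto
    then show ?thesis by simp
  qed
  moreover have "finite (range (cell \<xi>))"
    by (rule finite_subset[OF _ assms(1)]) (auto simp: cell_props[OF assms(3)])
  ultimately show ?thesis by (simp add: simple_function_def space_UNIV sets_\<mu>)
qed

lemma partition_rate_eq:
  assumes "finite \<xi>" "\<xi> \<subseteq> sets borel" "partition_on UNIV \<xi>"
  shows "partition_rate f \<mu> \<xi> = ereal (rate f \<mu> (cell \<xi>))"
  unfolding partition_rate_def iterated_join_eq[OF assms(3)] partition_entropy_fibres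
  by (rule limI) (use rate_tendsto[OF simple_cell[OF assms]] in simp)

lemma fibres_partition:
  assumes "simple_function \<mu> X"
  defines "\<xi> \<equiv> (\<lambda>l. X -` {l}) ` range X"
  shows "finite \<xi>" "\<xi> \<subseteq> sets borel" "partition_on UNIV \<xi>"
proof -
  show "finite \<xi>" using simple_functionD(1)[OF assms(1)] by (simp add: \<xi>_def space_UNIV)
  show "\<xi> \<subseteq> sets borel" using simple_functionD(2)[OF assms(1)] by (auto simp: \<xi>_def space_UNIV sets_\<mu>)
  show "partition_on UNIV \<xi>" by (auto simp: \<xi>_def partition_on_def disjoint_def)
qed

text \<open>Labels may have any type, while the supremum runs over partitions. The partition into
  fibres of X bridges the two, since its cell function separates the values of X.\<close>

lemma rate_le_measure_entropy:
  assumes "simple_function \<mu> X"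
  shows "ereal (rate f \<mu> X) \<le> measure_entropy f \<mu>"
proof -
  let ?\<xi> = "(\<lambda>l. X -` {l}) ` range X"
  note \<xi> = fibres_partition[OF assms]
  have "rate f \<mu> X \<le> rate f \<mu> (cell ?\<xi>)"
  proof (rule rate_mono[OF simple_cell[OF \<xi>]])
    fix x y assume "cell ?\<xi> x = cell ?\<xi> y"
    moreover have "cell ?\<xi> z = X -` {X z}" for z by (rule cell_eqI[OF \<xi>(3)]) auto
    ultimately show "X x = X y" by auto
  qed
  also have "ereal \<dots> = partition_rate f \<mu> ?\<xi>" by (rule partition_rate_eq[OF \<xi>, symmetric])
  also have "\<dots> \<le> measure_entropy f \<mu>"
    unfolding measure_entropy_def by (rule SUP_upper) (use \<xi> in auto)
  finally show ?thesis by simp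
qed

lemma measure_entropy_le:
  assumes "\<And>\<xi>. finite \<xi> \<Longrightarrow> \<xi> \<subseteq> sets borel \<Longrightarrow> partition_on UNIV \<xi> \<Longrightarrow> ereal (rate f \<mu> (cell \<xi>)) \<le> h"
  shows "measure_entropy f \<mu> \<le> h"
  unfolding measure_entropy_def using assms by (intro SUP_least) (auto simp: partition_rate_eq)

end

subsection \<open>Mixtures of measures\<close>

text \<open>Concavity of \<open>- p ln p\<close>: its graph lies below the tangent at the mean P,
  which is \<open>- p ln P + P - p\<close>. The linear error \<open>P - p\<close> averages to
  0.\<close>

lemma entropy_term_concave:
  fixes w p :: "'j \<Rightarrow> real"
  assumes J: "finite J" and w: "\<And>j. j \<in> J \<Longrightarrow> w j \<ge> 0" "(\<Sum>j\<in>J. w j) = 1"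
    and p: "\<And>j. j \<in> J \<Longrightarrow> p j \<ge> 0"
  shows "(\<Sum>j\<in>J. w j * (- (p j * ln (p j)))) \<le> - ((\<Sum>j\<in>J. w j * p j) * ln (\<Sum>j\<in>J. w j * p j))"
proof -
  define P where "P = (\<Sum>j\<in>J. w j * p j)"
  have P0: "P \<ge> 0" unfolding P_def using w p by (intro sum_nonneg) auto
  show ?thesis
  proof (cases "P = 0")
    case True
    then have "w j * p j = 0" if "j \<in> J" for j
      using that w p J unfolding P_def by (subst (asm) sum_nonneg_eq_0_iff) auto
    then have "w j * (- (p j * ln (p j))) = 0" if "j \<in> J" for j
      using that by auto
    then have "(\<Sum>j\<in>J. w j * (- (p j * ln (p j)))) = 0" by (intro sum.neutral) blast
    then show ?thesis using True by (simp add: P_def)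
  next
    case False
    with P0 have P: "P > 0" by simp
    have "- (p j * ln (p j)) \<le> - (p j * ln P) + (P - p j)" if "j \<in> J" for j
    proof (cases "p j = 0")
      case False
      with p[OF that] have pj: "p j > 0" by simp
      have "ln (P / p j) \<le> P / p j - 1" using P pj by (intro ln_le_minus_one) simp
      then have "p j * ln (P / p j) \<le> p j * (P / p j - 1)" using pj by (intro mult_left_mono) auto
      also have "\<dots> = P - p j" using pj by (simp add: field_simps)
      finally show ?thesis using P pj by (simp add: ln_div algebra_simps)
    qed (use P in simp)
    then have "(\<Sum>j\<in>J. w j * (- (p j * ln (p j)))) \<le> (\<Sum>j\<in>J. w j * (- (p j * ln P) + (P - p j)))"
      using w by (intro sum_mono mult_left_mono) auto
    also have "\<dots> = - (\<Sum>j\<in>J. w j * p j) * ln P + P * (\<Sum>j\<in>J. w j) - (\<Sum>j\<in>J. w j * p j)"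
      by (simp add: algebra_simps sum.distrib sum_subtractf sum_distrib_left sum_distrib_right sum_negf)
    also have "\<dots> = - (P * ln P)" using w by (simp add: P_def)
    finally show ?thesis by (simp add: P_def)
  qed
qed

text \<open>Each nonzero term satisfies \<open>w j * p j \<le> P\<close>, so \<open>- ln P\<close>
  is at most \<open>- ln (w j) - ln (p j)\<close>. The weights are arbitrary nonnegative numbers
  because \<open>xlnx_close\<close> takes them all equal to 1.\<close>

lemma entropy_term_mixture_upper:
  fixes w p :: "'j \<Rightarrow> real"
  assumes J: "finite J" and w: "\<And>j. j \<in> J \<Longrightarrow> w j \<ge> 0" and p: "\<And>j. j \<in> J \<Longrightarrow> p j \<ge> 0"
  shows "- ((\<Sum>j\<in>J. w j * p j) * ln (\<Sum>j\<in>J. w j * p j))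
    \<le> (\<Sum>j\<in>J. w j * (- (p j * ln (p j))) + p j * (- (w j * ln (w j))))"
proof -
  define P where "P = (\<Sum>j\<in>J. w j * p j)"
  have "- (w j * p j * ln P) \<le> w j * (- (p j * ln (p j))) + p j * (- (w j * ln (w j)))" if j: "j \<in> J" for j
  proof (cases "w j * p j = 0")
    case False
    then have pos: "w j > 0" "p j > 0" using w[OF j] p[OF j] by (auto simp: order.strict_iff_order)
    have "w j * p j \<le> P" unfolding P_def using w p J by (intro member_le_sum j) auto
    then have "ln (w j * p j) \<le> ln P" using pos by (intro ln_mono) auto
    then have "w j * p j * ln (w j * p j) \<le> w j * p j * ln P" using pos by (intro mult_left_mono) auto
    then show ?thesis using pos by (simp add: ln_mult algebra_simps)
  qed auto
  then have "(\<Sum>j\<in>J. - (w j * p j * ln P)) \<le> (\<Sum>j\<in>J. w j * (- (p j * ln (p j))) + p j * (- (w j * ln (w j))))"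
    by (rule sum_mono)
  then show ?thesis by (simp add: P_def sum_negf sum_distrib_right)
qed

lemma (in full_prob) sum_fibres:
  assumes X: "simple_function \<mu> X"
  shows "(\<Sum>l\<in>range X. prob (X -` {l})) = 1"
proof -
  have "prob (\<Union>l\<in>range X. X -` {l}) = (\<Sum>l\<in>range X. prob (X -` {l}))"
    by (rule finite_measure_finite_Union)
      (use simple_functionD[OF X] in \<open>auto simp: space_UNIV disjoint_family_on_def\<close>)
  moreover have "(\<Union>l\<in>range X. X -` {l}) = space \<mu>" by (auto simp: space_UNIV)
  ultimately show ?thesis using prob_space by simp
qed

text \<open>The two term estimates, summed over all labels. The gap between the bounds is the
  entropy of the weights, which does not depend on X; for words of length n it disappears on
  division by n.\<close>

lemma ent_mixture:
  fixes \<nu> :: "'j \<Rightarrow> 'a measure"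
  assumes J: "finite J" and w: "\<And>j. j \<in> J \<Longrightarrow> w j \<ge> 0" "(\<Sum>j\<in>J. w j) = 1"
    and \<nu>: "\<And>j. j \<in> J \<Longrightarrow> full_prob (\<nu> j)" "\<And>j. j \<in> J \<Longrightarrow> simple_function (\<nu> j) X"
    and \<mu>: "\<And>l. measure \<mu> (X -` {l}) = (\<Sum>j\<in>J. w j * measure (\<nu> j) (X -` {l}))"
  shows "(\<Sum>j\<in>J. w j * ent (\<nu> j) X) \<le> ent \<mu> X"
    and "ent \<mu> X \<le> (\<Sum>j\<in>J. w j * ent (\<nu> j) X) + (\<Sum>j\<in>J. - (w j * ln (w j)))"
proof -
  let ?p = "\<lambda>j l. measure (\<nu> j) (X -` {l})"
  have eq: "(\<Sum>j\<in>J. w j * ent (\<nu> j) X) = (\<Sum>l\<in>range X. \<Sum>j\<in>J. w j * (- (?p j l * ln (?p j l))))"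
    by (subst sum.swap) (simp add: ent_def sum_distrib_left sum_negf)
  have eq\<mu>: "ent \<mu> X = (\<Sum>l\<in>range X. - ((\<Sum>j\<in>J. w j * ?p j l) * ln (\<Sum>j\<in>J. w j * ?p j l)))"
    by (simp add: ent_def \<mu> sum_negf)
  show "(\<Sum>j\<in>J. w j * ent (\<nu> j) X) \<le> ent \<mu> X"
    unfolding eq eq\<mu> by (intro sum_mono entropy_term_concave J w) auto
  have "ent \<mu> X \<le> (\<Sum>l\<in>range X. \<Sum>j\<in>J. w j * (- (?p j l * ln (?p j l))) + ?p j l * (- (w j * ln (w j))))"
    unfolding eq\<mu> by (intro sum_mono entropy_term_mixture_upper J w) auto
  also have "\<dots> = (\<Sum>j\<in>J. w j * ent (\<nu> j) X) + (\<Sum>l\<in>range X. \<Sum>j\<in>J. ?p j l * (- (w j * ln (w j))))"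
    unfolding eq by (simp only: sum.distrib)
  also have "(\<Sum>l\<in>range X. \<Sum>j\<in>J. ?p j l * (- (w j * ln (w j)))) = (\<Sum>j\<in>J. (\<Sum>l\<in>range X. ?p j l) * (- (w j * ln (w j))))"
    by (subst sum.swap) (simp add: sum_distrib_right sum_negf)
  also have "\<dots> = (\<Sum>j\<in>J. - (w j * ln (w j)))"
    by (rule sum.cong) (use full_prob.sum_fibres[OF \<nu>] in auto)
  finally show "ent \<mu> X \<le> (\<Sum>j\<in>J. w j * ent (\<nu> j) X) + (\<Sum>j\<in>J. - (w j * ln (w j)))" .
qed

context inv_sys
begin

lemma simple_iff: "simple_function \<mu> X \<longleftrightarrow> simple_function borel X"
  by (rule simple_function_cong_algebra) (auto simp: sets_\<mu> space_UNIV)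

lemma events_vimage: "simple_function borel X \<Longrightarrow> X -` A \<in> sets borel"
  using simple_functionD(2)[of borel X A] by simp

end

lemma inv_sys_imp_full_prob:
  assumes "inv_sys f \<mu>" shows "full_prob \<mu>"
proof -
  interpret inv_sys f \<mu> by fact
  show ?thesis by (rule full_prob_axioms)
qed

text \<open>A finite family covers both applications: two components give affinity of entropy, and
  the pieces of a finite invariant partition are the components in
  \<open>rate_le_kernel_ent\<close>.\<close>

lemma rate_mixture:
  fixes \<nu> :: "'j \<Rightarrow> 'a::topological_space measure"
  assumes J: "finite J" and w: "\<And>j. j \<in> J \<Longrightarrow> w j \<ge> 0" "(\<Sum>j\<in>J. w j) = 1"
    and \<nu>: "\<And>j. j \<in> J \<Longrightarrow> inv_sys f (\<nu> j)" and \<mu>: "inv_sys f \<mu>"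
    and mix: "\<And>A. A \<in> sets borel \<Longrightarrow> measure \<mu> A = (\<Sum>j\<in>J. w j * measure (\<nu> j) A)"
    and X: "simple_function borel X"
  shows "rate f \<mu> X = (\<Sum>j\<in>J. w j * rate f (\<nu> j) X)"
proof -
  interpret inv_sys f \<mu> by fact
  let ?C = "\<Sum>j\<in>J. - (w j * ln (w j))"
  have s: "simple_function borel (word f n X)" for n
    using simple_word X by (simp add: simple_iff)
  note m = ent_mixture[where J = J and w = w and \<nu> = \<nu> and \<mu> = \<mu>]
  have lim: "(\<lambda>n. ent (\<nu> j) (word f n X) / real n) \<longlonglongrightarrow> rate f (\<nu> j) X" if "j \<in> J" for j
    using inv_sys.rate_tendsto[OF \<nu>[OF that]] X inv_sys.simple_iff[OF \<nu>[OF that]] by blast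
  have "(\<Sum>j\<in>J. w j * ent (\<nu> j) (word f n X)) \<le> ent \<mu> (word f n X) \<and>
      ent \<mu> (word f n X) \<le> (\<Sum>j\<in>J. w j * ent (\<nu> j) (word f n X)) + ?C" for n
  proof -
    have 1: "full_prob (\<nu> j)" if "j \<in> J" for j
      using \<nu>[OF that] by (rule inv_sys_imp_full_prob)
    have 2: "simple_function (\<nu> j) (word f n X)" if "j \<in> J" for j
      using s inv_sys.simple_iff[OF \<nu>[OF that]] by blast
    have 3: "measure \<mu> (word f n X -` {l}) = (\<Sum>j\<in>J. w j * measure (\<nu> j) (word f n X -` {l}))" for l
      by (rule mix) (rule events_vimage[OF s])
    show ?thesis using m[OF J w 1 2 3] by blast
  qed note b = this
  have b1: "(\<Sum>j\<in>J. w j * (ent (\<nu> j) (word f n X) / real n)) \<le> ent \<mu> (word f n X) / real n" for n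
    using divide_right_mono[OF conjunct1[OF b], of "real n" n] by (simp add: sum_divide_distrib)
  have b2: "ent \<mu> (word f n X) / real n \<le> (\<Sum>j\<in>J. w j * (ent (\<nu> j) (word f n X) / real n)) + ?C / real n" for n
    using divide_right_mono[OF conjunct2[OF b], of "real n" n] by (simp add: sum_divide_distrib add_divide_distrib)
  have l1: "(\<lambda>n. \<Sum>j\<in>J. w j * (ent (\<nu> j) (word f n X) / real n)) \<longlonglongrightarrow> (\<Sum>j\<in>J. w j * rate f (\<nu> j) X)"
    by (intro tendsto_sum tendsto_mult lim tendsto_const)
  have l2: "(\<lambda>n. (\<Sum>j\<in>J. w j * (ent (\<nu> j) (word f n X) / real n)) + ?C / real n) \<longlonglongrightarrow> (\<Sum>j\<in>J. w j * rate f (\<nu> j) X) + 0"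
    by (intro tendsto_add l1 lim_const_over_n)
  have "(\<lambda>n. ent \<mu> (word f n X) / real n) \<longlonglongrightarrow> (\<Sum>j\<in>J. w j * rate f (\<nu> j) X)"
    by (rule tendsto_sandwich[OF _ _ l1]) (use b1 b2 l2 in auto)
  moreover have "(\<lambda>n. ent \<mu> (word f n X) / real n) \<longlonglongrightarrow> rate f \<mu> X"
    using rate_tendsto X simple_iff by blast
  ultimately show ?thesis by (rule LIMSEQ_unique[symmetric])
qed

lemma measure_mix_measure:
  assumes "prob_space \<mu>" "prob_space \<nu>" "sets \<mu> = sets \<nu>" "A \<in> sets \<mu>" "t \<in> {0..1}"
  shows "measure (mix_measure t \<mu> \<nu>) A = (1 - t) * measure \<mu> A + t * measure \<nu> A"
proof -
  interpret \<mu>: prob_space \<mu> by fact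
  interpret \<nu>: prob_space \<nu> by fact
  have "emeasure (mix_measure t \<mu> \<nu>) A = ennreal ((1 - t) * measure \<mu> A + t * measure \<nu> A)"
    using assms
    by (simp add: emeasure_mix_measure \<mu>.emeasure_eq_measure \<nu>.emeasure_eq_measure ennreal_mult ennreal_plus)
  then show ?thesis using assms by (intro measure_eq_emeasure_eq_ennreal) auto
qed

lemma mix_measure_invariant:
  assumes f: "f \<in> borel \<rightarrow>\<^sub>M borel" and \<mu>: "\<mu> \<in> invariant_measures f" and \<nu>: "\<nu> \<in> invariant_measures f" and t: "t \<in> {0..1}"
  shows "mix_measure t \<mu> \<nu> \<in> invariant_measures f"
proof -
  interpret \<mu>: inv_sys f \<mu> using f \<mu> by (rule inv_sys.intro)
  interpret \<nu>: inv_sys f \<nu> using f \<nu> by (rule inv_sys.intro)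
  let ?M = "mix_measure t \<mu> \<nu>"
  have s: "sets ?M = sets borel" by (simp add: sets_mix_measure \<mu>.sets_\<mu>)
  have e: "emeasure ?M A = ennreal (1 - t) * emeasure \<mu> A + ennreal t * emeasure \<nu> A" if "A \<in> sets borel" for A
    using that by (intro emeasure_mix_measure) (auto simp: \<mu>.sets_\<mu> \<nu>.sets_\<mu>)
  have sp: "space ?M = UNIV" using sets_eq_imp_space_eq[OF s] by simp
  have "emeasure ?M UNIV = ennreal (1 - t) + ennreal t"
    using e[of UNIV] \<mu>.emeasure_space_1 \<nu>.emeasure_space_1 by (simp add: \<mu>.space_UNIV \<nu>.space_UNIV)
  also have "\<dots> = 1" using t by (simp flip: ennreal_plus)
  finally have "prob_space ?M" by (intro prob_spaceI) (simp add: sp)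
  moreover have "distr ?M borel f = ?M"
  proof (rule measure_eqI)
    fix A assume "A \<in> sets (distr ?M borel f)"
    then have A: "A \<in> sets borel" by simp
    have fA: "f -` A \<in> sets borel" using measurable_sets[OF f A] by simp
    have fM: "f \<in> ?M \<rightarrow>\<^sub>M borel" using f by (simp add: measurable_cong_sets[OF s refl])
    have 1: "emeasure N (f -` A) = emeasure N A" if "inv_sys f N" for N
    proof -
      interpret N: inv_sys f N by fact
      have "emeasure (distr N N f) A = emeasure N (f -` A \<inter> space N)"
        by (rule emeasure_distr) (auto simp: N.f_meas A N.sets_\<mu>)
      then show ?thesis by (simp add: N.distr_f N.space_UNIV)
    qed
    have "emeasure (distr ?M borel f) A = emeasure ?M (f -` A)"
      using emeasure_distr[OF fM A] by (simp add: sp)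
    also have "\<dots> = emeasure ?M A"
      using e[OF fA] e[OF A] 1[OF \<mu>.inv_sys_axioms] 1[OF \<nu>.inv_sys_axioms] by simp
    finally show "emeasure (distr ?M borel f) A = emeasure ?M A" .
  qed (simp add: s)
  ultimately show ?thesis by (simp add: invariant_measures_def s)
qed

text \<open>The mixture is a Bernoulli choice followed by sampling from the chosen measure, so
  integrals against it follow from the rule for \<open>bind\<close>.\<close>

lemma integral_mix_measure:
  fixes q :: "'a \<Rightarrow> real"
  assumes "prob_space \<mu>" "prob_space \<nu>" "sets \<mu> = sets \<nu>" and t: "t \<in> {0..1}"
    and q: "q \<in> borel_measurable \<mu>" and B: "\<And>x. \<bar>q x\<bar> \<le> B"
  shows "integral\<^sup>L (mix_measure t \<mu> \<nu>) q = (1 - t) * integral\<^sup>L \<mu> q + t * integral\<^sup>L \<nu> q"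
proof -
  interpret \<mu>: prob_space \<mu> by fact
  interpret \<nu>: prob_space \<nu> by fact
  let ?K = "\<lambda>b. if b then \<nu> else \<mu>" and ?P = "measure_pmf (bernoulli_pmf t)"
  have K: "?K \<in> ?P \<rightarrow>\<^sub>M subprob_algebra \<mu>"
    using assms by (auto simp: measurable_def space_subprob_algebra \<mu>.subprob_space_axioms \<nu>.subprob_space_axioms)
  have "mix_measure t \<mu> \<nu> = ?P \<bind> ?K"
  proof (rule measure_eqI)
    show s: "sets (mix_measure t \<mu> \<nu>) = sets (?P \<bind> ?K)"
      by (subst sets_bind[where N = \<mu>]) (use assms in \<open>auto simp: sets_mix_measure\<close>)
    fix A assume "A \<in> sets (mix_measure t \<mu> \<nu>)"
    then have A: "A \<in> sets \<mu>" by (simp add: sets_mix_measure)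
    have "emeasure (?P \<bind> ?K) A = (\<integral>\<^sup>+b. emeasure (?K b) A \<partial>?P)"
      by (rule emeasure_bind[OF _ K A]) simp
    also have "\<dots> = ennreal (1 - t) * emeasure \<mu> A + ennreal t * emeasure \<nu> A"
      using t by (simp add: nn_integral_bernoulli_pmf mult.commute add.commute)
    also have "\<dots> = emeasure (mix_measure t \<mu> \<nu>) A"
      using A assms by (simp add: emeasure_mix_measure)
    finally show "emeasure (mix_measure t \<mu> \<nu>) A = emeasure (?P \<bind> ?K) A" by simp
  qed
  also have "integral\<^sup>L (?P \<bind> ?K) q = (\<integral>b. integral\<^sup>L (?K b) q \<partial>?P)"
    by (rule integral_bind[OF q _ K, where B = B and B' = 1])
      (use B in \<open>auto simp: \<mu>.emeasure_space_1 \<nu>.emeasure_space_1 measure_pmf.finite_measure_axioms\<close>)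
  also have "\<dots> = (1 - t) * integral\<^sup>L \<mu> q + t * integral\<^sup>L \<nu> q"
    using t by simp
  finally show ?thesis .
qed

text \<open>For a fixed function the rate is affine, and the upper bound follows at once. A supremum
  of affine functions is in general only convex, so for the lower bound near-optimal partitions for
  the two measures are joined into one that serves both.\<close>

lemma measure_entropy_mixture:
  fixes f :: "'a::topological_space \<Rightarrow> 'a"
  assumes f: "f \<in> borel \<rightarrow>\<^sub>M borel" and \<mu>: "\<mu> \<in> invariant_measures f" and \<nu>: "\<nu> \<in> invariant_measures f" and t: "t \<in> {0..1}"
    and h: "measure_entropy f \<mu> = ereal a" "measure_entropy f \<nu> = ereal b"
  shows "measure_entropy f (mix_measure t \<mu> \<nu>) = ereal ((1 - t) * a + t * b)"
proof -
  let ?M = "mix_measure t \<mu> \<nu>"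
  interpret \<mu>: inv_sys f \<mu> using f \<mu> by (rule inv_sys.intro)
  interpret \<nu>: inv_sys f \<nu> using f \<nu> by (rule inv_sys.intro)
  interpret M: inv_sys f ?M using f mix_measure_invariant[OF f \<mu> \<nu> t] by (rule inv_sys.intro)
  have r: "rate f ?M X = (1 - t) * rate f \<mu> X + t * rate f \<nu> X" if "simple_function borel X" for X :: "'a \<Rightarrow> 'b"
  proof -
    have "rate f ?M X = (\<Sum>j\<in>UNIV. (if j then t else 1 - t) * rate f (if j then \<nu> else \<mu>) X)"
      by (rule rate_mixture)
        (use t that measure_mix_measure[OF \<mu>.prob_space_axioms \<nu>.prob_space_axioms _ _ t] in
          \<open>auto simp: UNIV_bool \<mu>.inv_sys_axioms \<nu>.inv_sys_axioms M.inv_sys_axioms \<mu>.sets_\<mu> \<nu>.sets_\<mu>\<close>)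
    then show ?thesis by (simp add: UNIV_bool)
  qed
  have le: "rate f \<mu> X \<le> a" "rate f \<nu> X \<le> b" if "simple_function borel X" for X :: "'a \<Rightarrow> 'b"
    using \<mu>.rate_le_measure_entropy[of X] \<nu>.rate_le_measure_entropy[of X] h that
    by (auto simp: \<mu>.simple_iff \<nu>.simple_iff)
  show ?thesis
  proof (rule antisym)
    show "measure_entropy f ?M \<le> ereal ((1 - t) * a + t * b)"
    proof (rule M.measure_entropy_le)
      fix \<xi> :: "'a set set" assume \<xi>: "finite \<xi>" "\<xi> \<subseteq> sets borel" "partition_on UNIV \<xi>"
      have s: "simple_function borel (cell \<xi>)" using M.simple_cell[OF \<xi>] by (simp add: M.simple_iff)
      show "ereal (rate f ?M (cell \<xi>)) \<le> ereal ((1 - t) * a + t * b)"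
        unfolding r[OF s] ereal_less_eq using t le[OF s] by (intro add_mono mult_left_mono) auto
    qed
    show "ereal ((1 - t) * a + t * b) \<le> measure_entropy f ?M"
    proof (rule ereal_le_epsilon2)
      fix e :: real assume e: "e > 0"
      have ex: "\<exists>\<xi>. finite \<xi> \<and> \<xi> \<subseteq> sets borel \<and> partition_on UNIV \<xi> \<and> c - e < rate f N (cell \<xi>)"
        if N: "inv_sys f N" and c: "measure_entropy f N = ereal c" for N c
      proof (rule ccontr)
        assume *: "\<not> ?thesis"
        have "measure_entropy f N \<le> ereal (c - e)"
          by (rule inv_sys.measure_entropy_le[OF N]) (use * in \<open>auto simp: not_less\<close>)
        then show False using c e by simp
      qed
      obtain \<xi> where \<xi>: "finite \<xi>" "\<xi> \<subseteq> sets borel" "partition_on UNIV \<xi>" "a - e < rate f \<mu> (cell \<xi>)"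
        using ex[OF \<mu>.inv_sys_axioms h(1)] by blast
      obtain \<zeta> where \<zeta>: "finite \<zeta>" "\<zeta> \<subseteq> sets borel" "partition_on UNIV \<zeta>" "b - e < rate f \<nu> (cell \<zeta>)"
        using ex[OF \<nu>.inv_sys_axioms h(2)] by blast
      let ?X = "\<lambda>x. (cell \<xi> x, cell \<zeta> x)"
      have s: "simple_function \<mu> ?X"
        by (intro simple_function_Pair \<mu>.simple_cell \<xi> \<zeta>)
      then have s': "simple_function \<nu> ?X" "simple_function ?M ?X" "simple_function borel ?X"
        by (auto simp: \<mu>.simple_iff \<nu>.simple_iff M.simple_iff)
      have "a - e \<le> rate f \<mu> ?X" using \<xi>(4) \<mu>.rate_mono[OF s, of "cell \<xi>"] by simp
      moreover have "b - e \<le> rate f \<nu> ?X" using \<zeta>(4) \<nu>.rate_mono[OF s'(1), of "cell \<zeta>"] by simp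
      ultimately have "(1 - t) * (a - e) + t * (b - e) \<le> rate f ?M ?X"
        unfolding r[OF s'(3)] using t by (intro add_mono mult_left_mono) auto
      then have "ereal ((1 - t) * (a - e) + t * (b - e)) \<le> measure_entropy f ?M"
        using M.rate_le_measure_entropy[OF s'(2)] by (meson ereal_less_eq(3) order_trans)
      then have "ereal ((1 - t) * (a - e) + t * (b - e)) + ereal e \<le> measure_entropy f ?M + ereal e"
        by (rule add_right_mono)
      then show "ereal ((1 - t) * a + t * b) \<le> measure_entropy f ?M + ereal e"
        by (simp add: algebra_simps)
    qed
  qed
qed

subsection \<open>Comparison of entropies\<close>

lemma open_inner_closed:
  fixes \<mu> :: "'a::metric_space measure"
  assumes "finite_measure \<mu>" "sets \<mu> = sets borel" "open U" "e > 0"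
  shows "\<exists>C. closed C \<and> C \<subseteq> U \<and> measure \<mu> (U - C) < e"
proof (cases "U = UNIV")
  case True
  then show ?thesis using assms by (intro exI[of _ UNIV]) simp
next
  case False
  interpret finite_measure \<mu> by fact
  \<comment> \<open>The points at distance at least \<open>1 / Suc n\<close> from the complement.
    The case \<open>U = UNIV\<close> is separate because \<open>infdist\<close> to the empty set is
    0, which would make these sets empty.\<close>
  define C where "C n = {x. 1 / real (Suc n) \<le> infdist x (- U)}" for n
  have cl: "closed (C n)" for n
    unfolding C_def by (intro closed_Collect_le continuous_intros)
  have CU: "C n \<subseteq> U" for n
    unfolding C_def using infdist_zero[of _ "- U"] by (fastforce simp: not_le)
  have mono: "incseq C"
  proof (rule incseq_SucI, safe)
    fix n x assume "x \<in> C n"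
    moreover have "1 / real (Suc (Suc n)) \<le> 1 / real (Suc n)" by (simp add: field_simps)
    ultimately show "x \<in> C (Suc n)" unfolding C_def by simp
  qed
  have "(\<Inter>n. U - C n) = {}"
  proof -
    have "\<exists>n. x \<in> C n" if "x \<in> U" for x
    proof -
      have "infdist x (- U) > 0"
        using that False assms(3) by (intro infdist_pos_not_in_closed) auto
      then obtain n where "inverse (real (Suc n)) < infdist x (- U)" using reals_Archimedean by blast
      then show ?thesis by (auto simp: C_def field_simps intro!: exI[of _ n])
    qed
    then show ?thesis by blast
  qed
  moreover have "(\<lambda>n. measure \<mu> (U - C n)) \<longlonglongrightarrow> measure \<mu> (\<Inter>n. U - C n)"
  proof (rule finite_Lim_measure_decseq)
    show "range (\<lambda>n. U - C n) \<subseteq> sets \<mu>"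
      using assms(3) cl by (auto simp: assms(2) intro: sets.Diff borel_open borel_closed)
    show "decseq (\<lambda>n. U - C n)" using mono by (auto simp: decseq_def incseq_def)
  qed
  ultimately have "(\<lambda>n. measure \<mu> (U - C n)) \<longlonglongrightarrow> 0" by (simp only: measure_empty)
  then have "\<forall>\<^sub>F n in sequentially. measure \<mu> (U - C n) < e"
    using assms(4) by (rule order_tendstoD)
  then obtain n where "measure \<mu> (U - C n) < e" by (auto simp: eventually_sequentially)
  then show ?thesis using cl CU by blast
qed

text \<open>The approximable sets form a sigma-algebra containing the open sets. Bounding the single
  gap \<open>U - C\<close> makes the property symmetric under complements. In a countable union the
  gaps add up to at most \<open>e/2\<close>. The union of the closed sets need not be closed, so it
  is cut off at a finite stage, which the slack between \<open>e/2\<close> and e allows.\<close>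

lemma borel_regular:
  fixes \<mu> :: "'a::metric_space measure"
  assumes fin: "finite_measure \<mu>" and s: "sets \<mu> = sets borel" and A: "A \<in> sets borel" and e: "e > 0"
  shows "\<exists>C U. closed C \<and> open U \<and> C \<subseteq> A \<and> A \<subseteq> U \<and> measure \<mu> (U - C) < e"
proof -
  interpret finite_measure \<mu> by fact
  have "A \<in> sigma_sets UNIV {S. open S}" using A by (simp add: sets_borel)
  then show ?thesis using e
  proof (induction arbitrary: e)
    case (Basic U)
    then show ?case using open_inner_closed[OF fin s, of U e] by blast
  next
    case Empty
    then show ?case by (intro exI[of _ "{}"]) simp
  next
    case (Compl A)
    then obtain C U where *: "closed C" "open U" "C \<subseteq> A" "A \<subseteq> U" "measure \<mu> (U - C) < e" by metis
    moreover have "- C - - U = U - C" by blast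
    ultimately have "closed (- U)" "open (- C)" "- U \<subseteq> UNIV - A" "UNIV - A \<subseteq> - C" "measure \<mu> (- C - - U) < e"
      by (auto simp only: closed_Compl open_Compl) 
    then show ?case by blast
  next
    case (Union A)
    have "\<exists>C U. closed C \<and> open U \<and> C \<subseteq> A i \<and> A i \<subseteq> U \<and> measure \<mu> (U - C) < (e/2) * (1/2)^(Suc i)" for i
      using Union.IH[of "(e/2) * (1/2)^(Suc i)" i] Union.prems by simp
    then obtain C U where CU: "\<And>i. closed (C i)" "\<And>i. open (U i)" "\<And>i. C i \<subseteq> A i" "\<And>i. A i \<subseteq> U i"
      "\<And>i. measure \<mu> (U i - C i) < (e/2) * (1/2)^(Suc i)"
      by metis
    have mC: "C i \<in> sets \<mu>" "U i \<in> sets \<mu>" for i using CU by (auto simp: s)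
    have sm: "(\<lambda>i. (e/2) * (1/2)^(Suc i)) sums (e/2)"
      using sums_mult[OF power_half_series, of "e/2"] by simp
    have sm2: "summable (\<lambda>i. measure \<mu> (U i - C i))"
      by (rule summable_comparison_test'[OF sums_summable[OF sm], of 0]) (use CU(5) in \<open>auto intro: less_imp_le\<close>)
    have "measure \<mu> (\<Union>i. U i - C i) \<le> (\<Sum>i. measure \<mu> (U i - C i))"
      by (rule finite_measure_subadditive_countably) (use mC sm2 in auto)
    also have "\<dots> \<le> (\<Sum>i. (e/2) * (1/2)^(Suc i))"
      by (intro suminf_le sm2 sums_summable[OF sm]) (use CU(5) in \<open>auto intro: less_imp_le\<close>)
    also have "\<dots> = e/2" using sm by (rule sums_unique[symmetric])
    finally have "measure \<mu> (\<Union>i. U i - C i) \<le> e/2" .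
    moreover have "measure \<mu> ((\<Union>i. U i) - (\<Union>i. C i)) \<le> measure \<mu> (\<Union>i. U i - C i)"
      by (intro finite_measure_mono) (use mC in auto)
    ultimately have b: "measure \<mu> ((\<Union>i. U i) - (\<Union>i. C i)) < e" using Union.prems by simp
    have "(\<lambda>n. measure \<mu> ((\<Union>i. U i) - (\<Union>i\<in>{..n}. C i))) \<longlonglongrightarrow> measure \<mu> (\<Inter>n. (\<Union>i. U i) - (\<Union>i\<in>{..n}. C i))"
      by (intro finite_Lim_measure_decseq) (use mC in \<open>auto simp: decseq_def\<close>)
    moreover have "(\<Inter>n. (\<Union>i. U i) - (\<Union>i\<in>{..n}. C i)) = (\<Union>i. U i) - (\<Union>i. C i)" by auto
    ultimately have "(\<lambda>n. measure \<mu> ((\<Union>i. U i) - (\<Union>i\<in>{..n}. C i))) \<longlonglongrightarrow> measure \<mu> ((\<Union>i. U i) - (\<Union>i. C i))" by simp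
    then have "\<forall>\<^sub>F n in sequentially. measure \<mu> ((\<Union>i. U i) - (\<Union>i\<in>{..n}. C i)) < e"
      using b by (rule order_tendstoD)
    then obtain n where "measure \<mu> ((\<Union>i. U i) - (\<Union>i\<in>{..n}. C i)) < e" by (auto simp: eventually_sequentially)
    moreover have "closed (\<Union>i\<in>{..n}. C i)" "open (\<Union>i. U i)" using CU by auto
    moreover have "(\<Union>i\<in>{..n}. C i) \<subseteq> (\<Union>i. A i)" "(\<Union>i. A i) \<subseteq> (\<Union>i. U i)"
      by (rule UN_mono[OF subset_UNIV CU(3)], rule UN_mono[OF subset_UNIV CU(4)])
    ultimately show ?case by (intro exI conjI)
  qed
qed

section \<open>Approximation by functions with closed fibres\<close>

lemma neg_xlnx_le:
  fixes a :: real
  assumes "a \<ge> 0"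
  shows "- (a * ln a) \<le> 2 * sqrt a"
proof (cases "a = 0")
  case False
  with assms have a: "a > 0" by simp
  \<comment> \<open>The bound \<open>ln y \<le> y - 1\<close> at \<open>y = 1 / sqrt a\<close> gives
    an explicit rate at which \<open>- a ln a\<close> vanishes as a tends to 0.\<close>
  have "ln (1 / sqrt a) \<le> 1 / sqrt a - 1" using a by (intro ln_le_minus_one) simp
  then have "- (ln a / 2) \<le> 1 / sqrt a" using a by (simp add: ln_div ln_sqrt)
  then have "(2 * a) * (- (ln a / 2)) \<le> (2 * a) * (1 / sqrt a)" using a by (intro mult_left_mono) auto
  also have "(2 * a) * (1 / sqrt a) = 2 * sqrt a" using a by (simp add: field_simps)
  finally show ?thesis by simp
qed simp

context full_prob
begin

lemma ent_eq_sum_superset: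
  assumes "finite L" "range X \<subseteq> L"
  shows "ent \<mu> X = - (\<Sum>l\<in>L. prob (X -` {l}) * ln (prob (X -` {l})))"
proof -
  have "(\<Sum>l\<in>range X. prob (X -` {l}) * ln (prob (X -` {l}))) = (\<Sum>l\<in>L. prob (X -` {l}) * ln (prob (X -` {l})))"
  proof (rule sum.mono_neutral_left[OF assms], rule)
    fix l assume "l \<in> L - range X"
    then have "X -` {l} = {}" by auto
    then show "prob (X -` {l}) * ln (prob (X -` {l})) = 0" by simp
  qed
  then show ?thesis by (simp add: ent_def)
qed

text \<open>In effect \<open>H(X|Y) \<le> 1\<close>. Where Y has a proper label it determines X, so
  only the pairs \<open>(l, None)\<close> add entropy. There are \<open>card (range X)\<close> of
  them, and each contributes at most the reciprocal of this number.\<close>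

lemma cond_ent_approx:
  fixes Y :: "'a \<Rightarrow> 'b option"
  assumes X: "simple_function \<mu> X" and Y: "\<And>x l. Y x = Some l \<Longrightarrow> X x = l"
    and small: "\<And>l. - (prob {x. X x = l \<and> Y x = None} * ln (prob {x. X x = l \<and> Y x = None})) \<le> 1 / real (card (range X))"
  shows "ent \<mu> (\<lambda>x. (X x, Y x)) \<le> ent \<mu> Y + 1"
proof -
  let ?h = "\<lambda>p::real. - (p * ln p)"
  let ?R = "range X"
  have fin: "finite ?R" using simple_functionD(1)[OF X] by (simp add: space_UNIV)
  let ?L = "(\<lambda>l. (l, Some l)) ` ?R \<union> (\<lambda>l. (l, None)) ` ?R"
  let ?L' = "insert None (Some ` ?R)"
  have 1: "ent \<mu> (\<lambda>x. (X x, Y x)) = (\<Sum>l\<in>?L. ?h (prob ((\<lambda>x. (X x, Y x)) -` {l})))"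
  proof -
    have "(X x, Y x) \<in> ?L" for x by (cases "Y x") (auto dest: Y)
    then show ?thesis using fin by (subst ent_eq_sum_superset[of ?L]) (auto simp: sum_negf)
  qed
  also have "\<dots> = (\<Sum>l\<in>?R. ?h (prob ((\<lambda>x. (X x, Y x)) -` {(l, Some l)}))) + (\<Sum>l\<in>?R. ?h (prob ((\<lambda>x. (X x, Y x)) -` {(l, None)})))"
    by (subst sum.union_disjoint) (use fin in \<open>auto simp: sum.reindex inj_on_def\<close>)
  also have "(\<Sum>l\<in>?R. ?h (prob ((\<lambda>x. (X x, Y x)) -` {(l, Some l)}))) = (\<Sum>l\<in>?R. ?h (prob (Y -` {Some l})))"
  proof -
    have "(\<lambda>x. (X x, Y x)) -` {(l, Some l)} = Y -` {Some l}" for l by (auto dest: Y)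
    then show ?thesis by simp
  qed
  also have "(\<Sum>l\<in>?R. ?h (prob ((\<lambda>x. (X x, Y x)) -` {(l, None)}))) \<le> (\<Sum>l\<in>?R. 1 / real (card ?R))"
  proof -
    have "(\<lambda>x. (X x, Y x)) -` {(l, None)} = {x. X x = l \<and> Y x = None}" for l by auto
    then show ?thesis using small by (intro sum_mono) simp
  qed
  also have "(\<Sum>l\<in>?R. 1 / real (card ?R)) \<le> 1" by simp
  also have "(\<Sum>l\<in>?R. ?h (prob (Y -` {Some l}))) \<le> ent \<mu> Y"
  proof -
    have "Y x \<in> ?L'" for x by (cases "Y x") (auto dest: Y)
    then have "ent \<mu> Y = (\<Sum>l\<in>?L'. ?h (prob (Y -` {l})))"
      using fin by (subst ent_eq_sum_superset[of ?L']) (auto simp: sum_negf)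
    also have "\<dots> = ?h (prob (Y -` {None})) + (\<Sum>l\<in>?R. ?h (prob (Y -` {Some l})))"
      by (subst sum.insert) (use fin in \<open>auto simp: sum.reindex inj_on_def\<close>)
    finally have "ent \<mu> Y = \<dots>" .
    moreover have "?h (prob (Y -` {None})) \<ge> 0"
    proof (cases "prob (Y -` {None}) = 0")
      case False
      then have "prob (Y -` {None}) > 0" using measure_nonneg[of \<mu> "Y -` {None}"] by linarith
      then show ?thesis using prob_le_1[of "Y -` {None}"] by (simp add: mult_nonneg_nonpos)
    qed simp
    ultimately show ?thesis by linarith
  qed
  finally show ?thesis by simp
qed

end

text \<open>In effect the conditional entropy of words of length m is at most m times
  \<open>H(X|Y)\<close>: each letter of X is paid for by the letter of Y at the same time.\<close>

lemma (in inv_sys) word_cond_ent: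
  assumes X: "simple_function \<mu> X" and Y: "simple_function \<mu> Y"
    and c: "ent \<mu> (\<lambda>x. (X x, Y x)) \<le> ent \<mu> Y + c"
  shows "ent \<mu> (\<lambda>x. (word f m X x, word f m Y x)) \<le> ent \<mu> (word f m Y) + real m * c"
proof (induction m)
  case 0
  show ?case by (simp add: word_def ent_const)
next
  case (Suc m)
  let ?A = "word f m X" and ?B = "word f m Y"
  let ?a = "\<lambda>x. X ((f ^^ m) x)" and ?b = "\<lambda>x. Y ((f ^^ m) x)"
  have A: "simple_function \<mu> ?A" and B: "simple_function \<mu> ?B" using X Y by (auto intro: simple_word)
  have a: "simple_function \<mu> ?a" by (rule simple_function_comp_measurable[OF X measurable_funpow[OF f_meas]])
  have b: "simple_function \<mu> ?b" by (rule simple_function_comp_measurable[OF Y measurable_funpow[OF f_meas]])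
  note sp = simple_function_Pair A B a b
  \<comment> \<open>Let A, B be the old words and a, b the new letters. Then 1 says
    \<open>H(A,a|B,b) \<le> H(A|B,b) + H(a|B,b)\<close>, while 2 drops b from the first condition
    and 3 drops B from the second.\<close>
  have 1: "ent \<mu> (\<lambda>x. (?A x, ?a x, ?B x, ?b x)) + ent \<mu> (\<lambda>x. (?B x, ?b x))
      \<le> ent \<mu> (\<lambda>x. (?A x, ?B x, ?b x)) + ent \<mu> (\<lambda>x. (?a x, ?B x, ?b x))"
    by (intro ent_submodular sp)
  have 2: "ent \<mu> (\<lambda>x. (?A x, ?b x, ?B x)) + ent \<mu> ?B \<le> ent \<mu> (\<lambda>x. (?A x, ?B x)) + ent \<mu> (\<lambda>x. (?b x, ?B x))"
    by (intro ent_submodular sp)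
  have 3: "ent \<mu> (\<lambda>x. (?a x, ?B x, ?b x)) + ent \<mu> ?b \<le> ent \<mu> (\<lambda>x. (?a x, ?b x)) + ent \<mu> (\<lambda>x. (?B x, ?b x))"
    by (intro ent_submodular sp)
  have 4: "ent \<mu> (\<lambda>x. (?A x, ?b x, ?B x)) = ent \<mu> (\<lambda>x. (?A x, ?B x, ?b x))"
    by (rule ent_cong_fibres) (intro sp, auto)
  have 5: "ent \<mu> (\<lambda>x. (?b x, ?B x)) = ent \<mu> (\<lambda>x. (?B x, ?b x))"
    by (rule ent_cong_fibres) (intro sp, auto)
  have 6: "ent \<mu> (\<lambda>x. (?a x, ?b x)) = ent \<mu> (\<lambda>x. (X x, Y x))" "ent \<mu> ?b = ent \<mu> Y"
    using ent_funpow[OF simple_function_Pair[OF X Y], of m] ent_funpow[OF Y, of m] by auto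
  have w: "word f (Suc m) Z x = word f m Z x @ [Z ((f ^^ m) x)]" for Z :: "'a \<Rightarrow> 'z" and x
    by (simp add: word_def)
  have 7: "ent \<mu> (\<lambda>x. (word f (Suc m) X x, word f (Suc m) Y x)) = ent \<mu> (\<lambda>x. (?A x, ?a x, ?B x, ?b x))"
    by (rule ent_cong_fibres, intro sp) (auto simp: w)
  have 8: "ent \<mu> (word f (Suc m) Y) = ent \<mu> (\<lambda>x. (?B x, ?b x))"
    by (rule ent_cong_fibres, intro sp) (auto simp: w)
  have e: "real (Suc m) * c = real m * c + c" by (simp add: algebra_simps)
  show ?case
    unfolding 7 8 e using 1 2 3 4 5 6 Suc c by linarith
qed

text \<open>The finite form of the variational principle: entropy plus mean energy is at most the
  logarithm of the partition function S. The distribution is compared with the Gibbs weights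
  \<open>exp (u w) / S\<close>.\<close>

lemma (in full_prob) gibbs:
  assumes W: "simple_function \<mu> W"
  shows "ent \<mu> W + (\<Sum>w\<in>range W. prob (W -` {w}) * u w) \<le> ln (\<Sum>w\<in>range W. exp (u w))"
proof -
  let ?R = "range W"
  let ?p = "\<lambda>w. prob (W -` {w})"
  have fin: "finite ?R" using simple_functionD(1)[OF W] by (simp add: space_UNIV)
  define S where "S = (\<Sum>w\<in>?R. exp (u w))"
  have S: "S > 0" unfolding S_def by (intro sum_pos fin) auto
  have "?p w * u w - ?p w * ln (?p w) \<le> ?p w * ln S + (exp (u w) / S - ?p w)" for w
  proof (cases "?p w = 0")
    case True
    then show ?thesis using S by simp
  next
    case False
    then have p: "?p w > 0" using measure_nonneg[of \<mu> "W -` {w}"] by linarith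
    have "ln (exp (u w) / (?p w * S)) \<le> exp (u w) / (?p w * S) - 1"
      using p S by (intro ln_le_minus_one) simp
    then have "?p w * ln (exp (u w) / (?p w * S)) \<le> ?p w * (exp (u w) / (?p w * S) - 1)"
      using p by (intro mult_left_mono) auto
    also have "\<dots> = exp (u w) / S - ?p w" using p S by (simp add: field_simps)
    also have "ln (exp (u w) / (?p w * S)) = u w - ln (?p w) - ln S"
      using p S by (simp add: ln_div ln_mult)
    finally show ?thesis by (simp add: algebra_simps)
  qed
  then have "(\<Sum>w\<in>?R. ?p w * u w - ?p w * ln (?p w)) \<le> (\<Sum>w\<in>?R. ?p w * ln S + (exp (u w) / S - ?p w))"
    by (intro sum_mono)
  also have "\<dots> = (\<Sum>w\<in>?R. ?p w) * ln S + (S / S - (\<Sum>w\<in>?R. ?p w))"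
    by (simp add: sum.distrib sum_subtractf sum_distrib_right S_def flip: sum_divide_distrib)
  also have "\<dots> = ln S" using sum_fibres[OF W] S by simp
  finally show ?thesis by (simp add: ent_def sum_subtractf S_def)
qed

lemma (in full_prob) integral_le_sum_fibres:
  fixes q :: "'a \<Rightarrow> real"
  assumes W: "simple_function \<mu> W" and q: "integrable \<mu> q" and le: "\<And>x. q x \<le> u (W x)"
  shows "integral\<^sup>L \<mu> q \<le> (\<Sum>w\<in>range W. prob (W -` {w}) * u w)"
proof -
  let ?I = "\<lambda>w. indicator (W -` {w}) :: 'a \<Rightarrow> real"
  have fin: "finite (range W)" using simple_functionD(1)[OF W] by (simp add: space_UNIV)
  have ev: "W -` {w} \<in> events" for w using simple_functionD(2)[OF W, of "{w}"] by (simp add: space_UNIV)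
  have s: "(\<Sum>w\<in>range W. ?I w x * u w) = u (W x)" for x
  proof -
    have "(\<Sum>w\<in>range W. ?I w x * u w) = (\<Sum>w\<in>{W x}. ?I w x * u w)"
      by (rule sum.mono_neutral_right) (use fin in \<open>auto simp: indicator_def\<close>)
    then show ?thesis by simp
  qed
  have int: "integrable \<mu> (\<lambda>x. ?I w x * u w)" for w
    using ev[of w] by (intro integrable_mult_left) (simp add: integrable_indicator_iff emeasure_eq_measure)
  have "integral\<^sup>L \<mu> q \<le> (\<integral>x. (\<Sum>w\<in>range W. ?I w x * u w) \<partial>\<mu>)"
    by (intro integral_mono q Bochner_Integration.integrable_sum int) (simp add: s le)
  also have "\<dots> = (\<Sum>w\<in>range W. \<integral>x. ?I w x * u w \<partial>\<mu>)"
    by (intro Bochner_Integration.integral_sum int)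
  also have "\<dots> = (\<Sum>w\<in>range W. prob (W -` {w}) * u w)"
    using ev by (simp add: space_UNIV)
  finally show ?thesis .
qed

subsection \<open>Half of the variational principle\<close>

text \<open>The fibres of X are shrunk from inside to closed sets, and the remaining points receive
  the label \<open>None\<close>. Disjoint closed sets are separated in a compact space, whereas the
  fibres of X may touch.\<close>

lemma exists_closed_approx:
  fixes f :: "'a::metric_space \<Rightarrow> 'a" and X :: "'a \<Rightarrow> 'b"
  assumes "inv_sys f \<mu>" and X: "simple_function \<mu> X"
  shows "\<exists>Y :: 'a \<Rightarrow> 'b option. simple_function \<mu> Y \<and> (\<forall>l. closed (Y -` {Some l})) \<and>
    ent \<mu> (\<lambda>x. (X x, Y x)) \<le> ent \<mu> Y + 1"
proof -
  interpret inv_sys f \<mu> by fact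
  let ?R = "range X"
  have fin: "finite ?R" using simple_functionD(1)[OF X] by (simp add: space_UNIV)
  then have c: "card ?R > 0" by (simp add: card_gt_0_iff)
  have ev: "X -` {l} \<in> sets borel" for l
    using X by (intro events_vimage) (simp add: simple_iff)
  \<comment> \<open>The tolerance is made for \<open>neg_xlnx_le\<close>: twice its square root is
    \<open>1 / card (range X)\<close>, the amount allowed in \<open>cond_ent_approx\<close>.\<close>
  have "\<exists>C. closed C \<and> C \<subseteq> X -` {l} \<and> prob (X -` {l} - C) < (1 / (2 * real (card ?R)))\<^sup>2" for l
  proof -
    have "0 < (1 / (2 * real (card ?R)))\<^sup>2" using c by simp
    then obtain C U where CU: "closed C" "open U" "C \<subseteq> X -` {l}" "X -` {l} \<subseteq> U" "prob (U - C) < (1 / (2 * real (card ?R)))\<^sup>2"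
      using borel_regular[OF finite_measure_axioms sets_\<mu> ev[of l]] by metis
    have "prob (X -` {l} - C) \<le> prob (U - C)"
      using CU by (intro finite_measure_mono) (auto simp: sets_\<mu>)
    with CU show ?thesis by (intro exI[of _ C]) auto
  qed
  then obtain C where C: "\<And>l. closed (C l)" "\<And>l. C l \<subseteq> X -` {l}" "\<And>l. prob (X -` {l} - C l) < (1 / (2 * real (card ?R)))\<^sup>2"
    by metis
  define Y where "Y x = (if x \<in> C (X x) then Some (X x) else None)" for x
  have Ys: "Y -` {Some l} = C l" for l using C(2)[of l] by (auto simp: Y_def split: if_splits)
  have Yn: "Y -` {None} = (\<Union>l\<in>?R. X -` {l} - C l)" by (auto simp: Y_def split: if_splits)
  have sY: "simple_function \<mu> Y"
    unfolding simple_function_def space_UNIV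
  proof (intro conjI ballI)
    have "range Y \<subseteq> insert None (Some ` ?R)" by (auto simp: Y_def)
    then show "finite (range Y)" using fin by (auto intro: finite_subset)
    have "Y -` {None} \<in> events" unfolding Yn using fin ev C(1)
      by (intro sets.finite_UN) (auto simp: sets_\<mu>)
    moreover have "Y -` {Some l} \<in> events" for l unfolding Ys using C(1) by (simp add: sets_\<mu>)
    ultimately show "Y -` {y} \<inter> UNIV \<in> events" for y by (cases y) auto
  qed
  have "ent \<mu> (\<lambda>x. (X x, Y x)) \<le> ent \<mu> Y + 1"
  proof (rule cond_ent_approx[OF X])
    show "Y x = Some l \<Longrightarrow> X x = l" for x l by (auto simp: Y_def split: if_splits)
    fix l
    have eq: "{x. X x = l \<and> Y x = None} = X -` {l} - C l" by (auto simp: Y_def split: if_splits)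
    have "sqrt (prob (X -` {l} - C l)) \<le> sqrt ((1 / (2 * real (card ?R)))\<^sup>2)"
      using C(3)[of l] by (intro real_sqrt_le_mono) simp
    also have "\<dots> = 1 / (2 * real (card ?R))" by (simp add: real_sqrt_divide)
    finally have "2 * sqrt (prob (X -` {l} - C l)) \<le> 1 / real (card ?R)" using c by (simp add: field_simps)
    then show "- (prob {x. X x = l \<and> Y x = None} * ln (prob {x. X x = l \<and> Y x = None})) \<le> 1 / real (card ?R)"
      unfolding eq using neg_xlnx_le[of "prob (X -` {l} - C l)"] by simp
  qed
  then show ?thesis using sY C(1) by (intro exI[of _ Y]) (simp add: Ys)
qed

section \<open>Counting words near an orbit\<close>

lemma closed_disjoint_dist:
  fixes A B :: "'a::metric_space set"
  assumes "compact (UNIV :: 'a set)" "closed A" "closed B" "A \<inter> B = {}"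
  shows "\<exists>d>0. \<forall>x\<in>A. \<forall>y\<in>B. d \<le> dist x y"
proof (cases "A = {} \<or> B = {}")
  case True
  then show ?thesis by (auto intro: exI[of _ 1])
next
  case False
  have "compact B" using compact_Int_closed[OF assms(1,3)] by simp
  moreover have "continuous_on B (\<lambda>y. infdist y A)" by (intro continuous_intros)
  ultimately obtain b where b: "b \<in> B" "\<And>y. y \<in> B \<Longrightarrow> infdist b A \<le> infdist y A"
    using False continuous_attains_inf[of B "\<lambda>y. infdist y A"] by auto
  have "infdist b A > 0"
    using b(1) assms False by (intro infdist_pos_not_in_closed) auto
  moreover have "infdist b A \<le> dist x y" if "x \<in> A" "y \<in> B" for x y
    using b(2)[OF that(2)] infdist_le[OF that(1), of y] by (simp add: dist_commute)
  ultimately show ?thesis by blast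
qed

text \<open>The smallest of finitely many positive distances. The label \<open>None\<close> is
  excluded because its fibre may touch all the others.\<close>

lemma closed_labels_separated:
  fixes Y :: "'a::metric_space \<Rightarrow> 'b option"
  assumes c: "compact (UNIV :: 'a set)" and fin: "finite (range Y)" and cl: "\<And>l. closed (Y -` {Some l})"
  shows "\<exists>d>0. \<forall>x x'. Y x \<noteq> None \<longrightarrow> Y x' \<noteq> None \<longrightarrow> Y x \<noteq> Y x' \<longrightarrow> d \<le> dist x x'"
proof -
  let ?L = "{l. Some l \<in> range Y}"
  let ?P = "{(l, l'). l \<in> ?L \<and> l' \<in> ?L \<and> l \<noteq> l'}"
  have "Some ` ?L \<subseteq> range Y" by auto
  then have "finite ?L" using fin by (meson finite_imageD finite_subset inj_Some)
  then have finP: "finite ?P" by (rule_tac finite_subset[of _ "?L \<times> ?L"]) auto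
  have "\<exists>d>0. \<forall>x\<in>Y -` {Some l}. \<forall>y\<in>Y -` {Some l'}. d \<le> dist x y" if "l \<noteq> l'" for l l'
    using that by (intro closed_disjoint_dist c cl) auto
  then obtain d where d: "\<And>l l'. l \<noteq> l' \<Longrightarrow> d l l' > 0"
    "\<And>l l' x y. l \<noteq> l' \<Longrightarrow> Y x = Some l \<Longrightarrow> Y y = Some l' \<Longrightarrow> d l l' \<le> dist x y"
    by (simp add: Ball_def) metis
  \<comment> \<open>The 1 keeps the minimum defined when there are no two distinct labels.\<close>
  define D where "D = Min (insert 1 ((\<lambda>(l, l'). d l l') ` ?P))"
  have "D > 0" unfolding D_def using finP d(1) by (subst Min_gr_iff) auto
  moreover have "D \<le> dist x x'" if "Y x \<noteq> None" "Y x' \<noteq> None" "Y x \<noteq> Y x'" for x x'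
  proof -
    from that(1,2) obtain l l' where l12: "Y x = Some l" "Y x' = Some l'" by blast
    with that(3) have l: "Y x = Some l" "Y x' = Some l'" "l \<noteq> l'" by auto
    then have "(l, l') \<in> ?P" by (auto intro: rangeI[of Y x] rangeI[of Y x'] simp: image_iff) metis+
    then have "D \<le> d l l'" unfolding D_def using finP by (intro Min_le) auto
    then show ?thesis using d(2)[OF l(3,1,2)] by linarith
  qed
  ultimately show ?thesis by blast
qed

text \<open>
  A small ball meets at most one fibre of \<open>Y\<close> besides the one over \<^const>\<open>None\<close>, so a word seen near
  the orbit of \<open>y\<close> is determined by the positions of \<^const>\<open>None\<close>.
\<close>

lemma card_near_words:
  fixes Y :: "'a::metric_space \<Rightarrow> 'b option" and g :: "'a \<Rightarrow> 'a" and m :: nat and y :: 'a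
  assumes sep: "\<And>x x'. Y x \<noteq> None \<Longrightarrow> Y x' \<noteq> None \<Longrightarrow> Y x \<noteq> Y x' \<Longrightarrow> d \<le> dist x x'"
    and \<epsilon>: "2 * \<epsilon> < d"
  defines "A \<equiv> {w. \<exists>x. w = word g m Y x \<and> (\<forall>j<m. dist ((g ^^ j) x) ((g ^^ j) y) \<le> \<epsilon>)}"
  shows "finite A" "card A \<le> 2 ^ m"
proof -
  let ?\<Phi> = "\<lambda>w. {j. j < m \<and> w ! j \<noteq> None}"
  have inj: "inj_on ?\<Phi> A"
  proof (rule inj_onI)
    fix w w' assume w: "w \<in> A" "w' \<in> A" and eq: "?\<Phi> w = ?\<Phi> w'"
    from w obtain x x' where x: "w = word g m Y x" "\<And>j. j < m \<Longrightarrow> dist ((g ^^ j) x) ((g ^^ j) y) \<le> \<epsilon>"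
      "w' = word g m Y x'" "\<And>j. j < m \<Longrightarrow> dist ((g ^^ j) x') ((g ^^ j) y) \<le> \<epsilon>"
      unfolding A_def by blast
    have nth: "w ! j = Y ((g ^^ j) x)" "w' ! j = Y ((g ^^ j) x')" if "j < m" for j
      using that by (auto simp: x word_def)
    have "w ! j = w' ! j" if j: "j < m" for j
    proof (cases "w ! j = None")
      case True
      then have "j \<notin> ?\<Phi> w'" using eq by blast
      then show ?thesis using True j by simp
    next
      case False
      then have "j \<in> ?\<Phi> w'" using eq j by blast
      then have "w' ! j \<noteq> None" by simp
      moreover have "dist ((g ^^ j) x) ((g ^^ j) x') < d"
        using x(2)[OF j] x(4)[OF j] \<epsilon> dist_triangle2[of "(g ^^ j) x" "(g ^^ j) x'" "(g ^^ j) y"] by linarith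
      ultimately show ?thesis using sep[of "(g ^^ j) x" "(g ^^ j) x'"] False nth[OF j] by (metis not_le)
    qed
    moreover have "length w = m" "length w' = m" by (auto simp: x word_def)
    ultimately show "w = w'" by (simp add: list_eq_iff_nth_eq)
  qed
  have im: "?\<Phi> ` A \<subseteq> Pow {..<m}" by auto
  show "finite A" using inj im by (meson finite_Pow_iff finite_imageD finite_lessThan finite_subset)
  have "card A \<le> card (Pow {..<m})" by (rule card_inj_on_le[OF inj im]) simp
  then show "card A \<le> 2 ^ m" by (simp add: card_Pow)
qed

text \<open>One side has lists of lists as values and the other has lists, but the fibres agree and
  hence so do the entropies. Positions are matched by \<open>k = i + N * j\<close>.\<close>

lemma word_word_fibres:
  "word (f ^^ N) m (word f N X) x = word (f ^^ N) m (word f N X) y \<longleftrightarrow> word f (m * N) X x = word f (m * N) X y"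
proof -
  have "(\<forall>j<m. \<forall>i<N. X ((f ^^ i) (((f ^^ N) ^^ j) x)) = X ((f ^^ i) (((f ^^ N) ^^ j) y)))
      \<longleftrightarrow> (\<forall>k<m * N. X ((f ^^ k) x) = X ((f ^^ k) y))"
  proof (intro iffI allI impI)
    fix k assume *: "\<forall>j<m. \<forall>i<N. X ((f ^^ i) (((f ^^ N) ^^ j) x)) = X ((f ^^ i) (((f ^^ N) ^^ j) y))" and k: "k < m * N"
    then have "N > 0" by (cases N) auto
    moreover have "k div N < m" using k by (simp add: less_mult_imp_div_less)
    moreover have "(f ^^ k) z = (f ^^ (k mod N)) (((f ^^ N) ^^ (k div N)) z)" for z
      by (simp add: funpow_mult flip: funpow_add[THEN fun_cong, unfolded comp_def])
    ultimately show "X ((f ^^ k) x) = X ((f ^^ k) y)" using * by simp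
  next
    fix j i assume *: "\<forall>k<m * N. X ((f ^^ k) x) = X ((f ^^ k) y)" and j: "j < m" and i: "i < N"
    have "i + N * j < N + N * j" using i by simp
    also have "\<dots> = N * Suc j" by simp
    also have "\<dots> \<le> m * N" using j by (simp add: mult.commute del: mult_Suc mult_Suc_right)
    finally have "X ((f ^^ (i + N * j)) x) = X ((f ^^ (i + N * j)) y)" using * by blast
    then show "X ((f ^^ i) (((f ^^ N) ^^ j) x)) = X ((f ^^ i) (((f ^^ N) ^^ j) y))"
      by (simp add: funpow_mult funpow_add)
  qed
  then show ?thesis by (simp add: word_eq_iff)
qed

lemma bowen_distD:
  assumes "bowen_dist f n x y \<le> \<epsilon>" "i < n"
  shows "dist ((f ^^ i) x) ((f ^^ i) y) \<le> \<epsilon>"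
proof -
  have "dist ((f ^^ i) x) ((f ^^ i) y) \<le> bowen_dist f n x y"
    unfolding bowen_dist_def using assms(2) by (intro Max_ge) auto
  then show ?thesis using assms(1) by simp
qed

lemma birkhoff_sum_close:
  assumes "\<And>i. i < n \<Longrightarrow> \<bar>g ((f ^^ i) x) - g ((f ^^ i) y)\<bar> \<le> (\<omega>::real)"
  shows "\<bar>birkhoff_sum f g n x - birkhoff_sum f g n y\<bar> \<le> real n * \<omega>"
proof -
  have "\<bar>birkhoff_sum f g n x - birkhoff_sum f g n y\<bar> \<le> (\<Sum>i<n. \<bar>g ((f ^^ i) x) - g ((f ^^ i) y)\<bar>)"
    unfolding birkhoff_sum_def sum_subtractf[symmetric] by (rule sum_abs)
  also have "\<dots> \<le> (\<Sum>i<n. \<omega>)" using assms by (intro sum_mono) auto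
  finally show ?thesis by simp
qed

context inv_sys
begin

lemma inv_sys_funpow: "inv_sys (f ^^ N) \<mu>"
proof
  show "f ^^ N \<in> borel \<rightarrow>\<^sub>M borel" by (rule measurable_funpow[OF f_borel])
  have "distr \<mu> borel (f ^^ N) = distr \<mu> \<mu> (f ^^ N)" by (rule distr_cong) (auto simp: sets_\<mu>)
  then show "\<mu> \<in> invariant_measures (f ^^ N)"
    by (simp add: invariant_measures_def prob_space_axioms sets_\<mu> distr_funpow)
qed

lemma borel_bounded_integrable:
  fixes q :: "'a \<Rightarrow> real"
  assumes "q \<in> borel_measurable borel" "\<And>x. \<bar>q x\<bar> \<le> B"
  shows "integrable \<mu> q"
  by (rule integrable_const_bound[of _ B]) (use assms in \<open>auto simp: meas_cong\<close>)

lemma integral_funpow: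
  fixes q :: "'a \<Rightarrow> real"
  assumes "q \<in> borel_measurable borel"
  shows "(\<integral>x. q ((f ^^ n) x) \<partial>\<mu>) = integral\<^sup>L \<mu> q"
proof -
  have "integral\<^sup>L (distr \<mu> \<mu> (f ^^ n)) q = (\<integral>x. q ((f ^^ n) x) \<partial>\<mu>)"
    by (rule integral_distr) (use assms in \<open>auto simp: meas_cong measurable_funpow f_borel\<close>)
  then show ?thesis by (simp add: distr_funpow)
qed

lemma birkhoff_sum_meas:
  fixes q :: "'a \<Rightarrow> real"
  assumes [measurable]: "q \<in> borel_measurable borel"
  shows "birkhoff_sum f q n \<in> borel_measurable borel"
proof -
  have [measurable]: "f ^^ i \<in> borel \<rightarrow>\<^sub>M borel" for i by (rule measurable_funpow[OF f_borel])
  show ?thesis unfolding birkhoff_sum_def[abs_def] by measurable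
qed

lemma integral_birkhoff_sum:
  fixes q :: "'a \<Rightarrow> real"
  assumes q: "q \<in> borel_measurable borel" and B: "\<And>x. \<bar>q x\<bar> \<le> B"
  shows "integrable \<mu> (birkhoff_sum f q n)" "integral\<^sup>L \<mu> (birkhoff_sum f q n) = real n * integral\<^sup>L \<mu> q"
proof -
  have int: "integrable \<mu> (\<lambda>x. q ((f ^^ i) x))" for i
    by (rule borel_bounded_integrable[where B = B])
      (use measurable_compose[OF measurable_funpow[OF f_borel] q] B in auto)
  show "integrable \<mu> (birkhoff_sum f q n)"
    unfolding birkhoff_sum_def[abs_def] by (intro Bochner_Integration.integrable_sum int)
  show "integral\<^sup>L \<mu> (birkhoff_sum f q n) = real n * integral\<^sup>L \<mu> q"
    unfolding birkhoff_sum_def[abs_def] by (subst Bochner_Integration.integral_sum[OF int]) (simp add: integral_funpow[OF q])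
qed

end

text \<open>
  Each application of \<open>f ^^ N\<close> loses \<open>1\<close> for replacing \<open>X\<close> by the closed approximation \<open>Y\<close> and \<open>ln 2\<close>
  for counting words. Per application of \<open>f\<close> this is the negligible \<open>(1 + ln 2) / N\<close>.
\<close>

lemma block_entropy_bound:
  fixes f :: "'a::metric_space \<Rightarrow> 'a" and g :: "'a \<Rightarrow> real" and X :: "'a \<Rightarrow> 'b"
  assumes inv: "inv_sys f \<mu>" and g: "g \<in> borel_measurable borel" and B: "\<And>x. \<bar>g x\<bar> \<le> B"
    and X: "simple_function \<mu> X" and Y: "simple_function \<mu> Y"
    and XY: "ent \<mu> (\<lambda>x. (word f N X x, Y x)) \<le> ent \<mu> Y + 1"
    and sep: "\<And>x x'. Y x \<noteq> None \<Longrightarrow> Y x' \<noteq> None \<Longrightarrow> Y x \<noteq> Y x' \<Longrightarrow> d \<le> dist x x'"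
    and \<epsilon>: "2 * \<epsilon> < d"
    and \<omega>: "\<And>x y. dist x y \<le> \<epsilon> \<Longrightarrow> \<bar>g x - g y\<bar> \<le> \<omega>"
    and N: "N \<ge> 1" and m: "m \<ge> 1"
    and F: "spanning_set f (m * N) \<epsilon> UNIV F"
    and K: "\<And>G. finite G \<Longrightarrow> G \<subseteq> F \<Longrightarrow> (\<Sum>x\<in>G. exp (birkhoff_sum f g (m * N) x)) \<le> K"
  shows "K > 0" and "rate f \<mu> X + integral\<^sup>L \<mu> g \<le> \<omega> + (1 + ln K) / (real m * real N) + (1 + ln 2) / real N"
proof -
  interpret inv_sys f \<mu> by fact
  interpret fN: inv_sys "f ^^ N" \<mu> by (rule inv_sys_funpow)
  define n where "n = m * N"
  let ?g = "f ^^ N"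
  let ?W = "word ?g m Y"
  let ?S = "birkhoff_sum f g n"
  have n1: "n \<ge> 1" using N m by (simp add: n_def)
  have W: "simple_function \<mu> ?W" by (rule fN.simple_word[OF Y])
  have finW: "finite (range ?W)" using simple_functionD(1)[OF W] by (simp add: space_UNIV)
  have SB: "?S x \<le> real n * B" for x
  proof -
    have "?S x \<le> (\<Sum>i<n. B)" unfolding birkhoff_sum_def using B by (intro sum_mono) (auto simp: abs_le_iff)
    then show ?thesis by simp
  qed
  have near: "\<exists>y\<in>F. \<forall>i<n. dist ((f ^^ i) x) ((f ^^ i) y) \<le> \<epsilon>" for x
    using F bowen_distD[of f n _ x \<epsilon>] unfolding spanning_set_def n_def[symmetric] by (metis UNIV_I dist_commute)
  \<comment> \<open>In each fibre of the word function a point x nearly maximises the Birkhoff sum,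
    and a point y of F shadows x. Fibres need not be compact, so the supremum is reached only up to
    1, which is negligible against n.\<close>
  have "\<exists>x y. ?W x = w \<and> y \<in> F \<and> (\<forall>i<n. dist ((f ^^ i) x) ((f ^^ i) y) \<le> \<epsilon>) \<and> (\<forall>z. ?W z = w \<longrightarrow> ?S z \<le> ?S x + 1)"
    if "w \<in> range ?W" for w
  proof -
    let ?T = "?S ` (?W -` {w})"
    have ne: "?T \<noteq> {}" using that by auto
    have bdd: "bdd_above ?T" using SB by (auto intro!: bdd_aboveI[of _ "real n * B"])
    obtain x where x: "?W x = w" "Sup ?T - 1 < ?S x"
      using less_cSup_iff[OF ne bdd, of "Sup ?T - 1"] by auto
    have "?S z \<le> ?S x + 1" if "?W z = w" for z
      using cSup_upper[OF _ bdd, of "?S z"] that x by auto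
    with x(1) near[of x] show ?thesis by blast
  qed
  then obtain xx yy where xy: "\<And>w. w \<in> range ?W \<Longrightarrow> ?W (xx w) = w" "\<And>w. w \<in> range ?W \<Longrightarrow> yy w \<in> F"
    "\<And>w i. w \<in> range ?W \<Longrightarrow> i < n \<Longrightarrow> dist ((f ^^ i) (xx w)) ((f ^^ i) (yy w)) \<le> \<epsilon>"
    "\<And>w z. w \<in> range ?W \<Longrightarrow> ?W z = w \<Longrightarrow> ?S z \<le> ?S (xx w) + 1"
    by metis
  \<comment> \<open>A bound for the Birkhoff sum on the whole fibre, passing through x to y: 1 pays
    for near-maximality and \<open>n * \<omega>\<close> for shadowing.\<close>
  define u where "u w = ?S (yy w) + real n * \<omega> + 1" for w
  have le_u: "?S x \<le> u (?W x)" for x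
  proof -
    have "?S x \<le> ?S (xx (?W x)) + 1" using xy(4) by blast
    moreover have "\<bar>?S (xx (?W x)) - ?S (yy (?W x))\<bar> \<le> real n * \<omega>"
      by (rule birkhoff_sum_close) (use xy(3) \<omega> in blast)
    ultimately show ?thesis unfolding u_def by linarith
  qed
  let ?G = "yy ` range ?W"
  \<comment> \<open>Different words may choose the same y, but \<open>card_near_words\<close> for
    \<open>f ^^ N\<close> allows at most \<open>2 ^ m\<close> of them.\<close>
  have "(\<Sum>w\<in>range ?W. exp (?S (yy w))) = (\<Sum>y\<in>?G. \<Sum>w\<in>{w\<in>range ?W. yy w = y}. exp (?S (yy w)))"
    by (rule sum.image_gen[OF finW])
  also have "\<dots> \<le> (\<Sum>y\<in>?G. 2 ^ m * exp (?S y))"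
  proof (rule sum_mono)
    fix y assume "y \<in> ?G"
    let ?A = "{w. \<exists>x. w = word ?g m Y x \<and> (\<forall>j<m. dist ((?g ^^ j) x) ((?g ^^ j) y) \<le> \<epsilon>)}"
    have jn: "N * j < n" if "j < m" for j using that N by (simp add: n_def mult.commute)
    have "{w\<in>range ?W. yy w = y} \<subseteq> ?A"
    proof clarify
      fix x assume y: "y = yy (?W x)"
      have "?W x = ?W (xx (?W x))" using xy(1) by simp
      moreover have "\<forall>j<m. dist ((?g ^^ j) (xx (?W x))) ((?g ^^ j) (yy (?W x))) \<le> \<epsilon>"
        using xy(3) jn by (simp add: funpow_mult)
      ultimately show "\<exists>x'. ?W x = ?W x' \<and> (\<forall>j<m. dist ((?g ^^ j) x') ((?g ^^ j) (yy (?W x))) \<le> \<epsilon>)"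
        by blast
    qed
    then have "card {w\<in>range ?W. yy w = y} \<le> 2 ^ m"
      using card_near_words[of Y d \<epsilon> ?g m y, OF sep \<epsilon>] by (meson card_mono le_trans)
    then have "real (card {w\<in>range ?W. yy w = y}) \<le> 2 ^ m" by (metis of_nat_le_iff of_nat_numeral of_nat_power)
    then show "(\<Sum>w\<in>{w\<in>range ?W. yy w = y}. exp (?S (yy w))) \<le> 2 ^ m * exp (?S y)"
      by (simp add: mult_right_mono)
  qed
  also have "\<dots> = 2 ^ m * (\<Sum>y\<in>?G. exp (?S y))" by (simp add: sum_distrib_left)
  also have KG: "(\<Sum>y\<in>?G. exp (?S y)) \<le> K"
    unfolding n_def by (rule K) (use finW xy(2) in auto)
  finally have sumle: "(\<Sum>w\<in>range ?W. exp (?S (yy w))) \<le> 2 ^ m * K" by simp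
  have "(\<Sum>y\<in>?G. exp (?S y)) > 0" using finW by (intro sum_pos) auto
  with KG show K0: "K > 0" by linarith
  have "(\<Sum>w\<in>range ?W. exp (u w)) = exp (real n * \<omega> + 1) * (\<Sum>w\<in>range ?W. exp (?S (yy w)))"
    by (simp add: u_def exp_add sum_distrib_left mult_ac)
  also have "\<dots> \<le> exp (real n * \<omega> + 1) * (2 ^ m * K)"
    using sumle by (intro mult_left_mono) auto
  finally have "ln (\<Sum>w\<in>range ?W. exp (u w)) \<le> ln (exp (real n * \<omega> + 1) * (2 ^ m * K))"
    using finW by (intro ln_mono) (auto intro!: sum_pos)
  also have "\<dots> = real n * \<omega> + 1 + real m * ln 2 + ln K"
    using K0 by (simp add: ln_mult ln_realpow)
  finally have A: "ln (\<Sum>w\<in>range ?W. exp (u w)) \<le> real n * \<omega> + 1 + real m * ln 2 + ln K" .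
  have "real n * integral\<^sup>L \<mu> g \<le> (\<Sum>w\<in>range ?W. prob (?W -` {w}) * u w)"
    using integral_le_sum_fibres[OF W integral_birkhoff_sum(1)[OF g B] le_u] integral_birkhoff_sum(2)[OF g B]
    by simp
  with gibbs[OF W, of u] A have B1: "ent \<mu> ?W + real n * integral\<^sup>L \<mu> g \<le> real n * \<omega> + 1 + real m * ln 2 + ln K"
    by linarith
  let ?Z = "word f N X"
  have Z: "simple_function \<mu> ?Z" by (rule simple_word[OF X])
  \<comment> \<open>Return from Y to X: a word of length \<open>m * N\<close> consists of m blocks
    of length N, and each block costs at most 1 given its label under Y.\<close>
  have "ent \<mu> (word f n X) = ent \<mu> (word ?g m ?Z)"
    unfolding n_def by (rule ent_cong_fibres[OF fN.simple_word[OF Z]]) (simp only: word_word_fibres)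
  also have "\<dots> \<le> ent \<mu> (\<lambda>x. (word ?g m ?Z x, ?W x))"
    by (rule ent_mono) (auto intro!: simple_function_Pair fN.simple_word Z Y)
  also have "\<dots> \<le> ent \<mu> ?W + real m * 1"
    by (rule fN.word_cond_ent[OF Z Y XY])
  finally have B2: "ent \<mu> (word f n X) \<le> ent \<mu> ?W + real m" by simp
  have "rate f \<mu> X \<le> ent \<mu> (word f n X) / real n" by (rule rate_le[OF n1])
  then have "real n * rate f \<mu> X \<le> ent \<mu> (word f n X)" using n1 by (simp add: field_simps)
  with B1 B2 have "real n * (rate f \<mu> X + integral\<^sup>L \<mu> g) \<le> real n * \<omega> + (1 + ln K) + real m * (1 + ln 2)"
    by (simp add: algebra_simps)
  then have "rate f \<mu> X + integral\<^sup>L \<mu> g \<le> (real n * \<omega> + (1 + ln K) + real m * (1 + ln 2)) / real n"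
    using n1 by (simp add: field_simps)
  also have "\<dots> = \<omega> + (1 + ln K) / (real m * real N) + (1 + ln 2) / real N"
    using N m by (simp add: n_def add_divide_distrib)
  finally show "rate f \<mu> X + integral\<^sup>L \<mu> g \<le> \<omega> + (1 + ln K) / (real m * real N) + (1 + ln 2) / real N" .
qed

text \<open>The hypothesis expresses that the pressure of g is at most 0: at every small scale the
  weights of some spanning sets stay below a constant K, and \<open>ln K / n\<close> vanishes. It
  speaks of finite subsets G because F may be infinite.\<close>

lemma half_variational:
  fixes f :: "'a::metric_space \<Rightarrow> 'a" and g :: "'a \<Rightarrow> real"
  assumes comp: "compact (UNIV :: 'a set)" and contf: "continuous_on UNIV f" and contg: "continuous_on UNIV g"
    and \<mu>: "\<mu> \<in> invariant_measures f" and \<epsilon>0: "\<epsilon>\<^sub>0 > 0"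
    and H: "\<And>\<epsilon>. 0 < \<epsilon> \<Longrightarrow> \<epsilon> < \<epsilon>\<^sub>0 \<Longrightarrow> \<exists>K n\<^sub>0. \<forall>n\<ge>n\<^sub>0. \<exists>F. spanning_set f n \<epsilon> UNIV F \<and>
      (\<forall>G. finite G \<longrightarrow> G \<subseteq> F \<longrightarrow> (\<Sum>x\<in>G. exp (birkhoff_sum f g n x)) \<le> K)"
  shows "measure_entropy f \<mu> \<le> ereal (- integral\<^sup>L \<mu> g)"
proof -
  interpret inv_sys f \<mu>
    using borel_measurable_continuous_onI[OF contf] \<mu> by (rule inv_sys.intro)
  have gm: "g \<in> borel_measurable borel" by (rule borel_measurable_continuous_onI[OF contg])
  have "bounded (range g)" by (intro compact_imp_bounded compact_continuous_image contg comp)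
  then obtain B where B: "\<And>x. \<bar>g x\<bar> \<le> B" by (auto simp: bounded_iff)
  have ucont: "uniformly_continuous_on UNIV g" by (rule compact_uniformly_continuous[OF contg comp])
  show ?thesis
  proof (rule measure_entropy_le)
    fix \<xi> :: "'a set set" assume \<xi>: "finite \<xi>" "\<xi> \<subseteq> sets borel" "partition_on UNIV \<xi>"
    let ?X = "cell \<xi>"
    have X: "simple_function \<mu> ?X" by (rule simple_cell[OF \<xi>])
    have "rate f \<mu> ?X + integral\<^sup>L \<mu> g \<le> 0 + e" if "e > 0" for e
    proof -
      define e' where "e' = e / 3"
      have e': "e' > 0" using that by (simp add: e'_def)
      \<comment> \<open>The order of the choices matters: N fixes the approximation Y, Y fixes d and
        hence \<epsilon>, \<epsilon> fixes K, and m is taken last to outweigh K.\<close>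
      obtain N :: nat where N: "(1 + ln 2) / e' < real N" using reals_Archimedean2 by blast
      have "0 < (1 + ln (2::real)) / e'" using e' ln_gt_zero[of "2::real"] by (intro divide_pos_pos) linarith+
      with N have N1: "N \<ge> 1" by linarith
      have N2: "(1 + ln 2) / real N < e'" using N N1 e' by (simp add: field_simps)
      obtain Y :: "'a \<Rightarrow> 'a set list option" where Y: "simple_function \<mu> Y" "\<And>l. closed (Y -` {Some l})"
        "ent \<mu> (\<lambda>x. (word f N ?X x, Y x)) \<le> ent \<mu> Y + 1"
        using exists_closed_approx[OF inv_sys_axioms simple_word[OF X, of N]] by blast
      have finY: "finite (range Y)" using simple_functionD(1)[OF Y(1)] by (simp add: space_UNIV)
      obtain d where d: "d > 0" "\<And>x x'. Y x \<noteq> None \<Longrightarrow> Y x' \<noteq> None \<Longrightarrow> Y x \<noteq> Y x' \<Longrightarrow> d \<le> dist x x'"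
        using closed_labels_separated[OF comp finY Y(2)] by blast
      obtain \<eta> where \<eta>: "\<eta> > 0" "\<And>x y. dist x y < \<eta> \<Longrightarrow> dist (g x) (g y) < e'"
        using ucont e' unfolding uniformly_continuous_on_def by (metis UNIV_I)
      define \<epsilon> where "\<epsilon> = min (\<epsilon>\<^sub>0 / 2) (min (d / 3) (\<eta> / 2))"
      have \<epsilon>: "0 < \<epsilon>" "\<epsilon> < \<epsilon>\<^sub>0" "2 * \<epsilon> < d" "\<epsilon> < \<eta>" using \<epsilon>0 d(1) \<eta>(1) by (auto simp: \<epsilon>_def)
      have \<omega>: "\<bar>g x - g y\<bar> \<le> e'" if "dist x y \<le> \<epsilon>" for x y
        using \<eta>(2)[of x y] that \<epsilon>(4) by (simp add: dist_real_def)
      obtain K n\<^sub>0 where K: "\<And>n. n \<ge> n\<^sub>0 \<Longrightarrow> \<exists>F. spanning_set f n \<epsilon> UNIV F \<and>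
        (\<forall>G. finite G \<longrightarrow> G \<subseteq> F \<longrightarrow> (\<Sum>x\<in>G. exp (birkhoff_sum f g n x)) \<le> K)"
        using H[OF \<epsilon>(1,2)] by blast
      obtain m0 :: nat where m0: "\<bar>1 + ln K\<bar> / e' < real m0" using reals_Archimedean2 by blast
      define m where "m = max m0 (max n\<^sub>0 1)"
      have m: "m \<ge> 1" "m \<ge> n\<^sub>0" "real m \<ge> real m0" by (auto simp: m_def)
      have "n\<^sub>0 \<le> m * N" using m(2) N1 by (metis mult.right_neutral mult_le_mono)
      then obtain F where F: "spanning_set f (m * N) \<epsilon> UNIV F"
        "\<And>G. finite G \<Longrightarrow> G \<subseteq> F \<Longrightarrow> (\<Sum>x\<in>G. exp (birkhoff_sum f g (m * N) x)) \<le> K"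
        using K by blast
      have *: "rate f \<mu> ?X + integral\<^sup>L \<mu> g \<le> e' + (1 + ln K) / (real m * real N) + (1 + ln 2) / real N"
        by (rule block_entropy_bound(2)[OF inv_sys_axioms gm B X Y(1,3) d(2) \<epsilon>(3) \<omega> N1 m(1) F])
      have "(1 + ln K) / (real m * real N) \<le> \<bar>1 + ln K\<bar> / (real m * real N)" by (intro divide_right_mono) auto
      also have "\<dots> \<le> \<bar>1 + ln K\<bar> / real m" using m(1) N1 by (intro divide_left_mono) auto
      also have "\<dots> \<le> e'"
      proof -
        have "\<bar>1 + ln K\<bar> < e' * real m0" using m0 e' by (simp add: field_simps)
        also have "\<dots> \<le> e' * real m" using m e' by (intro mult_left_mono) auto
        finally show ?thesis using m(1) by (simp add: field_simps)
      qed
      finally show ?thesis using * N2 unfolding e'_def by linarith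
    qed
    then have "rate f \<mu> ?X + integral\<^sup>L \<mu> g \<le> 0" by (rule field_le_epsilon)
    then show "ereal (rate f \<mu> ?X) \<le> ereal (- integral\<^sup>L \<mu> g)" by simp
  qed
qed

subsection \<open>Induced pressure\<close>

text \<open>\<open>Lim\<close> has a meaningful value only where convergence is known. Monotonicity
  provides it, with the supremum as the limit, so every fixed scale lies below the limit.\<close>

lemma antimono_le_Lim_at_right:
  fixes G :: "real \<Rightarrow> ereal"
  assumes mono: "\<And>\<epsilon> \<epsilon>'. 0 < \<epsilon> \<Longrightarrow> \<epsilon> \<le> \<epsilon>' \<Longrightarrow> G \<epsilon>' \<le> G \<epsilon>" and "0 < \<epsilon>"
  shows "G \<epsilon> \<le> Lim (at_right 0) G"
proof -
  let ?S = "SUP \<epsilon>\<in>{0<..}. G \<epsilon>"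
  have "(G \<longlongrightarrow> ?S) (at_right 0)"
  proof (rule order_tendstoI)
    fix a assume "a < ?S"
    then obtain e where e: "e > 0" "a < G e" by (auto simp: less_SUP_iff)
    have "\<forall>\<^sub>F x in at_right 0. 0 < x \<and> x < e"
      using e(1) by (auto simp: eventually_at_right_field)
    then show "\<forall>\<^sub>F x in at_right 0. a < G x"
      by eventually_elim (use e(2) mono in \<open>metis less_imp_le order_less_le_trans\<close>)
  next
    fix b assume b: "?S < b"
    have "\<forall>\<^sub>F x in at_right (0::real). 0 < x" by (auto simp: eventually_at_right_field intro: exI[of _ 1])
    then show "\<forall>\<^sub>F x in at_right 0. G x < b"
    proof eventually_elim
      case (elim x)
      then have "G x \<le> ?S" by (intro SUP_upper) simp
      then show ?case using b by (rule order_le_less_trans)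
    qed
  qed
  then have "Lim (at_right 0) G = ?S" by (intro tendsto_Lim) auto
  then show ?thesis using assms(2) by (auto intro: SUP_upper)
qed

section \<open>Spanning sets and finiteness of entropy\<close>

lemma spanning_set_mono: "spanning_set f n \<epsilon> Z F \<Longrightarrow> \<epsilon> \<le> \<epsilon>' \<Longrightarrow> spanning_set f n \<epsilon>' Z F"
  unfolding spanning_set_def by (meson order_trans)

lemma finite_spanning_set:
  fixes f :: "'a::metric_space \<Rightarrow> 'a"
  assumes comp: "compact (UNIV :: 'a set)" and contf: "continuous_on UNIV f" and \<epsilon>: "\<epsilon> > 0" and n: "n \<ge> 1"
  shows "\<exists>F. finite F \<and> spanning_set f n \<epsilon> UNIV F"
proof -
  define U where "U y = (\<Inter>i<n. {x. dist ((f ^^ i) y) ((f ^^ i) x) < \<epsilon>})" for y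
  have cont: "continuous_on UNIV (f ^^ i)" for i
  proof (induction i)
    case (Suc i)
    show ?case unfolding funpow.simps
      by (rule continuous_on_compose[OF Suc]) (rule continuous_on_subset[OF contf], simp)
  qed (simp add: id_def)
  have "open (U y)" for y
    unfolding U_def
  proof (intro open_INT finite_lessThan ballI)
    fix i
    show "open {x. dist ((f ^^ i) y) ((f ^^ i) x) < \<epsilon>}"
      by (intro open_Collect_less continuous_on_dist continuous_on_const cont)
  qed
  moreover have "x \<in> U x" for x using \<epsilon> by (simp add: U_def)
  then have "UNIV \<subseteq> (\<Union>y\<in>UNIV. U y)" by blast
  ultimately obtain F where "F \<subseteq> UNIV" and F: "finite F" "UNIV \<subseteq> (\<Union>y\<in>F. U y)"
    by (rule compactE_image[OF comp])
  have "spanning_set f n \<epsilon> UNIV F"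
    unfolding spanning_set_def
  proof
    fix x :: 'a
    obtain y where y: "y \<in> F" "x \<in> U y" using F(2) by blast
    have "bowen_dist f n y x \<le> \<epsilon>"
      unfolding bowen_dist_def using n y(2) by (subst Max_le_iff) (auto simp: U_def lessThan_empty_iff intro: less_imp_le)
    then show "\<exists>y\<in>F. bowen_dist f n y x \<le> \<epsilon>" using y(1) by blast
  qed
  then show ?thesis using F(1) by blast
qed

lemma min_spanning_card:
  fixes f :: "'a::metric_space \<Rightarrow> 'a"
  assumes "compact (UNIV :: 'a set)" "continuous_on UNIV f" "\<epsilon> > 0" "n \<ge> 1"
  obtains F where "finite F" "spanning_set f n \<epsilon> UNIV F" "card F = min_spanning_card f n \<epsilon>"
proof -
  have "{card F | F. finite F \<and> spanning_set f n \<epsilon> UNIV F} \<noteq> {}"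
    using finite_spanning_set[OF assms] by blast
  from Inf_nat_def1[OF this] show ?thesis
    using that unfolding min_spanning_card_def by fastforce
qed

lemma min_spanning_card_pos:
  fixes f :: "'a::metric_space \<Rightarrow> 'a"
  assumes "compact (UNIV :: 'a set)" "continuous_on UNIV f" "\<epsilon> > 0" "n \<ge> 1"
  shows "min_spanning_card f n \<epsilon> > 0"
proof -
  obtain F where F: "finite F" "spanning_set f n \<epsilon> UNIV F" "card F = min_spanning_card f n \<epsilon>"
    by (rule min_spanning_card[OF assms])
  then have "F \<noteq> {}" by (auto simp: spanning_set_def)
  then show ?thesis using F by (metis card_gt_0_iff)
qed

lemma min_spanning_card_antimono:
  fixes f :: "'a::metric_space \<Rightarrow> 'a"
  assumes "compact (UNIV :: 'a set)" "continuous_on UNIV f" "\<epsilon> > 0" "n \<ge> 1" "\<epsilon> \<le> \<epsilon>'"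
  shows "min_spanning_card f n \<epsilon>' \<le> min_spanning_card f n \<epsilon>"
proof -
  obtain F where F: "finite F" "spanning_set f n \<epsilon> UNIV F" "card F = min_spanning_card f n \<epsilon>"
    by (rule min_spanning_card[OF assms(1-4)])
  then have "card F \<in> {card F | F. finite F \<and> spanning_set f n \<epsilon>' UNIV F}"
    using spanning_set_mono[OF _ assms(5)] by blast
  then show ?thesis unfolding F(3)[symmetric] min_spanning_card_def[of f n \<epsilon>'] by (rule wellorder_Inf_le1)
qed

text \<open>The constant potential \<open>- \<beta>\<close> with \<beta> above the topological
  entropy: for large n minimal spanning sets have fewer than \<open>exp (\<beta> * n)\<close>
  points, so their total weight is at most 1.\<close>

lemma measure_entropy_le_top_entropy:
  fixes f :: "'a::metric_space \<Rightarrow> 'a"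
  assumes comp: "compact (UNIV :: 'a set)" and contf: "continuous_on UNIV f"
    and \<mu>: "\<mu> \<in> invariant_measures f" and \<beta>: "top_entropy f < ereal \<beta>"
  shows "measure_entropy f \<mu> \<le> ereal \<beta>"
proof -
  let ?G = "\<lambda>\<epsilon>. limsup (\<lambda>n. ereal (ln (real (min_spanning_card f n \<epsilon>)) / real n))"
  interpret inv_sys f \<mu>
    using borel_measurable_continuous_onI[OF contf] \<mu> by (rule inv_sys.intro)
  have mono: "?G \<epsilon>' \<le> ?G \<epsilon>" if "0 < \<epsilon>" "\<epsilon> \<le> \<epsilon>'" for \<epsilon> \<epsilon>'
  proof (rule Limsup_mono)
    show "\<forall>\<^sub>F n in sequentially. ereal (ln (real (min_spanning_card f n \<epsilon>')) / real n)
        \<le> ereal (ln (real (min_spanning_card f n \<epsilon>)) / real n)"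
      using eventually_ge_at_top[of 1]
    proof eventually_elim
      case (elim n)
      have "real (min_spanning_card f n \<epsilon>') \<le> real (min_spanning_card f n \<epsilon>)"
        using min_spanning_card_antimono[OF comp contf that(1) elim that(2)] by simp
      moreover have "0 < real (min_spanning_card f n \<epsilon>')"
        using min_spanning_card_pos[OF comp contf _ elim, of \<epsilon>'] that by simp
      ultimately show ?case by (simp add: divide_right_mono)
    qed
  qed
  have "measure_entropy f \<mu> \<le> ereal (- (\<integral>x. - \<beta> \<partial>\<mu>))"
  proof (rule half_variational[OF comp contf _ \<mu>, where \<epsilon>\<^sub>0 = 1])
    fix \<epsilon> :: real assume \<epsilon>: "0 < \<epsilon>" "\<epsilon> < 1"
    have "?G \<epsilon> \<le> top_entropy f"
      unfolding top_entropy_def by (rule antimono_le_Lim_at_right[OF mono \<epsilon>(1)])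
    then have "?G \<epsilon> < ereal \<beta>" using \<beta> by simp
    from Limsup_lessD[OF this] obtain n0 where
      n0: "\<And>n. n \<ge> n0 \<Longrightarrow> ln (real (min_spanning_card f n \<epsilon>)) / real n < \<beta>"
      by (auto simp: eventually_sequentially)
    have "\<exists>F. spanning_set f n \<epsilon> UNIV F \<and> (\<forall>G. finite G \<longrightarrow> G \<subseteq> F \<longrightarrow> (\<Sum>x\<in>G. exp (birkhoff_sum f (\<lambda>_. - \<beta>) n x)) \<le> 1)"
      if n: "n \<ge> max 1 n0" for n
    proof -
      have n1: "n \<ge> 1" "n \<ge> n0" using n by auto
      obtain F where F: "finite F" "spanning_set f n \<epsilon> UNIV F" "card F = min_spanning_card f n \<epsilon>"
        by (rule min_spanning_card[OF comp contf \<epsilon>(1) n1(1)])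
      have pos: "real (card F) > 0" using min_spanning_card_pos[OF comp contf \<epsilon>(1) n1(1)] F(3) by simp
      have "ln (real (card F)) < \<beta> * real n" using n0[OF n1(2)] n1 F(3) by (simp add: field_simps)
      then have "real (card F) < exp (\<beta> * real n)" using pos by (metis exp_less_mono exp_ln)
      then have cF: "real (card F) * exp (- (\<beta> * real n)) \<le> 1"
        by (simp add: exp_minus field_simps)
      have "(\<Sum>x\<in>G. exp (birkhoff_sum f (\<lambda>_. - \<beta>) n x)) \<le> 1" if "G \<subseteq> F" for G
      proof -
        have "(\<Sum>x\<in>G. exp (birkhoff_sum f (\<lambda>_. - \<beta>) n x)) = real (card G) * exp (- (\<beta> * real n))"
          by (simp add: birkhoff_sum_def mult.commute)
        also have "\<dots> \<le> real (card F) * exp (- (\<beta> * real n))"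
          using card_mono[OF F(1) that] by (intro mult_right_mono) auto
        finally show ?thesis using cF by simp
      qed
      then show ?thesis using F(2) by blast
    qed
    then show "\<exists>K n0. \<forall>n\<ge>n0. \<exists>F. spanning_set f n \<epsilon> UNIV F \<and>
        (\<forall>G. finite G \<longrightarrow> G \<subseteq> F \<longrightarrow> (\<Sum>x\<in>G. exp (birkhoff_sum f (\<lambda>_. - \<beta>) n x)) \<le> K)"
      by blast
  qed (auto intro: continuous_intros)
  then show ?thesis using prob_space by simp
qed

section \<open>Entropy bounded through the induced pressure\<close>

lemma sum_le_infsum_ennreal:
  fixes u :: "'b \<Rightarrow> ennreal"
  assumes "finite G" "G \<subseteq> A"
  shows "sum u G \<le> infsum u A"
  using assms by (subst nonneg_infsum_complete) (auto intro: SUP_upper)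

lemma induced_Q_antimono:
  assumes "\<epsilon> \<le> \<epsilon>'"
  shows "induced_Q f \<psi> \<phi> T \<epsilon>' \<le> induced_Q f \<psi> \<phi> T \<epsilon>"
  unfolding induced_Q_def
proof (rule INF_superset_mono)
  show "{F. \<forall>n\<in>level_times f \<psi> T. spanning_set f n \<epsilon> (level_set f \<psi> T n) (F n)}
      \<subseteq> {F. \<forall>n\<in>level_times f \<psi> T. spanning_set f n \<epsilon>' (level_set f \<psi> T n) (F n)}"
    using spanning_set_mono[of f _ \<epsilon> _ _ \<epsilon>'] assms by blast
qed simp

lemma ln_ennreal_mono: "x \<le> y \<Longrightarrow> ln_ennreal x \<le> ln_ennreal y"
proof (cases "x = 0 \<or> y = \<infinity>")
  case False
  assume le: "x \<le> y"
  with False have "x \<noteq> 0" "y \<noteq> 0" "x \<noteq> \<infinity>" "y \<noteq> \<infinity>" by (auto simp: top_unique)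
  moreover from this have "0 < enn2real x" "enn2real x \<le> enn2real y"
    using le by (auto simp: enn2real_positive_iff less_top enn2real_mono zero_less_iff_neq_zero)
  ultimately show ?thesis by (simp add: ln_ennreal_def)
qed (auto simp: ln_ennreal_def)

lemma ln_ennreal_less:
  assumes "ln_ennreal x < ereal r"
  shows "x < ennreal (exp r)"
proof -
  consider "x = 0" | "x \<noteq> 0" "x \<noteq> \<infinity>" "ln (enn2real x) < r"
    using assms by (auto simp: ln_ennreal_def split: if_splits)
  then show ?thesis
  proof cases
    case 2
    then have "enn2real x > 0" by (simp add: enn2real_positive_iff less_top zero_less_iff_neq_zero)
    then have "enn2real x < exp r" using 2 by (metis exp_less_mono exp_ln)
    then have "ennreal (enn2real x) < ennreal (exp r)" by (intro ennreal_lessI) auto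
    then show ?thesis using 2 by (simp add: less_top)
  qed simp
qed

text \<open>For \<beta> above the pressure, the potential \<open>\<phi> - \<beta> * \<psi>\<close>
  satisfies the hypothesis of \<open>half_variational\<close>. At level T the sum of \<psi> is close
  to T, and the weights of \<phi> add up to at most \<open>exp (\<beta>' * T)\<close> with
  \<open>\<beta>' < \<beta>\<close>. The contributions of the levels therefore decay exponentially
  in T, and their total is bounded uniformly in n.\<close>

lemma induced_pressure_variational:
  fixes f :: "'a::metric_space \<Rightarrow> 'a" and \<phi> \<psi> :: "'a \<Rightarrow> real"
  assumes comp: "compact (UNIV :: 'a set)" and contf: "continuous_on UNIV f"
    and cont\<phi>: "continuous_on UNIV \<phi>" and cont\<psi>: "continuous_on UNIV \<psi>" and \<psi>pos: "\<And>x. \<psi> x > 0"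
    and \<mu>: "\<mu> \<in> invariant_measures f" and \<beta>: "induced_pressure f \<psi> \<phi> < ereal \<beta>"
  shows "measure_entropy f \<mu> \<le> ereal (- (\<integral>x. \<phi> x - \<beta> * \<psi> x \<partial>\<mu>))"
proof -
  let ?S = "birkhoff_sum f"
  let ?g = "\<lambda>x. \<phi> x - \<beta> * \<psi> x"
  let ?G = "\<lambda>\<epsilon>. Limsup (at_top :: real filter) (\<lambda>T. ln_ennreal (induced_Q f \<psi> \<phi> T \<epsilon>) / ereal T)"
  have mono: "?G \<epsilon>' \<le> ?G \<epsilon>" if "0 < \<epsilon>" "\<epsilon> \<le> \<epsilon>'" for \<epsilon> \<epsilon>'
  proof (rule Limsup_mono)
    show "\<forall>\<^sub>F T in at_top. ln_ennreal (induced_Q f \<psi> \<phi> T \<epsilon>') / ereal T \<le> ln_ennreal (induced_Q f \<psi> \<phi> T \<epsilon>) / ereal T"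
      using eventually_gt_at_top[of 0]
      by eventually_elim (intro ereal_divide_right_mono ln_ennreal_mono induced_Q_antimono that, simp)
  qed
  obtain a where a: "\<And>x. \<psi> a \<le> \<psi> x"
    using continuous_attains_inf[OF comp _ cont\<psi>] by auto
  obtain b where b: "\<And>x. \<psi> x \<le> \<psi> b"
    using continuous_attains_sup[OF comp _ cont\<psi>] by auto
  define m where "m = \<psi> a"
  define M where "M = \<psi> b"
  have m: "m > 0" "\<And>x. m \<le> \<psi> x" and M: "\<And>x. \<psi> x \<le> M" using \<psi>pos a b by (auto simp: m_def M_def)
  obtain \<beta>' where \<beta>': "induced_pressure f \<psi> \<phi> < ereal \<beta>'" "\<beta>' < \<beta>"
    using ereal_dense2[OF \<beta>] by auto
  \<comment> \<open>One half of the gap between \<beta> and \<open>\<beta>'\<close> pays for the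
    error of shadowing, the other half gives the decay \<open>exp (- \<delta> * T)\<close>.\<close>
  define \<delta> where "\<delta> = (\<beta> - \<beta>') / 2"
  have \<delta>: "\<delta> > 0" using \<beta>' by (simp add: \<delta>_def)
  \<comment> \<open>With this bound on the oscillation of \<psi>, the shadowing error over n steps,
    multiplied by \<open>\<bar>\<beta>\<bar>\<close>, is at most
    \<open>n * m * \<delta> \<le> T * \<delta>\<close>. The added 1 avoids division by 0.\<close>
  define \<omega> where "\<omega> = m * \<delta> / (\<bar>\<beta>\<bar> + 1)"
  have \<omega>0: "\<omega> > 0" using m \<delta> by (simp add: \<omega>_def)
  have "\<bar>\<beta>\<bar> * \<omega> \<le> (\<bar>\<beta>\<bar> + 1) * \<omega>" using \<omega>0 by (intro mult_right_mono) auto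
  also have "\<dots> = m * \<delta>" by (simp add: \<omega>_def)
  finally have \<beta>\<omega>: "\<bar>\<beta>\<bar> * \<omega> \<le> m * \<delta>" .
  obtain \<eta> where \<eta>: "\<eta> > 0" "\<And>x y. dist x y < \<eta> \<Longrightarrow> dist (\<psi> x) (\<psi> y) < \<omega>"
    using compact_uniformly_continuous[OF cont\<psi> comp] \<omega>0 unfolding uniformly_continuous_on_def by (metis UNIV_I)
  show ?thesis
  proof (rule half_variational[OF comp contf _ \<mu> \<eta>(1)])
    show "continuous_on UNIV ?g" by (intro continuous_intros cont\<phi> cont\<psi>)
    fix \<epsilon> :: real assume \<epsilon>: "0 < \<epsilon>" "\<epsilon> < \<eta>"
    have "?G \<epsilon> \<le> induced_pressure f \<psi> \<phi>"
      unfolding induced_pressure_def by (rule antimono_le_Lim_at_right[OF mono \<epsilon>(1)])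
    then have "?G \<epsilon> < ereal \<beta>'" using \<beta>' by simp
    from Limsup_lessD[OF this] obtain T0' where
      T0': "\<And>T. T \<ge> T0' \<Longrightarrow> ln_ennreal (induced_Q f \<psi> \<phi> T \<epsilon>) / ereal T < ereal \<beta>'"
      by (auto simp: eventually_at_top_linorder)
    define T0 where "T0 = max T0' 1"
    have "\<exists>F. (\<forall>n\<in>level_times f \<psi> T. spanning_set f n \<epsilon> (level_set f \<psi> T n) (F n)) \<and>
      (\<Sum>\<^sub>\<infinity>n\<in>level_times f \<psi> T. \<Sum>\<^sub>\<infinity>x\<in>F n. ennreal (exp (?S \<phi> n x))) < ennreal (exp (\<beta>' * T))"
      if "T \<ge> T0" for T
    proof -
      have T: "T > 0" "T \<ge> T0'" using that by (auto simp: T0_def)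
      have "ln_ennreal (induced_Q f \<psi> \<phi> T \<epsilon>) < ereal (\<beta>' * T)"
        using T0'[OF T(2)] T(1) by (simp add: ereal_divide_less_iff)
      from ln_ennreal_less[OF this] show ?thesis
        unfolding induced_Q_def INF_less_iff by blast
    qed
    then have "\<forall>T. \<exists>F. T \<ge> T0 \<longrightarrow> (\<forall>n\<in>level_times f \<psi> T. spanning_set f n \<epsilon> (level_set f \<psi> T n) (F n)) \<and>
      (\<Sum>\<^sub>\<infinity>n\<in>level_times f \<psi> T. \<Sum>\<^sub>\<infinity>x\<in>F n. ennreal (exp (?S \<phi> n x))) < ennreal (exp (\<beta>' * T))"
      by blast
    from choice[OF this] obtain Fam where Fam: "\<And>T n. T \<ge> T0 \<Longrightarrow> n \<in> level_times f \<psi> T \<Longrightarrow> spanning_set f n \<epsilon> (level_set f \<psi> T n) (Fam T n)"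
      "\<And>T. T \<ge> T0 \<Longrightarrow> (\<Sum>\<^sub>\<infinity>n\<in>level_times f \<psi> T. \<Sum>\<^sub>\<infinity>x\<in>Fam T n. ennreal (exp (?S \<phi> n x))) < ennreal (exp (\<beta>' * T))"
      by blast
    have Fam_sum: "(\<Sum>x\<in>G. exp (?S \<phi> n x)) \<le> exp (\<beta>' * T)"
      if "T \<ge> T0" "n \<in> level_times f \<psi> T" "finite G" "G \<subseteq> Fam T n" for T n G
    proof -
      have "ennreal (\<Sum>x\<in>G. exp (?S \<phi> n x)) = (\<Sum>x\<in>G. ennreal (exp (?S \<phi> n x)))"
        by (rule sum_ennreal[symmetric]) simp
      also have "\<dots> \<le> (\<Sum>\<^sub>\<infinity>x\<in>Fam T n. ennreal (exp (?S \<phi> n x)))"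
        by (rule sum_le_infsum_ennreal[OF that(3,4)])
      also have "\<dots> = (\<Sum>n\<in>{n}. \<Sum>\<^sub>\<infinity>x\<in>Fam T n. ennreal (exp (?S \<phi> n x)))" by simp
      also have "\<dots> \<le> (\<Sum>\<^sub>\<infinity>n\<in>level_times f \<psi> T. \<Sum>\<^sub>\<infinity>x\<in>Fam T n. ennreal (exp (?S \<phi> n x)))"
        by (rule sum_le_infsum_ennreal) (use that in auto)
      also have "\<dots> < ennreal (exp (\<beta>' * T))" by (rule Fam(2)[OF that(1)])
      finally show ?thesis by (simp add: ennreal_less_iff sum_nonneg less_imp_le)
    qed
    \<comment> \<open>As \<open>m \<le> \<psi>\<close>, at every time \<open>n\<close> an orbit is at one of the levels \<open>k m\<close>. The spanning sets for
      these levels therefore add up to a spanning set of the whole space.\<close>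
    define A where "A T n = {x\<in>Fam T n. \<exists>y\<in>level_set f \<psi> T n. bowen_dist f n x y \<le> \<epsilon>}" for T n
    define F where "F n = (\<Union>k\<in>{k::nat. real k * m \<ge> T0 \<and> n \<in> level_times f \<psi> (real k * m)}. A (real k * m) n)" for n
    have Sm: "real n * m \<le> ?S \<psi> n y" for n y
    proof -
      have "(\<Sum>i<n. m) \<le> ?S \<psi> n y" unfolding birkhoff_sum_def by (intro sum_mono m)
      then show ?thesis by simp
    qed
    \<comment> \<open>The bound 1 on n matches the range of \<open>level_times\<close>, and
      \<open>T0 / m\<close> ensures that the level used is at least T0.\<close>
    have span: "spanning_set f n \<epsilon> UNIV (F n)" if n: "n \<ge> max 1 (nat \<lceil>T0 / m\<rceil>)" for n
      unfolding spanning_set_def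
    proof
      fix y :: 'a
      have "T0 / m \<le> real n" using n by linarith
      then have "T0 \<le> real n * m" using m by (simp add: field_simps)
      with Sm[of n y] have s: "T0 \<le> ?S \<psi> n y" by linarith
      \<comment> \<open>For the sum S of \<psi> over n steps, rounding up gives
        \<open>S \<le> k * m < S + m\<close>, and the next step adds at least m. So y crosses the
        level \<open>k * m\<close> exactly at time n.\<close>
      define k where "k = nat \<lceil>?S \<psi> n y / m\<rceil>"
      have s0: "?S \<psi> n y / m \<ge> 0" using s m by (simp add: T0_def)
      then have k: "?S \<psi> n y / m \<le> real k" "real k < ?S \<psi> n y / m + 1" unfolding k_def by linarith+
      then have kT: "?S \<psi> n y \<le> real k * m" "real k * m < ?S \<psi> n y + m"
        using m by (simp_all add: field_simps)
      have "?S \<psi> (n + 1) y = ?S \<psi> n y + \<psi> ((f ^^ n) y)" by (simp add: birkhoff_sum_def)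
      with kT m(2)[of "(f ^^ n) y"] have "real k * m < ?S \<psi> (n + 1) y" by linarith
      with kT have yl: "y \<in> level_set f \<psi> (real k * m) n" by (simp add: level_set_def)
      then have nl: "n \<in> level_times f \<psi> (real k * m)" using n by (auto simp: level_set_def level_times_def)
      have T: "real k * m \<ge> T0" using s kT by linarith
      obtain x where "x \<in> Fam (real k * m) n" "bowen_dist f n x y \<le> \<epsilon>"
        using Fam(1)[OF T nl] yl unfolding spanning_set_def by blast
      then have "x \<in> A (real k * m) n" using yl by (auto simp: A_def)
      then show "\<exists>x\<in>F n. bowen_dist f n x y \<le> \<epsilon>"
        using T nl \<open>bowen_dist f n x y \<le> \<epsilon>\<close> unfolding F_def by blast
    qed
    \<comment> \<open>Points of a spanning set could lie anywhere. Those kept in A shadow a point y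
      of the level set, whose sum lies between \<open>T - M\<close> and T, and this transfers to x
      up to \<open>n * \<omega>\<close>.\<close>
    have est: "- \<beta> * ?S \<psi> n x \<le> - \<beta> * T + \<bar>\<beta>\<bar> * M + T * \<delta>" if x: "x \<in> A T n" for x T n
    proof -
      obtain y where y: "?S \<psi> n y \<le> T" "?S \<psi> (n + 1) y > T" "bowen_dist f n x y \<le> \<epsilon>"
        using x by (auto simp: A_def level_set_def)
      have "?S \<psi> (n + 1) y = ?S \<psi> n y + \<psi> ((f ^^ n) y)" by (simp add: birkhoff_sum_def)
      with y(2) M[of "(f ^^ n) y"] have "T - M \<le> ?S \<psi> n y" by linarith
      moreover have "\<bar>?S \<psi> n x - ?S \<psi> n y\<bar> \<le> real n * \<omega>"
      proof (rule birkhoff_sum_close)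
        fix i assume "i < n"
        then have "dist ((f ^^ i) x) ((f ^^ i) y) < \<eta>" using bowen_distD[OF y(3)] \<epsilon>(2) by fastforce
        then show "\<bar>\<psi> ((f ^^ i) x) - \<psi> ((f ^^ i) y)\<bar> \<le> \<omega>" using \<eta>(2) by (fastforce simp: dist_real_def)
      qed
      ultimately have d: "\<bar>T - ?S \<psi> n x\<bar> \<le> M + real n * \<omega>"
        using y(1) m(1) m(2)[of y] M[of y] by (simp add: abs_le_iff)
      have "- \<beta> * ?S \<psi> n x = - \<beta> * T + \<beta> * (T - ?S \<psi> n x)" by (simp add: algebra_simps)
      also have "\<beta> * (T - ?S \<psi> n x) \<le> \<bar>\<beta>\<bar> * \<bar>T - ?S \<psi> n x\<bar>" by (metis abs_ge_self abs_mult)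
      also have "\<dots> \<le> \<bar>\<beta>\<bar> * (M + real n * \<omega>)" using d by (intro mult_left_mono) auto
      also have "\<dots> = \<bar>\<beta>\<bar> * M + real n * (\<bar>\<beta>\<bar> * \<omega>)" by (simp add: algebra_simps)
      also have "real n * (\<bar>\<beta>\<bar> * \<omega>) \<le> real n * (m * \<delta>)" using \<beta>\<omega> by (intro mult_left_mono) auto
      also have "\<dots> = (real n * m) * \<delta>" by simp
      also have "\<dots> \<le> T * \<delta>" using Sm[of n y] y(1) \<delta> by (intro mult_right_mono) linarith+
      finally show ?thesis by simp
    qed
    define C where "C = exp (\<bar>\<beta>\<bar> * M)"
    define r where "r = exp (- (m * \<delta>))"
    have r: "0 < r" "r < 1" using m \<delta> by (auto simp: r_def)
    have bound: "(\<Sum>x\<in>G. exp (?S ?g n x)) \<le> C / (1 - r)" if G: "finite G" "G \<subseteq> F n" for G n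
    proof -
      have "\<forall>x\<in>G. \<exists>k::nat. real k * m \<ge> T0 \<and> n \<in> level_times f \<psi> (real k * m) \<and> x \<in> A (real k * m) n"
        using G(2) unfolding F_def by blast
      \<comment> \<open>Levels may share points. Assigning each point of G to one level splits the
        sum over G without repetition.\<close>
      then obtain \<kappa> :: "'a \<Rightarrow> nat" where \<kappa>: "\<And>x. x \<in> G \<Longrightarrow> real (\<kappa> x) * m \<ge> T0"
        "\<And>x. x \<in> G \<Longrightarrow> n \<in> level_times f \<psi> (real (\<kappa> x) * m)" "\<And>x. x \<in> G \<Longrightarrow> x \<in> A (real (\<kappa> x) * m) n"
        by metis
      have "(\<Sum>x\<in>G. exp (?S ?g n x)) = (\<Sum>k\<in>\<kappa> ` G. \<Sum>x\<in>{x\<in>G. \<kappa> x = k}. exp (?S ?g n x))"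
        by (rule sum.image_gen[OF G(1)])
      also have "\<dots> \<le> (\<Sum>k\<in>\<kappa> ` G. C * r ^ k)"
      proof (rule sum_mono)
        fix k assume k: "k \<in> \<kappa> ` G"
        define T where "T = real k * m"
        have T: "T \<ge> T0" "n \<in> level_times f \<psi> T" using k \<kappa> by (auto simp: T_def)
        have "(\<Sum>x\<in>{x\<in>G. \<kappa> x = k}. exp (?S ?g n x)) \<le>
            (\<Sum>x\<in>{x\<in>G. \<kappa> x = k}. exp (- \<beta> * T + \<bar>\<beta>\<bar> * M + T * \<delta>) * exp (?S \<phi> n x))"
        proof (rule sum_mono)
          fix x assume x: "x \<in> {x\<in>G. \<kappa> x = k}"
          have "?S ?g n x = - \<beta> * ?S \<psi> n x + ?S \<phi> n x"
            by (simp add: birkhoff_sum_def sum_subtractf sum_distrib_left sum_negf)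
          also have "\<dots> \<le> (- \<beta> * T + \<bar>\<beta>\<bar> * M + T * \<delta>) + ?S \<phi> n x"
            using est[of x T n] \<kappa>(3)[of x] x by (simp add: T_def)
          finally show "exp (?S ?g n x) \<le> exp (- \<beta> * T + \<bar>\<beta>\<bar> * M + T * \<delta>) * exp (?S \<phi> n x)"
            by (simp flip: exp_add)
        qed
        also have "\<dots> = exp (- \<beta> * T + \<bar>\<beta>\<bar> * M + T * \<delta>) * (\<Sum>x\<in>{x\<in>G. \<kappa> x = k}. exp (?S \<phi> n x))"
          by (simp add: sum_distrib_left)
        also have "\<dots> \<le> exp (- \<beta> * T + \<bar>\<beta>\<bar> * M + T * \<delta>) * exp (\<beta>' * T)"
        proof (intro mult_left_mono Fam_sum T)
          show "{x\<in>G. \<kappa> x = k} \<subseteq> Fam T n" using \<kappa>(3) by (auto simp: A_def T_def)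
        qed (use G in auto)
        also have "\<dots> = exp (\<bar>\<beta>\<bar> * M + - \<beta> * T + T * \<delta> + \<beta>' * T)" by (simp flip: exp_add)
        also have "\<bar>\<beta>\<bar> * M + - \<beta> * T + T * \<delta> + \<beta>' * T = \<bar>\<beta>\<bar> * M + real k * (- (m * \<delta>))"
          by (simp add: \<delta>_def T_def field_simps)
        also have "exp \<dots> = C * r ^ k"
          by (simp only: C_def r_def exp_add exp_of_nat_mult)
        finally show "(\<Sum>x\<in>{x\<in>G. \<kappa> x = k}. exp (?S ?g n x)) \<le> C * r ^ k" .
      qed
      also have "\<dots> = C * (\<Sum>k\<in>\<kappa> ` G. r ^ k)" by (simp add: sum_distrib_left)
      \<comment> \<open>The value of the series serves as the constant K of
        \<open>half_variational\<close>, since it depends on neither n nor G.\<close>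
      also have "\<dots> \<le> C * (\<Sum>k. r ^ k)"
        using r G by (intro mult_left_mono sum_le_suminf summable_geometric) (auto simp: C_def)
      also have "\<dots> = C / (1 - r)" using r by (simp add: suminf_geometric)
      finally show ?thesis .
    qed
    show "\<exists>K n0. \<forall>n\<ge>n0. \<exists>F. spanning_set f n \<epsilon> UNIV F \<and>
        (\<forall>G. finite G \<longrightarrow> G \<subseteq> F \<longrightarrow> (\<Sum>x\<in>G. exp (?S ?g n x)) \<le> K)"
      using span bound by blast
  qed
qed

subsection \<open>The ergodic theorem\<close>

text \<open>Invariance is strict, as in \<open>ergodic\<close>, so that real functions measurable
  for this algebra are invariant at every point and not only almost everywhere.\<close>

definition inv_alg :: "('a::topological_space \<Rightarrow> 'a) \<Rightarrow> 'a measure" where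
  "inv_alg f = sigma UNIV {A \<in> sets borel. f -` A = A}"

lemma space_inv_alg: "space (inv_alg f) = UNIV"
  by (simp add: inv_alg_def)

lemma sets_inv_alg: "sets (inv_alg f) = {A \<in> sets borel. f -` A = A}"
proof -
  have "sigma_algebra UNIV {A \<in> sets borel. f -` A = A}"
    unfolding sigma_algebra_iff2
    by (auto simp: vimage_Compl Compl_eq_Diff_UNIV[symmetric] vimage_UN)
  then show ?thesis unfolding inv_alg_def by (simp add: sigma_algebra.sigma_sets_eq)
qed

lemma inv_alg_measurable_comp:
  fixes E :: "'a::topological_space \<Rightarrow> real"
  assumes "E \<in> borel_measurable (inv_alg f)"
  shows "E (f x) = E x"
proof -
  have "E -` {E x} \<in> sets (inv_alg f)"
    using measurable_sets[OF assms, of "{E x}"] by (simp add: space_inv_alg)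
  then have "f -` (E -` {E x}) = E -` {E x}" by (simp add: sets_inv_alg)
  then show ?thesis by blast
qed

lemma inv_alg_measurable_funpow:
  fixes E :: "'a::topological_space \<Rightarrow> real"
  assumes "E \<in> borel_measurable (inv_alg f)"
  shows "E ((f ^^ n) x) = E x"
  by (induction n) (simp_all add: inv_alg_measurable_comp[OF assms])

lemma inv_alg_measurable_borel:
  assumes "E \<in> measurable (inv_alg f) M"
  shows "E \<in> measurable borel M"
  using assms by (auto simp: measurable_def space_inv_alg sets_inv_alg)

text \<open>The maximum of the Birkhoff sums of orders \<open>1, \<dots>, n + 1\<close>.\<close>

fun max_sum :: "('a \<Rightarrow> 'a) \<Rightarrow> ('a \<Rightarrow> real) \<Rightarrow> nat \<Rightarrow> 'a \<Rightarrow> real" where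
  "max_sum f q 0 x = q x"
| "max_sum f q (Suc n) x = q x + max 0 (max_sum f q n (f x))"

lemma birkhoff_sum_Suc_shift: "birkhoff_sum f q (Suc n) x = q x + birkhoff_sum f q n (f x)"
  unfolding birkhoff_sum_def by (subst sum.lessThan_Suc_shift) (simp add: funpow_swap1)

lemma birkhoff_sum_le_max_sum:
  assumes "1 \<le> k" "k \<le> Suc n"
  shows "birkhoff_sum f q k x \<le> max_sum f q n x"
  using assms
proof (induction n arbitrary: k x)
  case 0
  then have "k = 1" by simp
  then show ?case by (simp add: birkhoff_sum_def)
next
  case (Suc n)
  show ?case
  proof (cases "k = 1")
    case True
    then show ?thesis by (simp add: birkhoff_sum_def)
  next
    case False
    with Suc.prems obtain j where j: "k = Suc j" "1 \<le> j" "j \<le> Suc n" by (cases k) auto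
    then show ?thesis using Suc.IH[OF j(2,3), of "f x"] by (simp add: birkhoff_sum_Suc_shift)
  qed
qed

lemma max_sum_mono: "max_sum f q n x \<le> max_sum f q (Suc n) x"
proof (induction n arbitrary: x)
  case (Suc n)
  from Suc[of "f x"] show ?case by simp
qed simp

lemma max_sum_mono': "n \<le> m \<Longrightarrow> max_sum f q n x \<le> max_sum f q m x"
  by (rule lift_Suc_mono_le[of "\<lambda>n. max_sum f q n x"]) (rule max_sum_mono)

context inv_sys
begin

lemma integrable_comp_f:
  fixes q :: "'a \<Rightarrow> real"
  assumes "integrable \<mu> q"
  shows "integrable \<mu> (\<lambda>x. q (f x))" "(\<integral>x. q (f x) \<partial>\<mu>) = integral\<^sup>L \<mu> q"
proof -
  have "integrable (distr \<mu> \<mu> f) q" using assms by (simp add: distr_f)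
  then show "integrable \<mu> (\<lambda>x. q (f x))" by (rule integrable_distr[OF f_meas])
  have "integral\<^sup>L (distr \<mu> \<mu> f) q = (\<integral>x. q (f x) \<partial>\<mu>)"
    by (rule integral_distr[OF f_meas]) (use assms in auto)
  then show "(\<integral>x. q (f x) \<partial>\<mu>) = integral\<^sup>L \<mu> q" by (simp add: distr_f)
qed

lemma max_sum_integrable:
  assumes "integrable \<mu> q"
  shows "integrable \<mu> (max_sum f q n)"
proof (induction n)
  case 0
  then show ?case using assms by (simp cong: Bochner_Integration.integrable_cong)
next
  case (Suc n)
  have "integrable \<mu> (\<lambda>x. q x + max 0 (max_sum f q n (f x)))"
    by (rule Bochner_Integration.integrable_add[OF assms integrable_max[OF integrable_zero integrable_comp_f(1)[OF Suc]]])
  then show ?case by (simp cong: Bochner_Integration.integrable_cong)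
qed

text \<open>The recursion gives \<open>max_sum f q (Suc n) x - max_sum f q n (f x) = q x - min 0
  (max_sum f q n (f x))\<close>. The integral of this over an invariant set is nonnegative, because
  \<open>max_sum\<close> grows with n and \<mu> is invariant. On A the maximal sums are eventually
  positive, so the \<open>min\<close> term vanishes in the limit. Unboundedness, in contrast to
  positivity, makes A invariant.\<close>

lemma maximal_ergodic:
  assumes q: "integrable \<mu> q" "q \<in> borel_measurable borel"
  defines "A \<equiv> {x. \<forall>c::nat. \<exists>n. real c < max_sum f q n x}"
  shows "A \<in> sets (inv_alg f)" "0 \<le> (\<integral>x. indicator A x * q x \<partial>\<mu>)"
proof -
  have mM: "max_sum f q n \<in> borel_measurable borel" for n
    using borel_measurable_integrable[OF max_sum_integrable[OF q(1)]] by (simp add: meas_cong)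
  have Ab: "A \<in> sets borel"
  proof -
    have "A = (\<Inter>c::nat. \<Union>n. max_sum f q n -` {real c<..})" by (auto simp: A_def)
    also have "\<dots> \<in> sets borel"
      by (intro sets.countable_INT'' sets.countable_UN'') (use mM in \<open>auto intro!: measurable_sets_borel\<close>)
    finally show ?thesis .
  qed
  have fA: "f x \<in> A \<longleftrightarrow> x \<in> A" for x
  proof
    assume *: "f x \<in> A"
    show "x \<in> A" unfolding A_def
    proof safe
      fix c :: nat
      obtain d :: nat where d: "real c - q x < real d" using reals_Archimedean2 by blast
      obtain n where "real d < max_sum f q n (f x)" using * unfolding A_def by blast
      with d have "real c < max_sum f q (Suc n) x" by simp
      then show "\<exists>n. real c < max_sum f q n x" by blast
    qed
  next
    assume *: "x \<in> A"
    show "f x \<in> A" unfolding A_def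
    proof safe
      fix c :: nat
      obtain d :: nat where d: "\<bar>q x\<bar> + real c < real d" using reals_Archimedean2 by blast
      obtain n where "real d < max_sum f q n x" using * unfolding A_def by blast
      also have "\<dots> \<le> max_sum f q (Suc n) x" by (rule max_sum_mono)
      finally have "real c < max 0 (max_sum f q n (f x))" using d by simp
      then have "real c < max_sum f q n (f x)" by (simp add: max_def split: if_splits)
      then show "\<exists>n. real c < max_sum f q n (f x)" by blast
    qed
  qed
  then show AI: "A \<in> sets (inv_alg f)" using Ab by (auto simp: sets_inv_alg)
  let ?I = "indicator A :: 'a \<Rightarrow> real"
  have If: "?I (f x) = ?I x" for x using fA by (simp add: indicator_def)
  have Am: "A \<in> events" using Ab by (simp add: sets_\<mu>)
  have int: "integrable \<mu> (\<lambda>x. ?I x * u x)" if "integrable \<mu> u" for u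
    using integrable_mult_indicator[OF Am that] by simp
  have inv: "(\<integral>x. ?I x * u (f x) \<partial>\<mu>) = (\<integral>x. ?I x * u x \<partial>\<mu>)" if "integrable \<mu> u" for u
    using integrable_comp_f(2)[OF int[OF that]] by (simp add: If)
  let ?D = "\<lambda>n x. ?I x * (q x - min 0 (max_sum f q n (f x)))"
  have Mf: "integrable \<mu> (\<lambda>x. max_sum f q n (f x))" for n
    by (rule integrable_comp_f(1)[OF max_sum_integrable[OF q(1)]])
  have pos: "0 \<le> (\<integral>x. ?D n x \<partial>\<mu>)" for n
  proof -
    have "(\<integral>x. ?I x * max_sum f q n x \<partial>\<mu>) \<le> (\<integral>x. ?I x * max_sum f q (Suc n) x \<partial>\<mu>)"
      by (intro integral_mono int max_sum_integrable q(1) mult_left_mono max_sum_mono) auto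
    then have "0 \<le> (\<integral>x. ?I x * max_sum f q (Suc n) x \<partial>\<mu>) - (\<integral>x. ?I x * max_sum f q n (f x) \<partial>\<mu>)"
      by (simp add: inv[OF max_sum_integrable[OF q(1)]] del: max_sum.simps)
    also have "\<dots> = (\<integral>x. ?I x * max_sum f q (Suc n) x - ?I x * max_sum f q n (f x) \<partial>\<mu>)"
      by (intro Bochner_Integration.integral_diff[symmetric] int max_sum_integrable q(1) Mf)
    also have "\<dots> = (\<integral>x. ?D n x \<partial>\<mu>)"
      by (intro Bochner_Integration.integral_cong) (auto simp: algebra_simps min_def max_def)
    finally show ?thesis .
  qed
  have "(\<lambda>n. \<integral>x. ?D n x \<partial>\<mu>) \<longlonglongrightarrow> (\<integral>x. ?I x * q x \<partial>\<mu>)"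
  proof (rule integral_dominated_convergence[where w = "\<lambda>x. \<bar>q x\<bar> + \<bar>q (f x)\<bar>"])
    show "integrable \<mu> (\<lambda>x. \<bar>q x\<bar> + \<bar>q (f x)\<bar>)"
      by (rule Bochner_Integration.integrable_add[OF integrable_abs[OF q(1)] integrable_abs[OF integrable_comp_f(1)[OF q(1)]]])
    show "(\<lambda>x. ?I x * q x) \<in> borel_measurable \<mu>" using int[OF q(1)] by (rule borel_measurable_integrable)
    show "(\<lambda>x. ?D n x) \<in> borel_measurable \<mu>" for n
      by (rule borel_measurable_integrable, rule int,
          rule Bochner_Integration.integrable_diff[OF q(1) integrable_min[OF integrable_zero Mf]])
    show "AE x in \<mu>. (\<lambda>n. ?D n x) \<longlonglongrightarrow> ?I x * q x"
    proof (rule AE_I2)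
      fix x
      show "(\<lambda>n. ?D n x) \<longlonglongrightarrow> ?I x * q x"
      proof (cases "x \<in> A")
        case True
        then have "f x \<in> A" by (simp add: fA)
        then obtain n0 where n0: "0 < max_sum f q n0 (f x)" unfolding A_def by (auto dest: spec[of _ 0])
        have "\<forall>\<^sub>F n in sequentially. ?D n x = ?I x * q x"
          using eventually_ge_at_top[of n0]
        proof eventually_elim
          case (elim n)
          then have "0 < max_sum f q n (f x)" using n0 max_sum_mono'[of n0 n f q "f x"] by linarith
          then show ?case by simp
        qed
        then show ?thesis by (rule tendsto_eventually)
      qed simp
    qed
    show "AE x in \<mu>. norm (?D n x) \<le> \<bar>q x\<bar> + \<bar>q (f x)\<bar>" for n
    proof (rule AE_I2)
      fix x
      \<comment> \<open>The maximum never falls below its first term, so its negative part is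
        dominated by \<open>\<bar>q (f x)\<bar>\<close> for every n.\<close>
      have "max_sum f q 0 (f x) \<le> max_sum f q n (f x)" by (rule max_sum_mono') simp
      then have "\<bar>min 0 (max_sum f q n (f x))\<bar> \<le> \<bar>q (f x)\<bar>" by (simp add: min_def)
      then have "\<bar>q x - min 0 (max_sum f q n (f x))\<bar> \<le> \<bar>q x\<bar> + \<bar>q (f x)\<bar>" by linarith
      then show "norm (?D n x) \<le> \<bar>q x\<bar> + \<bar>q (f x)\<bar>" by (cases "x \<in> A") auto
    qed
  qed
  then show "0 \<le> (\<integral>x. ?I x * q x \<partial>\<mu>)"
    by (rule LIMSEQ_le_const) (use pos in auto)
qed

text \<open>Apply \<open>maximal_ergodic\<close> to \<open>q - E - \<epsilon>\<close>. Over the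
  invariant set A where its maximal sums are unbounded, the integral equals
  \<open>- \<epsilon> * prob A\<close> and is nonnegative, so A is null. Elsewhere the maximal sums
  are bounded by some c.\<close>

lemma birkhoff_upper:
  assumes q: "integrable \<mu> q" "q \<in> borel_measurable borel"
    and E: "E \<in> borel_measurable (inv_alg f)" "integrable \<mu> E"
    and qE: "\<And>A. A \<in> sets (inv_alg f) \<Longrightarrow> (\<integral>x. indicator A x * q x \<partial>\<mu>) = (\<integral>x. indicator A x * E x \<partial>\<mu>)"
    and \<epsilon>: "\<epsilon> > 0"
  shows "AE x in \<mu>. \<exists>c::real. \<forall>k\<ge>1. birkhoff_sum f q k x \<le> real k * (E x + \<epsilon>) + c"
proof -
  let ?q = "\<lambda>x. q x - E x - \<epsilon>"
  have Eb: "E \<in> borel_measurable borel" by (rule inv_alg_measurable_borel[OF E(1)])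
  have q': "integrable \<mu> ?q" "?q \<in> borel_measurable borel" using q E Eb by auto
  define A where "A = {x. \<forall>c::nat. \<exists>n. real c < max_sum f ?q n x}"
  note A = maximal_ergodic[OF q', folded A_def]
  have Am: "A \<in> events" using A(1) by (simp add: sets_inv_alg sets_\<mu>)
  have int: "integrable \<mu> (\<lambda>x. indicator A x * u x)" if "integrable \<mu> u" for u :: "'a \<Rightarrow> real"
    using integrable_mult_indicator[OF Am that] by simp
  have "(\<integral>x. indicator A x * ?q x \<partial>\<mu>) = (\<integral>x. indicator A x * q x - indicator A x * E x - indicator A x * \<epsilon> \<partial>\<mu>)"
    by (simp add: algebra_simps)
  also have "\<dots> = (\<integral>x. indicator A x * q x \<partial>\<mu>) - (\<integral>x. indicator A x * E x \<partial>\<mu>) - (\<integral>x. indicator A x * \<epsilon> \<partial>\<mu>)"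
    by (simp only: Bochner_Integration.integral_diff int[OF q(1)] int[OF E(2)] int[OF integrable_const]
        Bochner_Integration.integrable_diff)
  also have "\<dots> = - \<epsilon> * prob A" using qE[OF A(1)] Am by (simp add: space_UNIV)
  finally have "\<epsilon> * prob A \<le> 0" using A(2) by simp
  then have "prob A = 0" using \<epsilon> by (simp add: mult_le_0_iff measure_le_0_iff)
  then have "AE x in \<mu>. x \<notin> A" using Am by (simp add: AE_iff_measurable[of A] emeasure_eq_measure space_UNIV)
  then show ?thesis
  proof (rule AE_mp, intro AE_I2 impI)
    fix x assume "x \<notin> A"
    then obtain c :: nat where c: "\<And>n. max_sum f ?q n x \<le> real c" by (auto simp: A_def not_less)
    have "birkhoff_sum f q k x \<le> real k * (E x + \<epsilon>) + real c" if "k \<ge> 1" for k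
    proof -
      have "birkhoff_sum f ?q k x \<le> real c"
        using birkhoff_sum_le_max_sum[of k k f ?q x] c[of k] that by simp
      moreover have "birkhoff_sum f ?q k x = birkhoff_sum f q k x - real k * (E x + \<epsilon>)"
        by (simp add: birkhoff_sum_def inv_alg_measurable_funpow[OF E(1)] sum_subtractf algebra_simps)
      ultimately show ?thesis by simp
    qed
    then show "\<exists>c::real. \<forall>k\<ge>1. birkhoff_sum f q k x \<le> real k * (E x + \<epsilon>) + c" by blast
  qed
qed

text \<open>E is any given version of the conditional expectation of q, so the limit can be
  prescribed: a constant for ergodic measures, \<open>measure (\<kappa> x) C\<close> for the kernel.
  The upper bound for q and for \<open>- q\<close> confines the averages from both sides.\<close>

theorem birkhoff_ergodic:
  assumes q: "integrable \<mu> q" "q \<in> borel_measurable borel"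
    and E: "E \<in> borel_measurable (inv_alg f)" "integrable \<mu> E"
    and qE: "\<And>A. A \<in> sets (inv_alg f) \<Longrightarrow> (\<integral>x. indicator A x * q x \<partial>\<mu>) = (\<integral>x. indicator A x * E x \<partial>\<mu>)"
  shows "AE x in \<mu>. (\<lambda>n. birkhoff_sum f q n x / real n) \<longlonglongrightarrow> E x"
proof -
  let ?\<epsilon> = "\<lambda>j. 1 / real (Suc j)"
  have 1: "AE x in \<mu>. \<forall>j. \<exists>c::real. \<forall>k\<ge>1. birkhoff_sum f q k x \<le> real k * (E x + ?\<epsilon> j) + c"
    unfolding AE_all_countable by (intro allI birkhoff_upper assms) auto
  have "AE x in \<mu>. \<forall>j. \<exists>c::real. \<forall>k\<ge>1. birkhoff_sum f (\<lambda>x. - q x) k x \<le> real k * (- E x + ?\<epsilon> j) + c"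
    unfolding AE_all_countable by (intro allI birkhoff_upper) (use assms in auto)
  with 1 show ?thesis
  proof eventually_elim
    case (elim x)
    have up: "\<forall>\<^sub>F n in sequentially. birkhoff_sum f q n x / real n < E x + r"
      if r: "r > 0" and *: "\<forall>j. \<exists>c::real. \<forall>k\<ge>1. birkhoff_sum f q k x \<le> real k * (E x + ?\<epsilon> j) + c" for q E and r :: real
    proof -
      obtain j where j: "inverse (real (Suc j)) < r / 2" using reals_Archimedean[of "r/2"] r by auto
      obtain c where c: "\<And>k. k \<ge> 1 \<Longrightarrow> birkhoff_sum f q k x \<le> real k * (E x + ?\<epsilon> j) + c" using * by blast
      have "\<forall>\<^sub>F n in sequentially. c / real n < r / 2"
        using lim_const_over_n[of c] r by (intro order_tendstoD) auto
      then show ?thesis using eventually_ge_at_top[of 1]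
      proof eventually_elim
        case (elim n)
        have "birkhoff_sum f q n x / real n \<le> (real n * (E x + ?\<epsilon> j) + c) / real n"
          using c[of n] elim by (intro divide_right_mono) auto
        also have "\<dots> = E x + ?\<epsilon> j + c / real n" using elim by (simp add: add_divide_distrib)
        finally have "birkhoff_sum f q n x / real n \<le> E x + inverse (real (Suc j)) + c / real n"
          by (simp add: inverse_eq_divide)
        with j elim(1) show ?case by linarith
      qed
    qed
    show ?case
    proof (rule LIMSEQ_I)
      fix r :: real assume r: "r > 0"
      have "\<forall>\<^sub>F n in sequentially. birkhoff_sum f (\<lambda>x. - q x) n x / real n < - E x + r"
        by (rule up[OF r, of "\<lambda>x. - q x" "\<lambda>x. - E x"]) (use elim in auto)
      moreover have "birkhoff_sum f (\<lambda>x. - q x) n x = - birkhoff_sum f q n x" for n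
        by (simp add: birkhoff_sum_def sum_negf)
      ultimately have "\<forall>\<^sub>F n in sequentially. - birkhoff_sum f q n x / real n < - E x + r" by simp
      moreover have "\<forall>\<^sub>F n in sequentially. birkhoff_sum f q n x / real n < E x + r"
        by (rule up[of r q E, OF r elim(1)])
      ultimately have "\<forall>\<^sub>F n in sequentially. norm (birkhoff_sum f q n x / real n - E x) < r"
        by eventually_elim (simp add: abs_less_iff)
      then show "\<exists>no. \<forall>n\<ge>no. norm (birkhoff_sum f q n x / real n - E x) < r"
        by (simp add: eventually_sequentially)
    qed
  qed
qed

text \<open>The averages restricted to an invariant A integrate to
  \<open>prob (A \<inter> B)\<close> for every \<open>n \<ge> 1\<close>. A constant limit therefore
  makes B independent of every invariant set; \<open>A = UNIV\<close> identifies c as the measure of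
  B.\<close>

lemma birkhoff_indicator_limit:
  assumes B: "B \<in> sets borel" and A: "A \<in> sets (inv_alg f)"
    and lim: "AE x in \<mu>. (\<lambda>n. birkhoff_sum f (indicator B) n x / real n) \<longlonglongrightarrow> (c::real)"
  shows "prob (A \<inter> B) = prob A * c"
proof -
  let ?I = "indicator A :: 'a \<Rightarrow> real" and ?q = "indicator B :: 'a \<Rightarrow> real"
  have Ab: "A \<in> sets borel" and fA: "f -` A = A" using A by (auto simp: sets_inv_alg)
  have m: "A \<in> events" "B \<in> events" using Ab B by (auto simp: sets_\<mu>)
  have fnA: "(f ^^ i) x \<in> A \<longleftrightarrow> x \<in> A" for i x
  proof (induction i)
    case (Suc i)
    have "f ((f ^^ i) x) \<in> A \<longleftrightarrow> (f ^^ i) x \<in> A" using fA by blast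
    then show ?case using Suc by simp
  qed simp
  have qm: "?q \<in> borel_measurable borel" using B by simp
  have Sm: "birkhoff_sum f ?q n \<in> borel_measurable \<mu>" for n
    using birkhoff_sum_meas[OF qm] by (simp add: meas_cong)
  have Sb: "0 \<le> birkhoff_sum f ?q n x" "birkhoff_sum f ?q n x \<le> real n" for n and x
  proof -
    show "0 \<le> birkhoff_sum f ?q n x" unfolding birkhoff_sum_def by (intro sum_nonneg) auto
    have "birkhoff_sum f ?q n x \<le> (\<Sum>i<n. 1)" unfolding birkhoff_sum_def by (intro sum_mono) (auto simp: indicator_def)
    then show "birkhoff_sum f ?q n x \<le> real n" by simp
  qed
  have eq: "(\<integral>x. ?I x * (birkhoff_sum f ?q n x / real n) \<partial>\<mu>) = prob (A \<inter> B)" if n: "n \<ge> 1" for n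
  proof -
    let ?AB = "indicator (A \<inter> B) :: 'a \<Rightarrow> real"
    have AB: "?AB \<in> borel_measurable borel" using Ab B by simp
    have "?I x * birkhoff_sum f ?q n x = birkhoff_sum f ?AB n x" for x
      by (simp add: birkhoff_sum_def sum_distrib_left indicator_inter_arith) (simp add: indicator_def fnA)
    then have "(\<integral>x. ?I x * (birkhoff_sum f ?q n x / real n) \<partial>\<mu>) = (\<integral>x. birkhoff_sum f ?AB n x / real n \<partial>\<mu>)"
      by simp
    also have "\<dots> = integral\<^sup>L \<mu> (birkhoff_sum f ?AB n) / real n" by simp
    also have "\<dots> = integral\<^sup>L \<mu> ?AB"
      using n integral_birkhoff_sum(2)[OF AB, of 1 n] by (simp add: indicator_def)
    also have "\<dots> = prob (A \<inter> B)" using m by (simp add: space_UNIV)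
    finally show ?thesis .
  qed
  have "(\<lambda>n. \<integral>x. ?I x * (birkhoff_sum f ?q n x / real n) \<partial>\<mu>) \<longlonglongrightarrow> (\<integral>x. ?I x * c \<partial>\<mu>)"
  proof (rule integral_dominated_convergence[where w = "\<lambda>_. 1"])
    show "AE x in \<mu>. (\<lambda>n. ?I x * (birkhoff_sum f ?q n x / real n)) \<longlonglongrightarrow> ?I x * c"
      using lim by eventually_elim (rule tendsto_mult_left)
    show "AE x in \<mu>. norm (?I x * (birkhoff_sum f ?q n x / real n)) \<le> 1" for n
    proof (rule AE_I2)
      fix x
      have "birkhoff_sum f ?q n x / real n \<le> 1" "0 \<le> birkhoff_sum f ?q n x / real n"
        using Sb[of n x] by (auto simp: divide_le_eq_1)
      then show "norm (?I x * (birkhoff_sum f ?q n x / real n)) \<le> 1" by (auto simp: indicator_def)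
    qed
  qed (use m Sm in auto)
  moreover have "(\<lambda>n. \<integral>x. ?I x * (birkhoff_sum f ?q n x / real n) \<partial>\<mu>) \<longlonglongrightarrow> prob (A \<inter> B)"
    by (rule tendsto_eventually) (use eq in \<open>auto simp: eventually_sequentially\<close>)
  ultimately have "prob (A \<inter> B) = (\<integral>x. ?I x * c \<partial>\<mu>)" by (rule LIMSEQ_unique[rotated])
  then show ?thesis using m by (simp add: space_UNIV)
qed

lemma ergodic_birkhoff:
  assumes erg: "ergodic f \<mu>" and B: "B \<in> sets borel"
  shows "AE x in \<mu>. (\<lambda>n. birkhoff_sum f (indicator B) n x / real n) \<longlonglongrightarrow> prob B"
proof (rule birkhoff_ergodic[where E = "\<lambda>_. prob B"])
  have m: "B \<in> events" using B by (simp add: sets_\<mu>)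
  then show "integrable \<mu> (indicator B :: 'a \<Rightarrow> real)" by (simp add: integrable_indicator_iff emeasure_eq_measure)
  fix A assume "A \<in> sets (inv_alg f)"
  then have A: "A \<in> events" "prob A = 0 \<or> prob A = 1"
    using erg by (auto simp: ergodic_def sets_inv_alg sets_\<mu>)
  have "prob (A \<inter> B) = prob A * prob B"
  proof (cases "prob A = 0")
    case True
    have "prob (A \<inter> B) \<le> prob A" using A m by (intro finite_measure_mono) auto
    then show ?thesis using True by (simp add: measure_le_0_iff)
  next
    case False
    then have "prob A = 1" using A by simp
    then show ?thesis using prob_eq_1 measure_space_inter A m
      by (metis Int_commute mult_1 space_UNIV prob_space sets.top)
  qed
  then show "(\<integral>x. indicator A x * indicator B x \<partial>\<mu>) = (\<integral>x. indicator A x * prob B \<partial>\<mu>)"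
    using A m by (simp add: space_UNIV flip: indicator_inter_arith)
qed (use B in auto)

end

text \<open>The visit frequencies of B equal \<open>measure \<mu> B\<close> off a \<mu>-null set,
  which is also \<nu>-null, and integrating the same frequencies against \<nu> gives
  \<open>measure \<nu> B\<close>. This is why an ergodic measure cannot be a proper mixture.\<close>

lemma ergodic_absolutely_continuous_eq:
  assumes "inv_sys f \<mu>" "inv_sys f \<nu>" "ergodic f \<mu>"
    and ac: "\<And>N. N \<in> sets borel \<Longrightarrow> measure \<mu> N = 0 \<Longrightarrow> measure \<nu> N = 0"
  shows "\<nu> = \<mu>"
proof (rule measure_eqI)
  interpret \<mu>: inv_sys f \<mu> by fact
  interpret \<nu>: inv_sys f \<nu> by fact
  show "sets \<nu> = sets \<mu>" by (simp add: \<mu>.sets_\<mu> \<nu>.sets_\<mu>)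
  fix B assume "B \<in> sets \<nu>"
  then have B: "B \<in> sets borel" by (simp add: \<nu>.sets_\<mu>)
  have "AE x in \<mu>. (\<lambda>n. birkhoff_sum f (indicator B) n x / real n) \<longlonglongrightarrow> measure \<mu> B"
    by (rule \<mu>.ergodic_birkhoff[OF assms(3) B])
  then obtain N where N: "N \<in> null_sets \<mu>" "{x. \<not> (\<lambda>n. birkhoff_sum f (indicator B) n x / real n) \<longlonglongrightarrow> measure \<mu> B} \<subseteq> N"
    by (auto simp: eventually_ae_filter \<mu>.space_UNIV)
  have "N \<in> null_sets \<nu>"
    using N(1) ac[of N] by (simp add: null_sets_def \<mu>.sets_\<mu> \<nu>.sets_\<mu> \<mu>.emeasure_eq_measure \<nu>.emeasure_eq_measure)
  then have "AE x in \<nu>. (\<lambda>n. birkhoff_sum f (indicator B) n x / real n) \<longlonglongrightarrow> measure \<mu> B"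
    using N(2) by (intro AE_I') auto
  from \<nu>.birkhoff_indicator_limit[OF B _ this, of UNIV]
  have "measure \<nu> B = measure \<mu> B" using \<nu>.prob_space by (simp add: sets_inv_alg \<nu>.space_UNIV)
  then show "emeasure \<nu> B = emeasure \<mu> B" by (simp add: \<mu>.emeasure_eq_measure \<nu>.emeasure_eq_measure)
qed

subsection \<open>Coding by real numbers\<close>

text \<open>With digits \<open>0\<close> and \<open>1\<close> in base \<open>3\<close> the tails are at most \<open>1/2\<close>, so the digits can be read off.\<close>

definition ternary :: "(nat \<Rightarrow> bool) \<Rightarrow> real" where
  "ternary b = (\<Sum>k. of_bool (b k) * (1/3) ^ Suc k)"

text \<open>Codes with first digit 0 lie in \<open>[0, 1/6]\<close>, those with first digit 1 in
  \<open>[1/3, 1/2]\<close>. The threshold 1/3 recovers the digit, and subtracting it after tripling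
  leaves the code of the remaining digits.\<close>

definition ternary_shift :: "real \<Rightarrow> real" where
  "ternary_shift t = 3 * t - of_bool (1/3 \<le> t)"

definition ternary_digit :: "nat \<Rightarrow> real \<Rightarrow> bool" where
  "ternary_digit k t \<longleftrightarrow> 1/3 \<le> (ternary_shift ^^ k) t"

lemma summable_ternary: "summable (\<lambda>k. of_bool (b k) * (1/3::real) ^ Suc k)"
  by (rule summable_comparison_test'[where g = "\<lambda>k. (1/3::real) ^ Suc k" and N = 0])
    (auto intro!: summable_mult summable_geometric simp: of_bool_def)

lemma ternary_bounds: "0 \<le> ternary b" "ternary b \<le> 1/2"
proof -
  show "0 \<le> ternary b" unfolding ternary_def by (intro suminf_nonneg summable_ternary) auto
  have "ternary b \<le> (\<Sum>k. (1/3::real) * (1/3) ^ k)"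
    unfolding ternary_def
    by (intro suminf_le summable_ternary summable_mult summable_geometric) (auto simp: of_bool_def)
  also have "\<dots> = 1/3 * (\<Sum>k. (1/3) ^ k)" by (rule suminf_mult) (simp add: summable_geometric)
  also have "\<dots> = 1/2" by (simp add: suminf_geometric)
  finally show "ternary b \<le> 1/2" .
qed

lemma ternary_unfold: "3 * ternary b = of_bool (b 0) + ternary (\<lambda>k. b (Suc k))"
proof -
  have "ternary b = of_bool (b 0) * (1/3) ^ Suc 0 + (\<Sum>k. of_bool (b (Suc k)) * (1/3::real) ^ Suc (Suc k))"
    unfolding ternary_def using suminf_split_head[OF summable_ternary[of b]] by simp
  also have "(\<Sum>k. of_bool (b (Suc k)) * (1/3::real) ^ Suc (Suc k)) = (\<Sum>k. (1/3) * (of_bool (b (Suc k)) * (1/3::real) ^ Suc k))"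
    by (simp add: mult_ac)
  also have "\<dots> = (1/3) * ternary (\<lambda>k. b (Suc k))"
    unfolding ternary_def by (rule suminf_mult[OF summable_ternary])
  finally show ?thesis by simp
qed

lemma ternary_first: "1/3 \<le> ternary b \<longleftrightarrow> b 0"
proof (cases "b 0")
  case True
  then have "3 * ternary b = 1 + ternary (\<lambda>k. b (Suc k))" using ternary_unfold[of b] by simp
  then have "1/3 \<le> ternary b" using ternary_bounds(1)[of "\<lambda>k. b (Suc k)"] by linarith
  then show ?thesis using True by blast
next
  case False
  then have "3 * ternary b = ternary (\<lambda>k. b (Suc k))" using ternary_unfold[of b] by simp
  then have "\<not> 1/3 \<le> ternary b" using ternary_bounds(2)[of "\<lambda>k. b (Suc k)"] by linarith
  then show ?thesis using False by blast
qed

lemma ternary_digit: "ternary_digit k (ternary b) \<longleftrightarrow> b k"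
proof (induction k arbitrary: b)
  case 0
  show ?case unfolding ternary_digit_def funpow_0 by (rule ternary_first)
next
  case (Suc k)
  have "ternary_shift (ternary b) = ternary (\<lambda>k. b (Suc k))"
    using ternary_unfold[of b] unfolding ternary_shift_def ternary_first by simp
  then have "ternary_digit (Suc k) (ternary b) = ternary_digit k (ternary (\<lambda>k. b (Suc k)))"
    by (simp add: ternary_digit_def funpow_swap1)
  then show ?case using Suc by simp
qed

lemma ternary_digit_measurable: "Measurable.pred borel (ternary_digit k)"
proof -
  have [measurable]: "ternary_shift \<in> borel \<rightarrow>\<^sub>M borel" unfolding ternary_shift_def[abs_def] by measurable
  have [measurable]: "ternary_shift ^^ k \<in> borel \<rightarrow>\<^sub>M borel" by (rule measurable_funpow) measurable
  show ?thesis unfolding ternary_digit_def[abs_def] by measurable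
qed

lemma compact_dense_sequence:
  assumes "compact (UNIV :: 'a::metric_space set)"
  shows "\<exists>s :: nat \<Rightarrow> 'a. \<forall>x e. 0 < e \<longrightarrow> (\<exists>i. dist x (s i) < e)"
proof -
  have "\<forall>n. \<exists>k. finite k \<and> (UNIV :: 'a set) \<subseteq> (\<Union>x\<in>k. ball x (inverse (real (Suc n))))"
    using assms unfolding compact_eq_totally_bounded by simp
  from choice[OF this] obtain K where K: "\<And>n. finite (K n)" "\<And>n. (UNIV :: 'a set) \<subseteq> (\<Union>x\<in>K n. ball x (inverse (real (Suc n))))"
    by blast
  let ?D = "\<Union>n. K n"
  have c: "countable ?D" using K(1) by (auto intro: countable_finite)
  have near: "\<exists>y\<in>?D. dist x y < e" if "0 < e" for x e
  proof -
    obtain n where n: "inverse (real (Suc n)) < e" using reals_Archimedean[OF \<open>0 < e\<close>] by blast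
    obtain y where "y \<in> K n" "dist y x < inverse (real (Suc n))" using K(2)[of n] by (auto simp: subset_iff)
    then show ?thesis using n by (intro bexI[of _ y]) (auto simp: dist_commute)
  qed
  then have ne: "?D \<noteq> {}" by (metis empty_iff zero_less_one)
  have "\<exists>i. dist x (from_nat_into ?D i) < e" if "0 < e" for x e
    using near[OF that, of x] from_nat_into_surj[OF c] by metis
  then show ?thesis by blast
qed

text \<open>
  Because of the Borel left inverse \<open>\<pi>\<close>, measures can be moved to the real line and back without
  knowing that the range of \<open>\<theta>\<close> is a Borel set.
\<close>

lemma exists_real_coding:
  assumes comp: "compact (UNIV :: 'a::metric_space set)"
  shows "\<exists>(\<theta> :: 'a \<Rightarrow> real) (\<pi> :: real \<Rightarrow> 'a). \<theta> \<in> borel \<rightarrow>\<^sub>M borel \<and> \<pi> \<in> borel \<rightarrow>\<^sub>M borel \<and>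
    (\<forall>x. \<pi> (\<theta> x) = x) \<and> (\<forall>x. 0 \<le> \<theta> x \<and> \<theta> x \<le> 1/2)"
proof -
  obtain s :: "nat \<Rightarrow> 'a" where s: "\<And>x e. 0 < e \<Longrightarrow> \<exists>i. dist x (s i) < e"
    using compact_dense_sequence[OF comp] by blast
  \<comment> \<open>The digits of a point record which balls of radius
    \<open>inverse (Suc n)\<close> around the centres \<open>s i\<close> contain it. Since the
    centres are dense, the digits determine the point.\<close>
  define b where "b x k = (case prod_decode k of (n, i) \<Rightarrow> dist x (s i) < inverse (real (Suc n)))" for x k
  define \<theta> where "\<theta> x = ternary (b x)" for x
  have [measurable]: "Measurable.pred borel (\<lambda>x. b x k)" for k
  proof (cases "prod_decode k")
    case (Pair n i)
    have "open {x. dist x (s i) < inverse (real (Suc n))}"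
      by (intro open_Collect_less continuous_intros)
    then show ?thesis unfolding b_def Pair pred_def by simp
  qed
  have \<theta>m: "\<theta> \<in> borel \<rightarrow>\<^sub>M borel"
    unfolding \<theta>_def[abs_def] ternary_def by measurable
  \<comment> \<open>The first centre whose n-th ball contains the coded point. These centres
    converge to the point, so decoding is a limit of measurable functions with countably many
    values.\<close>
  define idx where "idx n t = (LEAST i. ternary_digit (prod_encode (n, i)) t)" for n t
  have [measurable]: "idx n \<in> borel \<rightarrow>\<^sub>M count_space UNIV" for n
    unfolding idx_def[abs_def] by (intro measurable_Least ternary_digit_measurable)
  define p where "p n t = s (idx n t)" for n t
  have pm: "p n \<in> borel \<rightarrow>\<^sub>M borel" for n
    unfolding p_def[abs_def] by (rule measurable_compose[of "idx n" borel "count_space UNIV"]) auto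
  let ?C = "\<lambda>t. Cauchy (\<lambda>n. p n t)"
  have Cm: "Measurable.pred borel ?C"
  proof -
    \<comment> \<open>The distance depends on two indices only, hence on a countable discrete
      variable, which settles measurability.\<close>
    have "Measurable.pred borel (\<lambda>t. dist (s (idx m t)) (s (idx n t)) < inverse (real (Suc j)))" for m n j
    proof -
      have "(\<lambda>t. (idx m t, idx n t)) \<in> borel \<rightarrow>\<^sub>M count_space UNIV" by measurable
      from measurable_compose[OF this, of "\<lambda>(i, k). dist (s i) (s k) < inverse (real (Suc j))" "count_space UNIV"]
      show ?thesis by simp
    qed
    then have "Measurable.pred borel (\<lambda>t. \<forall>j. \<exists>M. \<forall>m\<ge>M. \<forall>n\<ge>M. dist (p m t) (p n t) < inverse (real (Suc j)))"
      unfolding p_def by measurable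
    then show ?thesis unfolding metric_Cauchy_iff2 .
  qed
  \<comment> \<open>A number that is no code may give a divergent sequence. The default
    \<open>s 0\<close> makes \<pi> total and keeps it measurable.\<close>
  define \<pi> where "\<pi> t = (if ?C t then lim (\<lambda>n. p n t) else s 0)" for t
  have \<pi>m: "\<pi> \<in> borel \<rightarrow>\<^sub>M borel"
  proof (rule borel_measurable_LIMSEQ_metric)
    show "(\<lambda>t. if ?C t then p n t else s 0) \<in> borel \<rightarrow>\<^sub>M borel" for n
      using pm Cm by measurable
    fix t
    show "(\<lambda>n. if ?C t then p n t else s 0) \<longlonglongrightarrow> \<pi> t"
    proof (cases "?C t")
      case True
      then obtain l where "(\<lambda>n. p n t) \<longlonglongrightarrow> l"
        using compact_imp_complete[OF comp] unfolding complete_def by blast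
      then show ?thesis using True by (simp add: \<pi>_def convergent_LIMSEQ_iff[symmetric] convergentI)
    qed (simp add: \<pi>_def)
  qed
  have "\<pi> (\<theta> x) = x" for x
  proof -
    have d: "dist x (p n (\<theta> x)) < inverse (real (Suc n))" for n
    proof -
      have D: "ternary_digit (prod_encode (n, i)) (\<theta> x) \<longleftrightarrow> dist x (s i) < inverse (real (Suc n))" for i
        by (simp add: \<theta>_def ternary_digit b_def)
      obtain i where "dist x (s i) < inverse (real (Suc n))" using s[of "inverse (real (Suc n))" x] by auto
      then show ?thesis unfolding p_def idx_def D by (rule LeastI)
    qed
    have "(\<lambda>n. p n (\<theta> x)) \<longlonglongrightarrow> x"
    proof (rule metric_LIMSEQ_I)
      fix r :: real assume "r > 0"
      then obtain N where N: "inverse (real (Suc N)) < r" using reals_Archimedean by blast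
      show "\<exists>no. \<forall>n\<ge>no. dist (p n (\<theta> x)) x < r"
      proof (intro exI allI impI)
        fix n assume "n \<ge> N"
        then have "inverse (real (Suc n)) \<le> inverse (real (Suc N))" by (intro le_imp_inverse_le) auto
        with d[of n] N have "dist x (p n (\<theta> x)) < r" by linarith
        then show "dist (p n (\<theta> x)) x < r" by (simp add: dist_commute)
      qed
    qed
    then show ?thesis by (simp add: \<pi>_def LIMSEQ_imp_Cauchy limI)
  qed
  then show ?thesis using \<theta>m \<pi>m ternary_bounds by (auto simp: \<theta>_def intro!: exI[of _ \<theta>] exI[of _ \<pi>])
qed

text \<open>Right continuity extends equality of the distribution functions from the rationals to
  the reals, and \<pi> recovers a measure from its image under \<theta>. As countably many equations
  decide equality, almost-sure statements can be collected into one null set.\<close>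

lemma measure_eqI_coded:
  fixes M N :: "'a::metric_space measure" and \<theta> :: "'a \<Rightarrow> real"
  assumes M: "prob_space M" "sets M = sets borel" and N: "prob_space N" "sets N = sets borel"
    and \<theta>: "\<theta> \<in> borel \<rightarrow>\<^sub>M borel" and \<pi>: "\<pi> \<in> borel \<rightarrow>\<^sub>M borel" and \<pi>\<theta>: "\<And>x. \<pi> (\<theta> x) = x"
    and eq: "\<And>q::rat. measure M {x. \<theta> x \<le> of_rat q} = measure N {x. \<theta> x \<le> of_rat q}"
  shows "M = N"
proof -
  have sp: "space M = UNIV" "space N = UNIV" using M(2) N(2) sets_eq_imp_space_eq[of _ borel] by auto
  have \<theta>M: "\<theta> \<in> M \<rightarrow>\<^sub>M borel" and \<theta>N: "\<theta> \<in> N \<rightarrow>\<^sub>M borel"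
    using \<theta> by (simp_all add: measurable_cong_sets[OF M(2) refl] measurable_cong_sets[OF N(2) refl])
  let ?M = "distr M borel \<theta>" and ?N = "distr N borel \<theta>"
  have rM: "real_distribution ?M" and rN: "real_distribution ?N"
    using prob_space.prob_space_distr[OF M(1) \<theta>M] prob_space.prob_space_distr[OF N(1) \<theta>N]
    by (auto simp: real_distribution_def real_distribution_axioms_def)
  have cM: "cdf ?M t = measure M {x. \<theta> x \<le> t}" and cN: "cdf ?N t = measure N {x. \<theta> x \<le> t}" for t
    using \<theta>M \<theta>N by (auto simp: cdf_def measure_distr sp vimage_def)
  have "cdf ?M t = cdf ?N t" for t
  proof (rule antisym)
    have le: "cdf A t \<le> cdf B t" if A: "real_distribution A" and B: "real_distribution B"
      and AB: "\<And>q::rat. cdf A (of_rat q) = cdf B (of_rat q)" for A B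
    proof (rule ccontr)
      interpret A: real_distribution A by fact
      interpret B: real_distribution B by fact
      assume "\<not> ?thesis"
      then have lt: "cdf B t < cdf A t" by simp
      have "(cdf B \<longlongrightarrow> cdf B t) (at_right t)"
        using B.cdf_is_right_cont[of t] by (simp add: continuous_within)
      then have "\<forall>\<^sub>F y in at_right t. cdf B y < cdf A t" using lt by (rule order_tendstoD)
      then obtain y where y: "y > t" "\<And>z. t < z \<Longrightarrow> z < y \<Longrightarrow> cdf B z < cdf A t"
        by (auto simp: eventually_at_right_field)
      obtain q :: rat where q: "t < of_rat q" "of_rat q < y" using of_rat_dense[OF y(1)] by blast
      have "cdf A t \<le> cdf A (of_rat q)" using q by (intro A.cdf_nondecreasing) auto
      then show False using y(2)[OF q] AB[of q] by simp
    qed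
    show "cdf ?M t \<le> cdf ?N t" by (rule le[OF rM rN], simp add: cM cN eq)
    show "cdf ?N t \<le> cdf ?M t" by (rule le[OF rN rM], simp add: cM cN eq)
  qed
  then have MN: "?M = ?N" by (intro cdf_unique rM rN) auto
  have recover: "distr (distr A borel \<theta>) borel \<pi> = A" if "sets A = sets borel" for A :: "'a measure"
  proof -
    have "\<theta> \<in> A \<rightarrow>\<^sub>M borel" using \<theta> by (simp add: measurable_cong_sets[OF that refl])
    then have "distr (distr A borel \<theta>) borel \<pi> = distr A borel (\<pi> \<circ> \<theta>)" by (rule distr_distr[OF \<pi>])
    also have "\<dots> = distr A A (\<lambda>x. x)" by (rule distr_cong) (auto simp: \<pi>\<theta> that)
    finally show ?thesis by simp
  qed
  have "M = distr ?M borel \<pi>" by (rule recover[OF M(2), symmetric])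
  also have "\<dots> = distr ?N borel \<pi>" by (simp only: MN)
  also have "\<dots> = N" by (rule recover[OF N(2)])
  finally show ?thesis .
qed

text \<open>Values on the rationals need not be right continuous. The infimum over the rationals
  strictly to the right repairs this, at the price that F may differ from H at rational
  points.\<close>

lemma inf_rational_cdf:
  fixes H :: "rat \<Rightarrow> real"
  assumes mono: "\<And>p q. p \<le> q \<Longrightarrow> H p \<le> H q" and 0: "\<And>q. q < 0 \<Longrightarrow> H q = 0" and 1: "\<And>q. q \<ge> 1 \<Longrightarrow> H q = 1"
  defines "F \<equiv> \<lambda>t::real. INF q\<in>{q. t < of_rat q}. H q"
  shows "real_distribution (interval_measure F)" "measure (interval_measure F) {..t} = F t"
    and "\<And>q. t < of_rat q \<Longrightarrow> F t \<le> H q" "\<And>y. F t < y \<Longrightarrow> \<exists>q. t < of_rat q \<and> H q < y"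
proof -
  have H0: "0 \<le> H q" for q using mono[of "-1" q] mono[of q "-1"] 0 by (cases "q < 0") auto
  have bdd: "bdd_below (H ` {q. t < of_rat q})" for t :: real by (intro bdd_belowI[of _ 0]) (auto simp: H0)
  have ne: "{q. t < of_rat q} \<noteq> {}" for t :: real using of_rat_dense[of t "t + 1"] by auto
  have low: "F t \<le> H q" if "t < of_rat q" for t q
    unfolding F_def using that by (intro cINF_lower bdd) auto
  have ex: "\<exists>q. t < of_rat q \<and> H q < y" if "F t < y" for t y
    using that cINF_less_iff[OF ne bdd] unfolding F_def by auto
  show "\<And>q. t < of_rat q \<Longrightarrow> F t \<le> H q" "\<And>y. F t < y \<Longrightarrow> \<exists>q. t < of_rat q \<and> H q < y"
    using low ex by auto
  have nondec: "F s \<le> F t" if "s \<le> t" for s t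
    unfolding F_def by (rule cINF_superset_mono[OF ne bdd]) (use that in auto)
  have F0: "F t = 0" if "t < 0" for t
  proof (rule antisym)
    obtain q :: rat where "t < of_rat q" "of_rat q < (0::real)" using of_rat_dense[of t 0] \<open>t < 0\<close> by auto
    then show "F t \<le> 0" using low[of t q] 0[of q] by simp
    show "0 \<le> F t" unfolding F_def by (intro cINF_greatest ne) (auto simp: H0)
  qed
  have F1: "F t = 1" if "t \<ge> 1" for t
  proof (rule antisym)
    have *: "H q = 1" if "t < of_rat q" for q
    proof -
      have "(1::real) < of_rat q" using that \<open>t \<ge> 1\<close> by linarith
      then show ?thesis using 1[of q] by simp
    qed
    obtain q where "t < of_rat q" using ne by blast
    then show "F t \<le> 1" using low[of t q] *[of q] by simp
    show "1 \<le> F t" unfolding F_def by (intro cINF_greatest ne) (auto simp: *)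
  qed
  have rc: "continuous (at_right a) F" for a
    unfolding continuous_within
  proof (rule order_tendstoI)
    fix c assume "c < F a"
    then have "\<And>x. a < x \<Longrightarrow> c < F x" using nondec by (meson less_imp_le order_less_le_trans)
    then show "\<forall>\<^sub>F x in at_right a. c < F x" by (auto simp: eventually_at_right_field intro!: exI[of _ "a + 1"])
  next
    fix c assume "F a < c"
    from ex[OF this] obtain q where q: "a < of_rat q" "H q < c" by blast
    have "F x < c" if "a < x" "x < of_rat q" for x using low[OF that(2)] q by simp
    then show "\<forall>\<^sub>F x in at_right a. F x < c" using q by (auto simp: eventually_at_right_field)
  qed
  have l0: "(F \<longlongrightarrow> 0) at_bot"
    by (rule tendsto_eventually) (use F0 in \<open>auto simp: eventually_at_bot_dense\<close>)
  have l1: "(F \<longlongrightarrow> 1) at_top"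
    by (rule tendsto_eventually) (use F1 in \<open>auto simp: eventually_at_top_linorder\<close>)
  show "real_distribution (interval_measure F)"
    by (rule real_distribution_interval_measure[OF nondec rc l0 l1])
  have "cdf (interval_measure F) = F" by (rule cdf_interval_measure[OF nondec rc l0])
  then show "measure (interval_measure F) {..t} = F t" by (simp add: cdf_def fun_eq_iff)
qed

subsection \<open>Conditional measures\<close>

lemma real_distributionD:
  assumes "real_distribution N"
  shows "prob_space N" "sets N = sets borel" "space N = UNIV"
  using assms by (simp_all add: real_distribution_def real_distribution_axioms_def)
    (auto dest: sets_eq_imp_space_eq)

text \<open>Conditional probabilities are determined only up to null sets. Those of
  \<open>\<theta> \<le> q\<close> for rational q are countably many, so off one null set they are
  monotone in q, equal to 0 below 0 and equal to 1 from 1 on. There \<open>inf_rational_cdf\<close>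
  turns them into distributions.\<close>

lemma exists_conditional_cdf:
  fixes \<theta> :: "'a \<Rightarrow> real"
  assumes "prob_space \<mu>" and "subalgebra \<mu> F" and \<theta>[measurable]: "\<theta> \<in> borel_measurable \<mu>"
    and \<theta>01: "\<And>x. 0 \<le> \<theta> x" "\<And>x. \<theta> x \<le> 1"
  shows "\<exists>\<nu> :: 'a \<Rightarrow> real measure. (\<forall>x. real_distribution (\<nu> x)) \<and>
    (\<forall>t. (\<lambda>x. measure (\<nu> x) {..t}) \<in> borel_measurable F \<and>
      (\<forall>A\<in>sets F. (\<integral>x. indicator A x * measure (\<nu> x) {..t} \<partial>\<mu>) = measure \<mu> (A \<inter> {x\<in>space \<mu>. \<theta> x \<le> t})))"
proof -
  interpret prob_space \<mu> by fact
  interpret finite_measure_subalgebra \<mu> F by unfold_locales fact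
  let ?L = "\<lambda>q::rat. {x\<in>space \<mu>. \<theta> x \<le> of_rat q}"
  let ?l = "\<lambda>q. indicator (?L q) :: 'a \<Rightarrow> real"
  have Lm[measurable]: "?L q \<in> sets \<mu>" for q by measurable
  have lint: "integrable \<mu> (?l q)" for q by (simp add: integrable_indicator_iff emeasure_eq_measure)
  have FM: "A \<in> sets F \<Longrightarrow> A \<in> sets \<mu>" for A using subalg by (auto simp: subalgebra_def)
  have spF: "space F = space \<mu>" using subalg by (auto simp: subalgebra_def)
  define G where "G q = real_cond_exp \<mu> F (?l q)" for q
  have Gm[measurable]: "G q \<in> borel_measurable F" for q unfolding G_def by (rule borel_measurable_cond_exp)
  have Gint: "integrable \<mu> (G q)" for q unfolding G_def by (rule real_cond_exp_int(1)[OF lint])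
  have GA: "(\<integral>x. indicator A x * G q x \<partial>\<mu>) = prob (A \<inter> ?L q)" if "A \<in> sets F" for A q
  proof -
    have "(\<integral>x. indicator A x * G q x \<partial>\<mu>) = (\<integral>x. indicator A x * ?l q x \<partial>\<mu>)"
      using real_cond_exp_intA[OF lint that, of q] by (simp add: G_def set_lebesgue_integral_def)
    also have "\<dots> = (\<integral>x. indicator (A \<inter> ?L q) x \<partial>\<mu>)" by (simp add: indicator_inter_arith)
    also have "\<dots> = prob (A \<inter> ?L q)" using FM[OF that] by simp
    finally show ?thesis .
  qed
  define \<Omega> where "\<Omega> x \<longleftrightarrow> (\<forall>p q. p \<le> q \<longrightarrow> G p x \<le> G q x) \<and> (\<forall>q. q < 0 \<longrightarrow> G q x = 0) \<and> (\<forall>q. 1 \<le> q \<longrightarrow> G q x = 1)" for x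
  have \<Omega>m[measurable]: "Measurable.pred F \<Omega>" unfolding \<Omega>_def by measurable
  have \<Omega>AE: "AE x in \<mu>. \<Omega> x"
  proof -
    have "AE x in \<mu>. G p x \<le> G q x" if "p \<le> q" for p q
    proof -
      have "of_rat p \<le> (of_rat q :: real)" using that by (simp add: of_rat_less_eq)
      then show ?thesis unfolding G_def
        by (intro real_cond_exp_mono lint AE_I2) (auto simp: indicator_def)
    qed
    then have 1: "AE x in \<mu>. \<forall>p q. p \<le> q \<longrightarrow> G p x \<le> G q x" by (auto simp: AE_all_countable)
    have "AE x in \<mu>. G q x = 0" if "q < 0" for q
    proof -
      have "of_rat q < (0::real)" using that by simp
      then have "\<not> \<theta> x \<le> of_rat q" for x using \<theta>01(1)[of x] by linarith
      then have e: "?L q = {}" by simp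
      have "AE x in \<mu>. real_cond_exp \<mu> F (indicator {}) x = (indicator {} x :: real)"
        using lint[of q] unfolding e by (rule real_cond_exp_F_meas) simp
      then show ?thesis unfolding G_def e by simp
    qed
    then have 2: "AE x in \<mu>. \<forall>q. q < 0 \<longrightarrow> G q x = 0" by (auto simp: AE_all_countable)
    have "AE x in \<mu>. G q x = 1" if "1 \<le> q" for q
    proof -
      have "(1::real) \<le> of_rat q" using that by simp
      then have "\<theta> x \<le> of_rat q" for x using \<theta>01(2)[of x] by linarith
      then have e: "?L q = space \<mu>" by simp
      have i: "integrable \<mu> (indicator (space \<mu>) :: 'a \<Rightarrow> real)" using lint[of q] unfolding e .
      have m: "(indicator (space \<mu>) :: 'a \<Rightarrow> real) \<in> borel_measurable F"
        using sets.top[of F] by (intro borel_measurable_indicator) (simp add: spF)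
      show ?thesis unfolding G_def e using real_cond_exp_F_meas[OF i m] by (rule AE_mp) (auto intro!: AE_I2)
    qed
    then have 3: "AE x in \<mu>. \<forall>q. 1 \<le> q \<longrightarrow> G q x = 1" by (auto simp: AE_all_countable)
    from 1 2 3 show ?thesis unfolding \<Omega>_def by eventually_elim auto
  qed
  \<comment> \<open>Off the good set H is the distribution function of the unit mass at 0, so a
    distribution results at every point. Measurability is kept because the good set lies in
    F.\<close>
  define H where "H x q = (if \<Omega> x then G q x else if 0 \<le> q then 1 else 0)" for x q
  have Hm[measurable]: "(\<lambda>x. H x q) \<in> borel_measurable F" for q unfolding H_def by measurable
  have H: "p \<le> q \<Longrightarrow> H x p \<le> H x q" "q < 0 \<Longrightarrow> H x q = 0" "1 \<le> q \<Longrightarrow> H x q = 1" for x p q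
    by (auto simp: H_def \<Omega>_def)
  have H01: "0 \<le> H x q" "H x q \<le> 1" for x q
    using H(1)[of "min q (-1)" q x] H(2)[of "min q (-1)" x] H(1)[of q "max q 1" x] H(3)[of "max q 1" x] by auto
  have HA: "(\<integral>x. indicator A x * H x q \<partial>\<mu>) = prob (A \<inter> ?L q)" if "A \<in> sets F" for A q
  proof -
    have [measurable]: "A \<in> sets \<mu>" using FM[OF that] .
    have [measurable]: "(\<lambda>x. H x q) \<in> borel_measurable \<mu>" "G q \<in> borel_measurable \<mu>"
      by (rule measurable_from_subalg[OF subalg Hm], rule measurable_from_subalg[OF subalg Gm])
    have "AE x in \<mu>. indicator A x * H x q = indicator A x * G q x"
      using \<Omega>AE by eventually_elim (simp add: H_def)
    then have "(\<integral>x. indicator A x * H x q \<partial>\<mu>) = (\<integral>x. indicator A x * G q x \<partial>\<mu>)"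
      by (intro integral_cong_AE) auto
    then show ?thesis using GA[OF that] by simp
  qed
  define D where "D x = (\<lambda>t::real. INF q\<in>{q. t < of_rat q}. H x q)" for x
  have D: "real_distribution (interval_measure (D x))" "measure (interval_measure (D x)) {..t} = D x t"
    "t < of_rat q \<Longrightarrow> D x t \<le> H x q" "D x t < y \<Longrightarrow> \<exists>q. t < of_rat q \<and> H x q < y" for x t q y
    unfolding D_def using inf_rational_cdf[of "H x", OF H] by auto
  define \<nu> where "\<nu> x = interval_measure (D x)" for x
  have \<nu>D: "measure (\<nu> x) {..t} = D x t" for x t unfolding \<nu>_def by (rule D(2))
  have Dm: "(\<lambda>x. D x t) \<in> borel_measurable F" for t
    unfolding D_def by (rule borel_measurable_cINF_real) (auto intro: Hm)
  have DA: "(\<integral>x. indicator A x * D x t \<partial>\<mu>) = prob (A \<inter> {x\<in>space \<mu>. \<theta> x \<le> t})" if A: "A \<in> sets F" for A t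
  proof -
    have Am[measurable]: "A \<in> sets \<mu>" using FM[OF A] .
    have [measurable]: "(\<lambda>x. H x q) \<in> borel_measurable \<mu>" "(\<lambda>x. D x t) \<in> borel_measurable \<mu>" for q
      by (rule measurable_from_subalg[OF subalg Hm], rule measurable_from_subalg[OF subalg Dm])
    \<comment> \<open>Rationals approaching t strictly from above: along them both sides of
      \<open>HA\<close> converge to the values at t.\<close>
    have "\<forall>n. \<exists>q::rat. t < of_rat q \<and> of_rat q < t + inverse (real (Suc n))"
      by (intro allI of_rat_dense) simp
    from choice[OF this] obtain r :: "nat \<Rightarrow> rat"
      where r: "\<And>n. t < of_rat (r n)" "\<And>n. of_rat (r n) < t + inverse (real (Suc n))" by blast
    have rlim: "\<forall>\<^sub>F n in sequentially. of_rat (r n) < y" if "t < y" for y :: real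
    proof -
      have "0 < y - t" using that by simp
      from reals_Archimedean[OF this] obtain N where N: "inverse (real (Suc N)) < y - t" by blast
      have "of_rat (r n) < y" if "n \<ge> N" for n
      proof -
        have "inverse (real (Suc n)) \<le> inverse (real (Suc N))" using that by (intro le_imp_inverse_le) auto
        then show ?thesis using r(2)[of n] N by linarith
      qed
      then show ?thesis by (auto simp: eventually_sequentially)
    qed
    have Hlim: "(\<lambda>n. H x (r n)) \<longlonglongrightarrow> D x t" for x
    proof (rule order_tendstoI)
      fix a assume a: "a < D x t"
      have "a < H x (r n)" for n using D(3)[OF r(1), of x n] a by linarith
      then show "\<forall>\<^sub>F n in sequentially. a < H x (r n)" by (intro always_eventually allI)
    next
      fix a assume "D x t < a"
      from D(4)[OF this] obtain q where q: "t < of_rat q" "H x q < a" by blast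
      show "\<forall>\<^sub>F n in sequentially. H x (r n) < a"
        using rlim[OF q(1)]
      proof eventually_elim
        case (elim n)
        then have "r n \<le> q" by (simp add: of_rat_less)
        then show ?case using H(1)[of "r n" q x] q(2) by linarith
      qed
    qed
    have "(\<lambda>n. \<integral>x. indicator A x * H x (r n) \<partial>\<mu>) \<longlonglongrightarrow> (\<integral>x. indicator A x * D x t \<partial>\<mu>)"
    proof (rule integral_dominated_convergence[where w = "\<lambda>_. 1"])
      show "AE x in \<mu>. (\<lambda>n. indicator A x * H x (r n)) \<longlonglongrightarrow> indicator A x * D x t"
        by (intro AE_I2 tendsto_mult_left Hlim)
      show "AE x in \<mu>. norm (indicator A x * H x (r n)) \<le> 1" for n
        using H01 by (intro AE_I2) (auto simp: indicator_def)
    qed auto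
    moreover have "(\<lambda>n. \<integral>x. indicator (A \<inter> ?L (r n)) x \<partial>\<mu>) \<longlonglongrightarrow> (\<integral>x. (indicator (A \<inter> {x\<in>space \<mu>. \<theta> x \<le> t}) x :: real) \<partial>\<mu>)"
    proof (rule integral_dominated_convergence[where w = "\<lambda>_. 1"])
      show "AE x in \<mu>. (\<lambda>n. indicator (A \<inter> ?L (r n)) x :: real) \<longlonglongrightarrow> indicator (A \<inter> {x\<in>space \<mu>. \<theta> x \<le> t}) x"
      proof (rule AE_I2)
        fix x
        have "\<forall>\<^sub>F n in sequentially. (\<theta> x \<le> of_rat (r n) \<longleftrightarrow> \<theta> x \<le> t)"
        proof (cases "\<theta> x \<le> t")
          case True
          then have "\<theta> x \<le> of_rat (r n)" for n using r(1)[of n] by linarith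
          then show ?thesis using True by simp
        next
          case False
          then have "t < \<theta> x" by simp
          from rlim[OF this] show ?thesis by eventually_elim (use False in auto)
        qed
        then have "\<forall>\<^sub>F n in sequentially. (indicator (A \<inter> ?L (r n)) x :: real) = indicator (A \<inter> {x\<in>space \<mu>. \<theta> x \<le> t}) x"
          by eventually_elim (auto simp: indicator_def)
        then show "(\<lambda>n. indicator (A \<inter> ?L (r n)) x :: real) \<longlonglongrightarrow> indicator (A \<inter> {x\<in>space \<mu>. \<theta> x \<le> t}) x"
          by (rule tendsto_eventually)
      qed
    qed (auto simp: indicator_def)
    ultimately show ?thesis using LIMSEQ_unique by (fastforce simp: HA[OF A])
  qed
  show ?thesis
    using D(1) Dm DA by (intro exI[of _ \<nu>]) (auto simp: \<nu>D, simp add: \<nu>_def)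
qed

text \<open>The half-lines are stable under intersection and generate the Borel sets, and both
  claims are preserved by complements and by countable disjoint unions.\<close>

lemma conditional_kernel_extend:
  fixes \<nu> :: "'a \<Rightarrow> real measure"
  assumes "prob_space \<mu>" and subalg: "subalgebra \<mu> F" and \<theta>[measurable]: "\<theta> \<in> borel_measurable \<mu>"
    and \<nu>: "\<And>x. real_distribution (\<nu> x)" "\<And>t. (\<lambda>x. measure (\<nu> x) {..t}) \<in> borel_measurable F"
    and \<nu>A: "\<And>t A. A \<in> sets F \<Longrightarrow> (\<integral>x. indicator A x * measure (\<nu> x) {..t} \<partial>\<mu>) = measure \<mu> (A \<inter> {x\<in>space \<mu>. \<theta> x \<le> t})"
    and B: "B \<in> sets borel"
  shows "(\<lambda>x. measure (\<nu> x) B) \<in> borel_measurable F \<and>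
    (\<forall>A\<in>sets F. (\<integral>x. indicator A x * measure (\<nu> x) B \<partial>\<mu>) = measure \<mu> (A \<inter> (\<theta> -` B \<inter> space \<mu>)))"
proof -
  interpret prob_space \<mu> by fact
  have FM: "A \<in> sets F \<Longrightarrow> A \<in> sets \<mu>" for A using subalg by (auto simp: subalgebra_def)
  have p: "prob_space (\<nu> x)" "sets (\<nu> x) = sets borel" "space (\<nu> x) = UNIV" for x
    using real_distributionD[OF \<nu>(1)] by auto
  have bnd: "\<bar>indicator A x * measure (\<nu> x) C\<bar> \<le> (1::real)" for A x C
    using prob_space.prob_le_1[OF p(1), of x C] by (auto simp: indicator_def)
  have "Int_stable (range (\<lambda>a::real. {..a}))" by (auto simp: Int_stable_def)
  moreover have "range (\<lambda>a::real. {..a}) \<subseteq> Pow UNIV" by simp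
  moreover have "B \<in> sigma_sets UNIV (range (\<lambda>a::real. {..a}))" using B by (simp add: borel_eq_atMost)
  ultimately show ?thesis
  proof (induction rule: sigma_sets_induct_disjoint)
    case (basic A)
    then show ?case using \<nu>(2) \<nu>A by (auto simp: vimage_def Int_def conj_commute)
  next
    case empty
    show ?case by simp
  next
    case (compl B)
    have Bb: "B \<in> sets borel" using compl(1) by (simp add: borel_eq_atMost)
    have [measurable]: "(\<lambda>x. measure (\<nu> x) B) \<in> borel_measurable F" using compl by blast
    have m: "(\<lambda>x. measure (\<nu> x) B) \<in> borel_measurable \<mu>" by (rule measurable_from_subalg[OF subalg]) measurable
    have c: "measure (\<nu> x) (UNIV - B) = 1 - measure (\<nu> x) B" for x
      using prob_space.prob_compl[OF p(1), of B x] Bb p by auto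
    have "(\<integral>x. indicator A x * (1 - measure (\<nu> x) B) \<partial>\<mu>) = prob (A \<inter> (\<theta> -` (UNIV - B) \<inter> space \<mu>))" if A: "A \<in> sets F" for A
    proof -
      have Am[measurable]: "A \<in> sets \<mu>" using FM[OF A] .
      have i1: "integrable \<mu> (indicator A :: 'a \<Rightarrow> real)" by (simp add: integrable_indicator_iff emeasure_eq_measure)
      have i2: "integrable \<mu> (\<lambda>x. indicator A x * measure (\<nu> x) B)"
        by (rule integrable_const_bound[of _ 1]) (use m bnd[of A _ B] in auto)
      have "(\<integral>x. indicator A x * (1 - measure (\<nu> x) B) \<partial>\<mu>) = (\<integral>x. indicator A x \<partial>\<mu>) - (\<integral>x. indicator A x * measure (\<nu> x) B \<partial>\<mu>)"
        using i1 i2 by (simp add: right_diff_distrib)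
      also have "\<dots> = prob A - prob (A \<inter> (\<theta> -` B \<inter> space \<mu>))" using compl A by simp
      also have "\<dots> = prob (A - (\<theta> -` B \<inter> space \<mu>))"
        using Bb by (subst finite_measure_Diff') (auto intro!: measurable_sets[OF \<theta>])
      also have "A - (\<theta> -` B \<inter> space \<mu>) = A \<inter> (\<theta> -` (UNIV - B) \<inter> space \<mu>)"
        using sets.sets_into_space[OF Am] by auto
      finally show ?thesis .
    qed
    then show ?case by (simp add: c)
  next
    case (union B)
    have Bb: "B i \<in> sets borel" for i using union(2) by (auto simp: borel_eq_atMost)
    have mF: "(\<lambda>x. measure (\<nu> x) (B i)) \<in> borel_measurable F" for i using union by blast
    have [measurable]: "(\<lambda>x. measure (\<nu> x) (B i)) \<in> borel_measurable \<mu>" for i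
      by (rule measurable_from_subalg[OF subalg mF])
    have s: "(\<lambda>i. measure (\<nu> x) (B i)) sums measure (\<nu> x) (\<Union>i. B i)" for x
      using union(1) Bb p by (intro finite_measure.finite_measure_UNION prob_space.finite_measure) auto
    then have se: "measure (\<nu> x) (\<Union>i. B i) = (\<Sum>i. measure (\<nu> x) (B i))" for x by (simp add: sums_iff)
    have mU: "(\<lambda>x. measure (\<nu> x) (\<Union>i. B i)) \<in> borel_measurable F"
      unfolding se using mF by (intro borel_measurable_suminf)
    then have [measurable]: "(\<lambda>x. measure (\<nu> x) (\<Union>i. B i)) \<in> borel_measurable \<mu>"
      by (rule measurable_from_subalg[OF subalg])
    have "(\<integral>x. indicator A x * measure (\<nu> x) (\<Union>i. B i) \<partial>\<mu>) = prob (A \<inter> (\<theta> -` (\<Union>i. B i) \<inter> space \<mu>))" if A: "A \<in> sets F" for A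
    proof -
      have Am[measurable]: "A \<in> sets \<mu>" using FM[OF A] .
      have \<theta>B: "\<theta> -` B i \<inter> space \<mu> \<in> sets \<mu>" for i using Bb by (intro measurable_sets[OF \<theta>])
      have "(\<lambda>n. \<integral>x. indicator A x * (\<Sum>i<n. measure (\<nu> x) (B i)) \<partial>\<mu>) \<longlonglongrightarrow> (\<integral>x. indicator A x * measure (\<nu> x) (\<Union>i. B i) \<partial>\<mu>)"
      proof (rule integral_dominated_convergence[where w = "\<lambda>_. 1"])
        show "AE x in \<mu>. (\<lambda>n. indicator A x * (\<Sum>i<n. measure (\<nu> x) (B i))) \<longlonglongrightarrow> indicator A x * measure (\<nu> x) (\<Union>i. B i)"
          using s by (intro AE_I2 tendsto_mult_left) (simp add: sums_def)
        show "AE x in \<mu>. norm (indicator A x * (\<Sum>i<n. measure (\<nu> x) (B i))) \<le> 1" for n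
        proof (rule AE_I2)
          fix x
          have "(\<Sum>i<n. measure (\<nu> x) (B i)) \<le> measure (\<nu> x) (\<Union>i. B i)"
            unfolding se using s[of x] by (intro sum_le_suminf) (auto simp: sums_iff)
          also have "\<dots> \<le> 1" by (rule prob_space.prob_le_1[OF p(1)])
          finally have "(\<Sum>i<n. measure (\<nu> x) (B i)) \<le> 1" .
          moreover have "0 \<le> (\<Sum>i<n. measure (\<nu> x) (B i))" by (intro sum_nonneg) auto
          ultimately show "norm (indicator A x * (\<Sum>i<n. measure (\<nu> x) (B i))) \<le> 1" by (auto simp: indicator_def)
        qed
      qed auto
      moreover have "(\<integral>x. indicator A x * (\<Sum>i<n. measure (\<nu> x) (B i)) \<partial>\<mu>) = (\<Sum>i<n. prob (A \<inter> (\<theta> -` B i \<inter> space \<mu>)))" for n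
      proof -
        have i2: "integrable \<mu> (\<lambda>x. indicator A x * measure (\<nu> x) (B i))" for i
          by (rule integrable_const_bound[of _ 1]) (use bnd[of A _ "B i"] in auto)
        have "(\<integral>x. indicator A x * (\<Sum>i<n. measure (\<nu> x) (B i)) \<partial>\<mu>) = (\<Sum>i<n. \<integral>x. indicator A x * measure (\<nu> x) (B i) \<partial>\<mu>)"
          unfolding sum_distrib_left by (rule Bochner_Integration.integral_sum[OF i2])
        then show ?thesis using union(3) A by simp
      qed
      moreover have "(\<lambda>n. \<Sum>i<n. prob (A \<inter> (\<theta> -` B i \<inter> space \<mu>))) \<longlonglongrightarrow> prob (\<Union>i. A \<inter> (\<theta> -` B i \<inter> space \<mu>))"
        unfolding sums_def[symmetric] using union(1) \<theta>B
        by (intro finite_measure_UNION) (auto simp: disjoint_family_on_def)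
      moreover have "(\<Union>i. A \<inter> (\<theta> -` B i \<inter> space \<mu>)) = A \<inter> (\<theta> -` (\<Union>i. B i) \<inter> space \<mu>)" by auto
      ultimately show ?thesis using LIMSEQ_unique by fastforce
    qed
    then show ?case using mU by blast
  qed
qed

text \<open>Condition on \<theta> in the real line, then push forward by \<pi>. Since \<pi> undoes
  \<theta>, the preimage of B under the composition is B itself. Mass of \<open>\<nu> x\<close> off
  the codes also lands in X, so every \<open>\<kappa> x\<close> is a probability measure.\<close>

lemma exists_conditional_kernel:
  fixes \<mu> :: "'a::metric_space measure"
  assumes comp: "compact (UNIV :: 'a set)" and \<mu>: "prob_space \<mu>" and s: "sets \<mu> = sets borel" and F: "subalgebra \<mu> F"
  shows "\<exists>\<kappa> :: 'a \<Rightarrow> 'a measure. (\<forall>x. prob_space (\<kappa> x) \<and> sets (\<kappa> x) = sets borel) \<and>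
    (\<forall>B\<in>sets borel. (\<lambda>x. measure (\<kappa> x) B) \<in> borel_measurable F \<and>
      (\<forall>A\<in>sets F. (\<integral>x. indicator A x * measure (\<kappa> x) B \<partial>\<mu>) = measure \<mu> (A \<inter> B)))"
proof -
  obtain \<theta> :: "'a \<Rightarrow> real" and \<pi> where c: "\<theta> \<in> borel \<rightarrow>\<^sub>M borel" "\<pi> \<in> borel \<rightarrow>\<^sub>M borel" "\<And>x. \<pi> (\<theta> x) = x"
    "\<And>x. 0 \<le> \<theta> x" "\<And>x. \<theta> x \<le> 1/2"
    using exists_real_coding[OF comp] by blast
  have \<theta>1: "\<theta> x \<le> 1" for x using c(5)[of x] by simp
  have \<theta>\<mu>: "\<theta> \<in> borel_measurable \<mu>" using c(1) by (simp add: measurable_cong_sets[OF s refl])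
  have sp: "space \<mu> = UNIV" using sets_eq_imp_space_eq[OF s] by simp
  obtain \<nu> :: "'a \<Rightarrow> real measure" where \<nu>: "\<And>x. real_distribution (\<nu> x)"
    "\<And>t. (\<lambda>x. measure (\<nu> x) {..t}) \<in> borel_measurable F"
    "\<And>t A. A \<in> sets F \<Longrightarrow> (\<integral>x. indicator A x * measure (\<nu> x) {..t} \<partial>\<mu>) = measure \<mu> (A \<inter> {x\<in>space \<mu>. \<theta> x \<le> t})"
    using exists_conditional_cdf[OF \<mu> F \<theta>\<mu> c(4) \<theta>1] by blast
  have e: "(\<lambda>x. measure (\<nu> x) B) \<in> borel_measurable F \<and>
    (\<forall>A\<in>sets F. (\<integral>x. indicator A x * measure (\<nu> x) B \<partial>\<mu>) = measure \<mu> (A \<inter> (\<theta> -` B \<inter> space \<mu>)))" if "B \<in> sets borel" for B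
    by (rule conditional_kernel_extend[OF \<mu> F \<theta>\<mu> \<nu> that])
  define \<kappa> where "\<kappa> x = distr (\<nu> x) borel \<pi>" for x
  have \<pi>\<nu>: "\<pi> \<in> \<nu> x \<rightarrow>\<^sub>M borel" and \<nu>s: "space (\<nu> x) = UNIV" "prob_space (\<nu> x)" for x
    using real_distributionD[OF \<nu>(1), of x] c(2) by (simp_all add: measurable_cong_sets[OF real_distributionD(2)[OF \<nu>(1)] refl])
  have m: "measure (\<kappa> x) B = measure (\<nu> x) (\<pi> -` B)" if "B \<in> sets borel" for x B
    unfolding \<kappa>_def using measure_distr[OF \<pi>\<nu> that] by (simp add: \<nu>s)
  have \<pi>B: "\<pi> -` B \<in> sets borel" if "B \<in> sets borel" for B using c(2) that by (rule measurable_sets_borel)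
  have \<theta>\<pi>: "\<theta> -` (\<pi> -` B) \<inter> space \<mu> = B" for B by (auto simp: c(3) sp)
  show ?thesis
  proof (intro exI[of _ \<kappa>] conjI allI ballI)
    show "prob_space (\<kappa> x)" for x unfolding \<kappa>_def by (rule prob_space.prob_space_distr[OF \<nu>s(2) \<pi>\<nu>])
    show "sets (\<kappa> x) = sets borel" for x by (simp add: \<kappa>_def)
    fix B :: "'a set" assume B: "B \<in> sets borel"
    show "(\<lambda>x. measure (\<kappa> x) B) \<in> borel_measurable F" using e[OF \<pi>B[OF B]] by (simp add: m[OF B])
    fix A assume "A \<in> sets F"
    then show "(\<integral>x. indicator A x * measure (\<kappa> x) B \<partial>\<mu>) = measure \<mu> (A \<inter> B)"
      using e[OF \<pi>B[OF B]] by (simp add: m[OF B] \<theta>\<pi>)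
  qed
qed

subsection \<open>Ergodicity of the conditional measures\<close>

lemma (in inv_sys) subalgebra_inv_alg: "subalgebra \<mu> (inv_alg f)"
  by (auto simp: subalgebra_def space_inv_alg space_UNIV sets_inv_alg sets_\<mu>)

locale inv_kernel = inv_sys f \<mu>
  for f :: "'a::metric_space \<Rightarrow> 'a" and \<mu> :: "'a measure" +
  fixes \<kappa> :: "'a \<Rightarrow> 'a measure"
  assumes \<kappa>_prob: "\<And>x. prob_space (\<kappa> x)" and \<kappa>_sets: "\<And>x. sets (\<kappa> x) = sets borel"
    and \<kappa>_meas: "\<And>B. B \<in> sets borel \<Longrightarrow> (\<lambda>x. measure (\<kappa> x) B) \<in> borel_measurable (inv_alg f)"
    and \<kappa>_cond: "\<And>A B. A \<in> sets (inv_alg f) \<Longrightarrow> B \<in> sets borel \<Longrightarrow>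
      (\<integral>x. indicator A x * measure (\<kappa> x) B \<partial>\<mu>) = prob (A \<inter> B)"
begin

sublocale sub: finite_measure_subalgebra \<mu> "inv_alg f"
  by unfold_locales (rule subalgebra_inv_alg)

lemma \<kappa>_space: "space (\<kappa> x) = UNIV"
  using sets_eq_imp_space_eq[OF \<kappa>_sets] by simp

lemma \<kappa>_le_1: "measure (\<kappa> x) B \<le> 1"
  by (rule prob_space.prob_le_1[OF \<kappa>_prob])

lemma \<kappa>_borel: "B \<in> sets borel \<Longrightarrow> (\<lambda>x. measure (\<kappa> x) B) \<in> borel_measurable borel"
  by (rule inv_alg_measurable_borel[OF \<kappa>_meas])

text \<open>A function measurable for the invariant algebra is its own conditional expectation,
  which integrals over invariant sets determine almost surely. This turns the integral identities
  for the kernel into statements about almost every \<open>\<kappa> x\<close>.\<close>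

lemma inv_alg_eqI:
  fixes u v :: "'a \<Rightarrow> real"
  assumes u: "u \<in> borel_measurable (inv_alg f)" "\<And>x. \<bar>u x\<bar> \<le> 1" and v: "v \<in> borel_measurable (inv_alg f)" "\<And>x. \<bar>v x\<bar> \<le> 1"
    and eq: "\<And>A. A \<in> sets (inv_alg f) \<Longrightarrow> (\<integral>x. indicator A x * u x \<partial>\<mu>) = (\<integral>x. indicator A x * v x \<partial>\<mu>)"
  shows "AE x in \<mu>. u x = v x"
proof -
  have iu: "integrable \<mu> u" by (rule borel_bounded_integrable[OF inv_alg_measurable_borel[OF u(1)] u(2)])
  have iv: "integrable \<mu> v" by (rule borel_bounded_integrable[OF inv_alg_measurable_borel[OF v(1)] v(2)])
  have "AE x in \<mu>. real_cond_exp \<mu> (inv_alg f) u x = v x"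
    by (rule sub.real_cond_exp_charact) (use eq iu iv v in \<open>auto simp: set_lebesgue_integral_def\<close>)
  moreover have "AE x in \<mu>. real_cond_exp \<mu> (inv_alg f) u x = u x"
    by (rule sub.real_cond_exp_F_meas[OF iu u(1)])
  ultimately show ?thesis by eventually_elim simp
qed

text \<open>The \<kappa>-measures of a null set have mean 0, hence vanish almost surely.\<close>

lemma kernel_AE:
  assumes "AE y in \<mu>. P y"
  shows "AE x in \<mu>. AE y in \<kappa> x. P y"
proof -
  obtain N where N: "N \<in> null_sets \<mu>" "{y. \<not> P y} \<subseteq> N"
    using assms by (auto simp: eventually_ae_filter space_UNIV)
  have Nb: "N \<in> sets borel" "prob N = 0" using N(1) by (auto simp: null_sets_def sets_\<mu> emeasure_eq_measure)
  have "AE x in \<mu>. measure (\<kappa> x) N = 0"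
  proof (rule inv_alg_eqI)
    fix A assume A: "A \<in> sets (inv_alg f)"
    then have "prob (A \<inter> N) \<le> prob N" using Nb by (intro finite_measure_mono) (auto simp: sets_\<mu>)
    then show "(\<integral>x. indicator A x * measure (\<kappa> x) N \<partial>\<mu>) = (\<integral>x. indicator A x * 0 \<partial>\<mu>)"
      using Nb \<kappa>_cond[OF A Nb(1)] by (simp add: measure_le_0_iff)
  qed (use \<kappa>_meas[OF Nb(1)] \<kappa>_le_1 in auto)
  then show ?thesis
  proof eventually_elim
    case (elim x)
    interpret K: prob_space "\<kappa> x" by (rule \<kappa>_prob)
    have "N \<in> null_sets (\<kappa> x)" using elim Nb by (simp add: null_sets_def \<kappa>_sets K.emeasure_eq_measure)
    then show ?case using N(2) by (intro AE_I') (auto simp: \<kappa>_space)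
  qed
qed

lemma kernel_inv_set:
  assumes B: "B \<in> sets (inv_alg f)"
  shows "AE x in \<mu>. measure (\<kappa> x) B = indicator B x"
proof (rule inv_alg_eqI)
  have Bb: "B \<in> sets borel" using B by (simp add: sets_inv_alg)
  show "(\<lambda>x. measure (\<kappa> x) B) \<in> borel_measurable (inv_alg f)" by (rule \<kappa>_meas[OF Bb])
  fix A assume A: "A \<in> sets (inv_alg f)"
  have "(\<integral>x. indicator A x * indicator B x \<partial>\<mu>) = (\<integral>x. (indicator (A \<inter> B) x :: real) \<partial>\<mu>)"
    by (simp add: indicator_inter_arith)
  also have "\<dots> = prob (A \<inter> B)" using A Bb by (simp add: space_UNIV)
  finally show "(\<integral>x. indicator A x * measure (\<kappa> x) B \<partial>\<mu>) = (\<integral>x. indicator A x * indicator B x \<partial>\<mu>)"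
    using \<kappa>_cond[OF A Bb] by simp
qed (use B \<kappa>_le_1 in \<open>auto simp: indicator_def\<close>)

text \<open>Each set \<open>{g \<le> r}\<close> is invariant, so almost every
  \<open>\<kappa> x\<close> gives it measure 1 or 0 according to whether x lies in it. Taken over
  all rational r, this fixes the value of g.\<close>

lemma kernel_const:
  fixes g :: "'a \<Rightarrow> real"
  assumes g: "g \<in> borel_measurable (inv_alg f)"
  shows "AE x in \<mu>. AE y in \<kappa> x. g y = g x"
proof -
  have S: "{y. g y \<le> of_rat r} \<in> sets (inv_alg f)" for r :: rat
    using measurable_sets[OF g, of "{..of_rat r}"] by (simp add: space_inv_alg vimage_def)
  have "AE x in \<mu>. \<forall>r::rat. measure (\<kappa> x) {y. g y \<le> of_rat r} = indicator {y. g y \<le> of_rat r} x"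
    unfolding AE_all_countable by (intro allI kernel_inv_set S)
  then show ?thesis
  proof eventually_elim
    case (elim x)
    interpret K: prob_space "\<kappa> x" by (rule \<kappa>_prob)
    have "AE y in \<kappa> x. (g y \<le> of_rat r \<longleftrightarrow> g x \<le> of_rat r)" for r :: rat
    proof -
      have Sx: "{y. g y \<le> of_rat r} \<in> sets (\<kappa> x)" using S[of r] by (simp add: \<kappa>_sets sets_inv_alg)
      show ?thesis
      proof (cases "g x \<le> of_rat r")
        case True
        then have "K.prob {y. g y \<le> of_rat r} = 1" using elim by simp
        then have "AE y in \<kappa> x. y \<in> {y. g y \<le> of_rat r}" using K.prob_eq_1[OF Sx] by simp
        then show ?thesis using True by simp
      next
        case False
        then have "K.prob {y. g y \<le> of_rat r} = 0" using elim by simp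
        then have "AE y in \<kappa> x. y \<notin> {y. g y \<le> of_rat r}" using K.prob_eq_0[OF Sx] by simp
        then show ?thesis using False by simp
      qed
    qed
    then have "AE y in \<kappa> x. \<forall>r::rat. (g y \<le> of_rat r \<longleftrightarrow> g x \<le> of_rat r)"
      unfolding AE_all_countable by blast
    then show ?case
    proof eventually_elim
      case (elim y)
      show ?case
      proof (rule ccontr)
        assume "g y \<noteq> g x"
        then consider "g y < g x" | "g x < g y" by linarith
        then show False
        proof cases
          case 1
          then obtain r where "g y < of_rat r" "of_rat r < g x" using of_rat_dense by blast
          then show False using elim[rule_format, of r] by simp
        next
          case 2
          then obtain r where "g x < of_rat r" "of_rat r < g y" using of_rat_dense by blast
          then show False using elim[rule_format, of r] by simp
        qed
      qed
    qed
  qed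
qed

text \<open>\<mu> is the barycentre of the measures \<open>\<kappa> x\<close>, written as a
  bind.\<close>

lemma kernel_integral:
  fixes q :: "'a \<Rightarrow> real"
  assumes q: "q \<in> borel_measurable borel" and B: "\<And>x. \<bar>q x\<bar> \<le> B"
  shows "(\<lambda>x. integral\<^sup>L (\<kappa> x) q) \<in> borel_measurable \<mu>" "(\<integral>x. integral\<^sup>L (\<kappa> x) q \<partial>\<mu>) = integral\<^sup>L \<mu> q"
    "\<And>x. \<bar>integral\<^sup>L (\<kappa> x) q\<bar> \<le> B"
proof -
  have K: "\<kappa> \<in> \<mu> \<rightarrow>\<^sub>M subprob_algebra borel"
  proof (rule measurable_subprob_algebra)
    fix x
    show "subprob_space (\<kappa> x)" by (rule prob_space_imp_subprob_space[OF \<kappa>_prob])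
    show "sets (\<kappa> x) = sets borel" by (rule \<kappa>_sets)
  next
    fix C :: "'a set" assume C: "C \<in> sets borel"
    have "emeasure (\<kappa> x) C = ennreal (measure (\<kappa> x) C)" for x
      by (rule finite_measure.emeasure_eq_measure[OF prob_space.finite_measure[OF \<kappa>_prob]])
    then show "(\<lambda>x. emeasure (\<kappa> x) C) \<in> borel_measurable \<mu>"
      using \<kappa>_borel[OF C] by (simp add: meas_cong)
  qed
  show "(\<lambda>x. integral\<^sup>L (\<kappa> x) q) \<in> borel_measurable \<mu>"
    by (rule measurable_compose[OF K integral_measurable_subprob_algebra[OF q]])
  have "\<mu> \<bind> \<kappa> = \<mu>"
  proof (rule measure_eqI)
    have se: "sets (\<mu> \<bind> \<kappa>) = sets borel" by (rule sets_bind) (auto simp: \<kappa>_sets space_UNIV)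
    then show "sets (\<mu> \<bind> \<kappa>) = sets \<mu>" by (simp add: sets_\<mu>)
    fix C assume "C \<in> sets (\<mu> \<bind> \<kappa>)"
    then have C: "C \<in> sets borel" using se by simp
    have "emeasure (\<mu> \<bind> \<kappa>) C = (\<integral>\<^sup>+x. emeasure (\<kappa> x) C \<partial>\<mu>)"
      by (rule emeasure_bind[OF _ K C]) (simp add: space_UNIV)
    also have "\<dots> = (\<integral>\<^sup>+x. ennreal (measure (\<kappa> x) C) \<partial>\<mu>)"
      by (simp add: finite_measure.emeasure_eq_measure[OF prob_space.finite_measure[OF \<kappa>_prob]])
    also have "\<dots> = ennreal (\<integral>x. measure (\<kappa> x) C \<partial>\<mu>)"
      by (rule nn_integral_eq_integral) (use borel_bounded_integrable[OF \<kappa>_borel[OF C], of 1] \<kappa>_le_1 in auto)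
    also have "(\<integral>x. measure (\<kappa> x) C \<partial>\<mu>) = prob C"
      using \<kappa>_cond[of UNIV C] C by (simp add: sets_inv_alg)
    finally show "emeasure (\<mu> \<bind> \<kappa>) C = emeasure \<mu> C" by (simp add: emeasure_eq_measure)
  qed
  moreover have "integral\<^sup>L (\<mu> \<bind> \<kappa>) q = (\<integral>x. integral\<^sup>L (\<kappa> x) q \<partial>\<mu>)"
    by (rule integral_bind[OF q _ K, where B = B and B' = 1])
      (use B prob_space.emeasure_space_1[OF \<kappa>_prob] in \<open>auto simp: finite_measure_axioms\<close>)
  ultimately show "(\<integral>x. integral\<^sup>L (\<kappa> x) q \<partial>\<mu>) = integral\<^sup>L \<mu> q" by simp
  fix x
  interpret K: prob_space "\<kappa> x" by (rule \<kappa>_prob)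
  have qx: "integrable (\<kappa> x) q"
    by (rule K.integrable_const_bound[of _ B]) (use B q in \<open>auto simp: measurable_cong_sets[OF \<kappa>_sets refl]\<close>)
  have "\<bar>integral\<^sup>L (\<kappa> x) q\<bar> \<le> (\<integral>y. \<bar>q y\<bar> \<partial>\<kappa> x)" by (rule integral_abs_bound)
  also have "\<dots> \<le> (\<integral>y. B \<partial>\<kappa> x)" using qx B by (intro integral_mono) auto
  finally show "\<bar>integral\<^sup>L (\<kappa> x) q\<bar> \<le> B" by (simp add: K.prob_space)
qed

text \<open>By the coding, invariance of \<open>\<kappa> x\<close> is tested on countably many sets
  C. For invariant A, the intersection of A with the preimage of C is the preimage of
  \<open>A \<inter> C\<close>. So the \<kappa>-measures of C and of its preimage have the same
  integrals over A and agree almost surely.\<close>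

lemma kernel_invariant:
  assumes comp: "compact (UNIV :: 'a set)"
  shows "AE x in \<mu>. \<kappa> x \<in> invariant_measures f"
proof -
  obtain \<theta> :: "'a \<Rightarrow> real" and \<pi> where c: "\<theta> \<in> borel \<rightarrow>\<^sub>M borel" "\<pi> \<in> borel \<rightarrow>\<^sub>M borel" "\<And>x. \<pi> (\<theta> x) = x"
    using exists_real_coding[OF comp] by blast
  let ?C = "\<lambda>q::rat. {x. \<theta> x \<le> of_rat q}"
  have Cb: "?C q \<in> sets borel" for q using measurable_sets_borel[OF c(1), of "{..of_rat q}"] by (simp add: vimage_def)
  have fb: "f -` B \<in> sets borel" if "B \<in> sets borel" for B by (rule measurable_sets_borel[OF f_borel that])
  have "AE x in \<mu>. measure (\<kappa> x) (f -` ?C q) = measure (\<kappa> x) (?C q)" for q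
  proof (rule inv_alg_eqI)
    fix A assume A: "A \<in> sets (inv_alg f)"
    then have A': "A \<in> sets borel" "f -` A = A" by (auto simp: sets_inv_alg)
    have "prob (A \<inter> f -` ?C q) = prob ((f ^^ 1) -` (A \<inter> ?C q))" using A' by simp
    also have "\<dots> = prob (A \<inter> ?C q)" by (rule prob_funpow) (use A' Cb in auto)
    finally show "(\<integral>x. indicator A x * measure (\<kappa> x) (f -` ?C q) \<partial>\<mu>) = (\<integral>x. indicator A x * measure (\<kappa> x) (?C q) \<partial>\<mu>)"
      using \<kappa>_cond[OF A fb[OF Cb[of q]]] \<kappa>_cond[OF A Cb[of q]] by simp
  qed (use \<kappa>_meas[OF Cb[of q]] \<kappa>_meas[OF fb[OF Cb[of q]]] \<kappa>_le_1 in auto)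
  then have "AE x in \<mu>. \<forall>q. measure (\<kappa> x) (f -` ?C q) = measure (\<kappa> x) (?C q)"
    unfolding AE_all_countable by blast
  then show ?thesis
  proof eventually_elim
    case (elim x)
    have fm: "f \<in> \<kappa> x \<rightarrow>\<^sub>M borel" using f_borel by (simp add: measurable_cong_sets[OF \<kappa>_sets refl])
    have "distr (\<kappa> x) borel f = \<kappa> x"
    proof (rule measure_eqI_coded[OF _ _ \<kappa>_prob \<kappa>_sets c])
      show "prob_space (distr (\<kappa> x) borel f)" by (rule prob_space.prob_space_distr[OF \<kappa>_prob fm])
      show "measure (distr (\<kappa> x) borel f) (?C q) = measure (\<kappa> x) (?C q)" for q
        using elim by (simp add: measure_distr[OF fm Cb] \<kappa>_space)
    qed simp
    then show ?case by (simp add: invariant_measures_def \<kappa>_prob \<kappa>_sets)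
  qed
qed

text \<open>For almost every x, the visit frequencies of each test set C converge
  \<open>\<kappa> x\<close>-almost surely to the constant \<open>measure (\<kappa> x) C\<close>.
  Hence an invariant A is independent of every C under \<open>\<kappa> x\<close>; if A is not null,
  conditioning on A leaves \<open>\<kappa> x\<close> unchanged, so A has measure 1. The exceptional
  null set comes from the countably many C and therefore does not depend on A.\<close>

lemma kernel_ergodic:
  assumes comp: "compact (UNIV :: 'a set)"
  shows "AE x in \<mu>. ergodic f (\<kappa> x)"
proof -
  obtain \<theta> :: "'a \<Rightarrow> real" and \<pi> where c: "\<theta> \<in> borel \<rightarrow>\<^sub>M borel" "\<pi> \<in> borel \<rightarrow>\<^sub>M borel" "\<And>x. \<pi> (\<theta> x) = x"
    using exists_real_coding[OF comp] by blast
  let ?C = "\<lambda>q::rat. {x. \<theta> x \<le> of_rat q}"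
  let ?avg = "\<lambda>q n y. birkhoff_sum f (indicator (?C q)) n y / real n"
  have Cb: "?C q \<in> sets borel" for q using measurable_sets_borel[OF c(1), of "{..of_rat q}"] by (simp add: vimage_def)
  have lim: "AE y in \<mu>. (\<lambda>n. ?avg q n y) \<longlonglongrightarrow> measure (\<kappa> y) (?C q)" for q
  proof (rule birkhoff_ergodic)
    show "integrable \<mu> (indicator (?C q) :: 'a \<Rightarrow> real)"
      using Cb[of q] by (simp add: integrable_indicator_iff emeasure_eq_measure sets_\<mu>)
    show "(indicator (?C q) :: 'a \<Rightarrow> real) \<in> borel_measurable borel" using Cb[of q] by simp
    show "(\<lambda>x. measure (\<kappa> x) (?C q)) \<in> borel_measurable (inv_alg f)" by (rule \<kappa>_meas[OF Cb])
    show "integrable \<mu> (\<lambda>x. measure (\<kappa> x) (?C q))"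
      by (rule borel_bounded_integrable[OF \<kappa>_borel[OF Cb], of _ 1]) (simp add: \<kappa>_le_1)
    fix A assume A: "A \<in> sets (inv_alg f)"
    then have "A \<in> sets borel" by (simp add: sets_inv_alg)
    then have "(\<integral>x. indicator A x * indicator (?C q) x \<partial>\<mu>) = prob (A \<inter> ?C q)"
      using Cb[of q] by (simp add: space_UNIV sets_\<mu> flip: indicator_inter_arith)
    then show "(\<integral>x. indicator A x * indicator (?C q) x \<partial>\<mu>) = (\<integral>x. indicator A x * measure (\<kappa> x) (?C q) \<partial>\<mu>)"
      using \<kappa>_cond[OF A Cb] by simp
  qed
  have "AE x in \<mu>. AE y in \<kappa> x. (\<lambda>n. ?avg q n y) \<longlonglongrightarrow> measure (\<kappa> x) (?C q)" for q
    using kernel_AE[OF lim[of q]] kernel_const[OF \<kappa>_meas[OF Cb[of q]]]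
  proof eventually_elim
    case (elim x)
    from elim show ?case by eventually_elim simp
  qed
  then have "AE x in \<mu>. \<forall>q. AE y in \<kappa> x. (\<lambda>n. ?avg q n y) \<longlonglongrightarrow> measure (\<kappa> x) (?C q)"
    unfolding AE_all_countable by blast
  with kernel_invariant[OF comp] show ?thesis
  proof eventually_elim
    case (elim x)
    interpret K: inv_sys f "\<kappa> x" using f_borel elim(1) by (rule inv_sys.intro)
    show ?case unfolding ergodic_def
    proof (intro conjI ballI impI elim(1))
      fix A :: "'a set" assume A: "A \<in> sets borel" "f -` A = A"
      then have AI: "A \<in> sets (inv_alg f)" by (simp add: sets_inv_alg)
      have indep: "K.prob (A \<inter> ?C q) = K.prob A * K.prob (?C q)" for q
        using K.birkhoff_indicator_limit[OF Cb AI] elim(2) by blast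
      show "K.prob A = 0 \<or> K.prob A = 1"
      proof (cases "K.prob A = 0")
        case False
        let ?U = "uniform_measure (\<kappa> x) A"
        have Am: "A \<in> sets (\<kappa> x)" using A by (simp add: \<kappa>_sets)
        have U: "measure ?U B = K.prob (A \<inter> B) / K.prob A" if "B \<in> sets borel" for B
          using that Am False by (intro measure_uniform_measure) (auto simp: K.emeasure_eq_measure \<kappa>_sets)
        have "?U = \<kappa> x"
        proof (rule measure_eqI_coded[OF _ _ \<kappa>_prob \<kappa>_sets c])
          show "prob_space ?U" by (rule prob_space_uniform_measure) (use Am False in \<open>auto simp: K.emeasure_eq_measure\<close>)
          show "measure ?U (?C q) = measure (\<kappa> x) (?C q)" for q
            using False by (simp add: U[OF Cb] indep)
        qed (simp add: \<kappa>_sets)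
        then have "K.prob A = K.prob (A \<inter> A) / K.prob A" using U[OF A(1)] by simp
        then show ?thesis using False by simp
      qed simp
    qed
  qed
qed

end

lemma exists_inv_kernel:
  fixes f :: "'a::metric_space \<Rightarrow> 'a"
  assumes "compact (UNIV :: 'a set)" "inv_sys f \<mu>"
  shows "\<exists>\<kappa>. inv_kernel f \<mu> \<kappa>"
proof -
  interpret inv_sys f \<mu> by fact
  obtain \<kappa> where \<kappa>: "\<forall>x. prob_space (\<kappa> x) \<and> sets (\<kappa> x) = sets borel"
    "\<forall>B\<in>sets borel. (\<lambda>x. measure (\<kappa> x) B) \<in> borel_measurable (inv_alg f) \<and>
      (\<forall>A\<in>sets (inv_alg f). (\<integral>x. indicator A x * measure (\<kappa> x) B \<partial>\<mu>) = measure \<mu> (A \<inter> B))"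
    using exists_conditional_kernel[OF assms(1) prob_space_axioms sets_\<mu> subalgebra_inv_alg] by blast
  have "inv_kernel f \<mu> \<kappa>"
  proof (rule inv_kernel.intro[OF inv_sys_axioms inv_kernel_axioms.intro])
    fix x
    show "prob_space (\<kappa> x)" by (rule conjunct1[OF spec[OF \<kappa>(1)]])
    show "sets (\<kappa> x) = sets borel" by (rule conjunct2[OF spec[OF \<kappa>(1)]])
  next
    fix B :: "'a set" assume B: "B \<in> sets borel"
    show "(\<lambda>x. measure (\<kappa> x) B) \<in> borel_measurable (inv_alg f)" by (rule conjunct1[OF bspec[OF \<kappa>(2) B]])
    fix A assume A: "A \<in> sets (inv_alg f)"
    show "(\<integral>x. indicator A x * measure (\<kappa> x) B \<partial>\<mu>) = prob (A \<inter> B)"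
      by (rule bspec[OF conjunct2[OF bspec[OF \<kappa>(2) B]] A])
  qed
  then show ?thesis by (rule exI[where x = \<kappa>])
qed

subsection \<open>Entropy of the conditional measures\<close>

text \<open>A one-sided modulus of continuity for \<open>- p ln p\<close> that does not depend on
  the position of b. For \<open>b \<le> a\<close>, subadditivity on \<open>a = b + (a - b)\<close>
  leaves \<open>- (a - b) ln (a - b)\<close>, which the square root bounds. For \<open>a < b\<close>
  the slope is at least -1 on the unit interval, which costs \<delta>.\<close>

lemma xlnx_close:
  fixes a b :: real
  assumes "0 \<le> a" "0 \<le> b" "b \<le> 1" "\<bar>a - b\<bar> \<le> \<delta>"
  shows "- (a * ln a) \<le> - (b * ln b) + 2 * sqrt \<delta> + \<delta>"
proof -
  have \<delta>: "\<delta> \<ge> 0" using assms by linarith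
  show ?thesis
  proof (cases "b \<le> a")
    case True
    let ?p = "\<lambda>j::bool. if j then b else a - b"
    have "- ((\<Sum>j\<in>UNIV. 1 * ?p j) * ln (\<Sum>j\<in>UNIV. 1 * ?p j))
        \<le> (\<Sum>j\<in>UNIV. 1 * (- (?p j * ln (?p j))) + ?p j * (- (1 * ln 1)))"
      by (rule entropy_term_mixture_upper) (use assms True in auto)
    then have "- (a * ln a) \<le> - (b * ln b) - (a - b) * ln (a - b)" by (simp add: UNIV_bool)
    moreover have "- ((a - b) * ln (a - b)) \<le> 2 * sqrt (a - b)" using True by (intro neg_xlnx_le) simp
    moreover have "sqrt (a - b) \<le> sqrt \<delta>" using assms(4) True by (intro real_sqrt_le_mono) linarith
    ultimately show ?thesis using \<delta> by linarith
  next
    case False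
    then have b: "b > 0" "a < b" using assms by auto
    have "- (a * ln a) + b * ln b \<le> b - a"
    proof (cases "a = 0")
      case True
      have "b * ln b \<le> 0" using b assms(3) by (simp add: mult_nonneg_nonpos)
      moreover have "- (a * ln a) = 0" using True by simp
      ultimately show ?thesis using True b by linarith
    next
      case False
      then have a: "a > 0" using assms by simp
      have "ln (b / a) \<le> b / a - 1" using a b by (intro ln_le_minus_one) simp
      then have "a * ln (b / a) \<le> a * (b / a - 1)" using a by (intro mult_left_mono) auto
      also have "\<dots> = b - a" using a by (simp add: field_simps)
      finally have "a * (ln b - ln a) \<le> b - a" using a b by (simp add: ln_div)
      moreover have "(b - a) * ln b \<le> 0" using b assms(3) by (intro mult_nonneg_nonpos) auto
      ultimately show ?thesis by (simp add: algebra_simps)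
    qed
    moreover have "b - a \<le> \<delta>" using assms(4) by linarith
    moreover have "0 \<le> sqrt \<delta>" using \<delta> by simp
    ultimately show ?thesis by linarith
  qed
qed

context inv_sys
begin

lemma uniform_measure_meas:
  assumes "A \<in> sets borel" "prob A > 0" "B \<in> sets borel"
  shows "measure (uniform_measure \<mu> A) B = prob (A \<inter> B) / prob A"
  by (rule measure_uniform_measure) (use assms in \<open>auto simp: emeasure_eq_measure sets_\<mu>\<close>)

lemma uniform_measure_invariant:
  assumes A: "A \<in> sets (inv_alg f)" and pos: "prob A > 0"
  shows "uniform_measure \<mu> A \<in> invariant_measures f"
proof -
  let ?U = "uniform_measure \<mu> A"
  have Ab: "A \<in> sets borel" "f -` A = A" using A by (auto simp: sets_inv_alg)
  have s: "sets ?U = sets borel" by (simp add: sets_\<mu>)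
  have P: "prob_space ?U" by (rule prob_space_uniform_measure) (use Ab pos in \<open>auto simp: emeasure_eq_measure\<close>)
  interpret U: prob_space ?U by fact
  have fU: "f \<in> ?U \<rightarrow>\<^sub>M borel" using f_borel by (simp add: measurable_cong_sets[OF s refl])
  interpret fU: prob_space "distr ?U borel f" by (rule U.prob_space_distr[OF fU])
  have "distr ?U borel f = ?U"
  proof (rule measure_eqI)
    fix B assume "B \<in> sets (distr ?U borel f)"
    then have B: "B \<in> sets borel" by simp
    have fB: "f -` B \<in> sets borel" by (rule measurable_sets_borel[OF f_borel B])
    have "measure (distr ?U borel f) B = measure ?U (f -` B)"
      using measure_distr[OF fU B] by (simp add: space_UNIV)
    also have "\<dots> = prob ((f ^^ 1) -` (A \<inter> B)) / prob A" using uniform_measure_meas[OF Ab(1) pos fB] Ab by simp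
    also have "prob ((f ^^ 1) -` (A \<inter> B)) = prob (A \<inter> B)" by (rule prob_funpow) (use Ab B in auto)
    also have "\<dots> / prob A = measure ?U B" using uniform_measure_meas[OF Ab(1) pos B] by simp
    finally show "emeasure (distr ?U borel f) B = emeasure ?U B"
      by (simp add: U.emeasure_eq_measure fU.emeasure_eq_measure)
  qed (simp add: sets_\<mu>)
  then show ?thesis using P s by (simp add: invariant_measures_def)
qed

lemma ent_word_le:
  assumes X: "simple_function \<mu> X"
  shows "ent \<mu> (word f n X) \<le> real n * ln (card (range X))"
proof -
  have 1: "ent \<mu> (word f 1 X) \<le> ln (card (range X))"
  proof -
    have "ent \<mu> (word f 1 X) \<le> ent \<mu> X" by (rule ent_mono[OF X]) (simp add: word_eq_iff)
    also have "\<dots> \<le> ln (card (range X))" by (rule ent_le_card[OF X])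
    finally show ?thesis .
  qed
  show ?thesis
  proof (induction n)
    case 0
    have "word f 0 X = (\<lambda>_. [])" by (simp add: word_def fun_eq_iff)
    then show ?case by (simp add: ent_const)
  next
    case (Suc n)
    have "ent \<mu> (word f (n + 1) X) \<le> ent \<mu> (word f n X) + ent \<mu> (word f 1 X)" by (rule ent_word_add[OF X])
    with Suc 1 show ?case by (simp add: algebra_simps)
  qed
qed

end

context inv_kernel
begin

lemma ent_kernel_meas:
  fixes W :: "'a \<Rightarrow> 'w"
  assumes W: "simple_function borel W"
  shows "(\<lambda>x. ent (\<kappa> x) W) \<in> borel_measurable borel"
proof -
  have [measurable]: "(\<lambda>x. measure (\<kappa> x) (W -` {w})) \<in> borel_measurable borel" for w
    by (rule \<kappa>_borel[OF events_vimage[OF W]])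
  show ?thesis unfolding ent_def by measurable
qed

lemma ent_kernel_bounds:
  assumes W: "simple_function borel W"
  shows "0 \<le> ent (\<kappa> x) W" "ent (\<kappa> x) W \<le> ln (card (range W))"
proof -
  have "full_prob (\<kappa> x)"
    by (intro full_prob.intro \<kappa>_prob full_prob_axioms.intro \<kappa>_space)
  moreover have "simple_function (\<kappa> x) W"
    using W simple_function_cong_algebra[of "\<kappa> x" borel W] by (simp add: \<kappa>_sets \<kappa>_space)
  ultimately show "0 \<le> ent (\<kappa> x) W" "ent (\<kappa> x) W \<le> ln (card (range W))"
    by (auto intro: full_prob.ent_nonneg full_prob.ent_le_card)
qed

text \<open>
  Rounding the probabilities of the words under \<open>\<kappa> x\<close> to multiples of \<open>1 / M\<close> gives a finite invariant
  partition, on whose pieces \<open>\<kappa> x\<close> is close to \<open>\<mu>\<close> conditioned on the piece.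
\<close>

lemma rate_le_kernel_ent:
  fixes X :: "'a \<Rightarrow> 'b"
  assumes X: "simple_function borel X" and n: "n \<ge> 1"
  shows "real n * rate f \<mu> X \<le> (\<integral>x. ent (\<kappa> x) (word f n X) \<partial>\<mu>)"
proof -
  let ?W = "word f n X"
  let ?R = "range ?W"
  let ?v = "\<lambda>w x. measure (\<kappa> x) (?W -` {w})"
  let ?E = "\<lambda>x. ent (\<kappa> x) ?W"
  have W: "simple_function borel ?W" using simple_word X by (simp add: simple_iff)
  have fin: "finite ?R" using simple_functionD(1)[OF W] by simp
  have Wb: "?W -` {w} \<in> sets borel" for w by (rule events_vimage[OF W])
  have vF[measurable]: "?v w \<in> borel_measurable (inv_alg f)" for w by (rule \<kappa>_meas[OF Wb])
  have Eint: "integrable \<mu> ?E"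
    by (rule borel_bounded_integrable[OF ent_kernel_meas[OF W], of "ln (card ?R)"])
      (use ent_kernel_bounds[OF W] in \<open>auto simp: abs_le_iff intro: order_trans[of _ 0]\<close>)
  \<comment> \<open>n stays fixed while M grows. On a piece the rate is bounded by the entropy of
    n-words, which depends continuously on finitely many probabilities; the rate itself offers no
    such continuity.\<close>
  have main: "real n * rate f \<mu> X \<le> integral\<^sup>L \<mu> ?E + real (card ?R) * (2 * sqrt (1 / real M) + 1 / real M)"
    if M: "M \<ge> 1" for M :: nat
  proof -
    define c where "c = real (card ?R) * (2 * sqrt (1 / real M) + 1 / real M)"
    have c0: "c \<ge> 0" by (simp add: c_def)
    \<comment> \<open>Words outside the range are sent to 0, so that Z has finitely many
      values.\<close>
    define Z where "Z x = (\<lambda>w. if w \<in> ?R then \<lfloor>real M * ?v w x\<rfloor> else 0)" for x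
    have finZ: "finite (range Z)"
    proof (rule finite_subset)
      show "finite {h. \<forall>w. (w \<in> ?R \<longrightarrow> h w \<in> {0..int M}) \<and> (w \<notin> ?R \<longrightarrow> h w = (0::int))}"
        by (rule finite_set_of_finite_funs[OF fin]) simp
      have "\<lfloor>real M * ?v w x\<rfloor> \<le> int M" for w x
      proof -
        have "real M * ?v w x \<le> real M * 1" by (intro mult_left_mono \<kappa>_le_1) simp
        then show ?thesis by linarith
      qed
      then show "range Z \<subseteq> {h. \<forall>w. (w \<in> ?R \<longrightarrow> h w \<in> {0..int M}) \<and> (w \<notin> ?R \<longrightarrow> h w = (0::int))}"
        by (auto simp: Z_def)
    qed
    have ZF: "Z -` {z} \<in> sets (inv_alg f)" if "z \<in> range Z" for z
    proof -
      have "Z -` {z} = {x \<in> space (inv_alg f). \<forall>w\<in>?R. \<lfloor>real M * ?v w x\<rfloor> = z w}"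
      proof -
        from that obtain u where u: "z = Z u" by blast
        have "Z y = z \<longleftrightarrow> (\<forall>w\<in>?R. \<lfloor>real M * ?v w y\<rfloor> = z w)" for y
        proof
          assume eq: "Z y = z"
          show "\<forall>w\<in>?R. \<lfloor>real M * ?v w y\<rfloor> = z w"
          proof
            fix w assume "w \<in> ?R"
            moreover have "Z y w = z w" using eq by simp
            ultimately show "\<lfloor>real M * ?v w y\<rfloor> = z w" by (simp add: Z_def)
          qed
        next
          assume *: "\<forall>w\<in>?R. \<lfloor>real M * ?v w y\<rfloor> = z w"
          show "Z y = z"
          proof
            fix w
            show "Z y w = z w"
            proof (cases "w \<in> ?R")
              case True
              then have "Z y w = \<lfloor>real M * ?v w y\<rfloor>" unfolding Z_def by (rule if_P)
              then show ?thesis using bspec[OF * True] by (rule trans)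
            next
              case False
              then have "Z x w = 0" for x unfolding Z_def by (rule if_not_P)
              then show ?thesis by (simp only: u)
            qed
          qed
        qed
        then show ?thesis by (auto simp: space_inv_alg)
      qed
      also have "\<dots> \<in> sets (inv_alg f)" using fin by measurable
      finally show ?thesis .
    qed
    then have Zb: "Z -` {z} \<in> sets borel" if "z \<in> range Z" for z using that by (auto simp: sets_inv_alg)
    define p where "p z = prob (Z -` {z})" for z
    \<comment> \<open>Conditioning gives a probability measure only on pieces of positive measure;
      the others carry no mass.\<close>
    define J where "J = {z\<in>range Z. p z > 0}"
    have finJ: "finite J" using finZ by (simp add: J_def)
    let ?\<nu> = "\<lambda>z. uniform_measure \<mu> (Z -` {z})"
    have J: "z \<in> range Z" "p z > 0" if "z \<in> J" for z using that by (auto simp: J_def)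
    have inv\<nu>: "inv_sys f (?\<nu> z)" if "z \<in> J" for z
      using J[OF that] by (intro inv_sys.intro f_borel uniform_measure_invariant ZF) (auto simp: p_def)
    have \<nu>m: "p z * measure (?\<nu> z) B = prob (Z -` {z} \<inter> B)" if "z \<in> J" "B \<in> sets borel" for z B
      using uniform_measure_meas[OF Zb[OF J(1)[OF that(1)]] _ that(2)] J(2)[OF that(1)] by (simp add: p_def)
    have mix: "prob B = (\<Sum>z\<in>J. p z * measure (?\<nu> z) B)" if B: "B \<in> sets borel" for B
    proof -
      have "prob (\<Union>z\<in>range Z. Z -` {z} \<inter> B) = (\<Sum>z\<in>range Z. prob (Z -` {z} \<inter> B))"
        by (rule finite_measure_finite_Union[OF finZ]) (use Zb B in \<open>auto simp: sets_\<mu> disjoint_family_on_def\<close>)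
      moreover have "(\<Union>z\<in>range Z. Z -` {z} \<inter> B) = B" by auto
      moreover have "(\<Sum>z\<in>range Z. prob (Z -` {z} \<inter> B)) = (\<Sum>z\<in>J. prob (Z -` {z} \<inter> B))"
      proof (rule sum.mono_neutral_right[OF finZ])
        show "\<forall>z\<in>range Z - J. prob (Z -` {z} \<inter> B) = 0"
        proof
          fix z assume z: "z \<in> range Z - J"
          then have "p z = 0" using measure_nonneg[of \<mu> "Z -` {z}"] by (auto simp: J_def p_def)
          moreover have "prob (Z -` {z} \<inter> B) \<le> p z" unfolding p_def
            by (rule finite_measure_mono) (use Zb z in \<open>auto simp: sets_\<mu>\<close>)
          ultimately show "prob (Z -` {z} \<inter> B) = 0" using measure_nonneg[of \<mu> "Z -` {z} \<inter> B"] by linarith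
        qed
      qed (auto simp: J_def)
      ultimately show ?thesis using \<nu>m B by simp
    qed
    have "measure (?\<nu> z) UNIV = 1" if "z \<in> J" for z
      using prob_space.prob_space[OF full_prob.axioms(1)[OF inv_sys_imp_full_prob[OF inv\<nu>[OF that]]]]
      by (simp add: space_UNIV)
    then have p1: "(\<Sum>z\<in>J. p z) = 1" using mix[of UNIV] prob_space by (simp add: space_UNIV)
    have near: "ent (?\<nu> z) ?W \<le> ?E x + c" if z: "z \<in> J" and x: "Z x = z" for z x
    proof -
      \<comment> \<open>On the piece all values \<open>?v w y\<close> lie in one interval of length
        \<open>1 / M\<close>. So does their average, which is the conditional measure of the
        fibre.\<close>
      have close: "\<bar>measure (?\<nu> z) (?W -` {w}) - ?v w x\<bar> \<le> 1 / real M" if w: "w \<in> ?R" for w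
      proof -
        let ?I = "indicator (Z -` {z}) :: 'a \<Rightarrow> real"
        have b: "real_of_int (z w) / real M \<le> ?v w y" "?v w y \<le> (real_of_int (z w) + 1) / real M" if "Z y = z" for y
        proof -
          have "z w = \<lfloor>real M * ?v w y\<rfloor>" using that w by (auto simp: Z_def)
          then have "real_of_int (z w) \<le> real M * ?v w y" "real M * ?v w y \<le> real_of_int (z w) + 1" by linarith+
          then show "real_of_int (z w) / real M \<le> ?v w y" "?v w y \<le> (real_of_int (z w) + 1) / real M"
            using M by (simp_all add: field_simps)
        qed
        have Zm: "Z -` {z} \<in> events" using Zb J[OF z] by (simp add: sets_\<mu>)
        have i1: "integrable \<mu> (\<lambda>y. ?I y * r)" for r
          using Zm by (intro integrable_mult_left) (simp add: integrable_indicator_iff emeasure_eq_measure)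
        have i2: "integrable \<mu> (\<lambda>y. ?I y * ?v w y)"
        proof -
          have "integrable \<mu> (?v w)"
            by (rule borel_bounded_integrable[OF \<kappa>_borel[OF Wb], of _ 1]) (simp add: \<kappa>_le_1)
          from integrable_mult_indicator[OF Zm this] show ?thesis by simp
        qed
        have eq: "p z * measure (?\<nu> z) (?W -` {w}) = (\<integral>y. ?I y * ?v w y \<partial>\<mu>)"
          using \<nu>m[OF z Wb] \<kappa>_cond[OF ZF[OF J(1)[OF z]] Wb] by simp
        have cst: "(\<integral>y. ?I y * r \<partial>\<mu>) = p z * r" for r
          using Zm by (simp add: space_UNIV p_def)
        have "(\<integral>y. ?I y * (real_of_int (z w) / real M) \<partial>\<mu>) \<le> (\<integral>y. ?I y * ?v w y \<partial>\<mu>)"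
          using b(1) by (intro integral_mono i1 i2) (auto simp: indicator_def)
        then have l: "real_of_int (z w) / real M \<le> measure (?\<nu> z) (?W -` {w})"
          unfolding cst eq[symmetric] by (rule mult_left_le_imp_le[OF _ J(2)[OF z]])
        have "(\<integral>y. ?I y * ?v w y \<partial>\<mu>) \<le> (\<integral>y. ?I y * ((real_of_int (z w) + 1) / real M) \<partial>\<mu>)"
          using b(2) by (intro integral_mono i1 i2) (auto simp: indicator_def)
        then have u: "measure (?\<nu> z) (?W -` {w}) \<le> (real_of_int (z w) + 1) / real M"
          unfolding cst eq[symmetric] by (rule mult_left_le_imp_le[OF _ J(2)[OF z]])
        have "(real_of_int (z w) + 1) / real M = real_of_int (z w) / real M + 1 / real M" by (simp add: add_divide_distrib)
        then show ?thesis using l u b[OF x] by linarith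
      qed
      have "ent (?\<nu> z) ?W = (\<Sum>w\<in>?R. - (measure (?\<nu> z) (?W -` {w}) * ln (measure (?\<nu> z) (?W -` {w}))))"
        by (simp add: ent_def sum_negf)
      also have "\<dots> \<le> (\<Sum>w\<in>?R. - (?v w x * ln (?v w x)) + 2 * sqrt (1 / real M) + 1 / real M)"
        by (intro sum_mono xlnx_close close) (auto simp: \<kappa>_le_1)
      also have "\<dots> = ?E x + c" by (simp add: ent_def sum.distrib sum_negf sum_subtractf c_def algebra_simps)
      finally show ?thesis .
    qed
    have ind: "integrable \<mu> (\<lambda>x. indicator (Z -` {z}) x * (?E x + c))" if "z \<in> J" for z
      using integrable_mult_indicator[of "Z -` {z}" \<mu> "\<lambda>x. ?E x + c"] Zb[OF J(1)[OF that]] Eint by (simp add: sets_\<mu>)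
    have "real n * rate f \<mu> X = real n * (\<Sum>z\<in>J. p z * rate f (?\<nu> z) X)"
      using rate_mixture[OF finJ _ p1 inv\<nu> inv_sys_axioms mix X] J by (simp add: less_imp_le)
    also have "\<dots> \<le> (\<Sum>z\<in>J. p z * ent (?\<nu> z) ?W)"
      unfolding sum_distrib_left
    proof (rule sum_mono)
      fix z assume z: "z \<in> J"
      have "real n * rate f (?\<nu> z) X \<le> ent (?\<nu> z) ?W"
        using inv_sys.rate_le[OF inv\<nu>[OF z] n, of X] n by (simp add: field_simps)
      then have "p z * (real n * rate f (?\<nu> z) X) \<le> p z * ent (?\<nu> z) ?W" using J(2)[OF z] by (intro mult_left_mono) auto
      then show "real n * (p z * rate f (?\<nu> z) X) \<le> p z * ent (?\<nu> z) ?W" by (simp add: mult_ac)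
    qed
    also have "\<dots> \<le> (\<Sum>z\<in>J. \<integral>x. indicator (Z -` {z}) x * (?E x + c) \<partial>\<mu>)"
    proof (rule sum_mono)
      fix z assume z: "z \<in> J"
      have Zm: "Z -` {z} \<in> events" using Zb J[OF z] by (simp add: sets_\<mu>)
      have "p z * ent (?\<nu> z) ?W = (\<integral>x. indicator (Z -` {z}) x * ent (?\<nu> z) ?W \<partial>\<mu>)"
        using Zm by (simp add: space_UNIV p_def)
      also have "\<dots> \<le> (\<integral>x. indicator (Z -` {z}) x * (?E x + c) \<partial>\<mu>)"
      proof (rule integral_mono[OF _ ind[OF z]])
        show "integrable \<mu> (\<lambda>x. indicator (Z -` {z}) x * ent (?\<nu> z) ?W)"
          using integrable_mult_indicator[OF Zm integrable_const[of "ent (?\<nu> z) ?W"]] by simp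
        show "indicator (Z -` {z}) x * ent (?\<nu> z) ?W \<le> indicator (Z -` {z}) x * (?E x + c)" for x
          using near[OF z, of x] by (simp add: indicator_def)
      qed
      finally show "p z * ent (?\<nu> z) ?W \<le> (\<integral>x. indicator (Z -` {z}) x * (?E x + c) \<partial>\<mu>)" .
    qed
    also have "\<dots> = (\<integral>x. (\<Sum>z\<in>J. indicator (Z -` {z}) x * (?E x + c)) \<partial>\<mu>)"
      by (rule Bochner_Integration.integral_sum[OF ind, symmetric])
    also have "\<dots> \<le> (\<integral>x. ?E x + c \<partial>\<mu>)"
    proof (rule integral_mono)
      show "integrable \<mu> (\<lambda>x. \<Sum>z\<in>J. indicator (Z -` {z}) x * (?E x + c))"
        by (rule Bochner_Integration.integrable_sum[OF ind])
      show "integrable \<mu> (\<lambda>x. ?E x + c)" using Eint by simp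
      fix x
      have "(\<Sum>z\<in>J. indicator (Z -` {z}) x * (?E x + c)) = (\<Sum>z\<in>J. if Z x = z then ?E x + c else 0)"
        by (intro sum.cong) (auto simp: indicator_def)
      also have "\<dots> \<le> ?E x + c" using ent_kernel_bounds(1)[OF W, of x] c0 finJ by simp
      finally show "(\<Sum>z\<in>J. indicator (Z -` {z}) x * (?E x + c)) \<le> ?E x + c" .
    qed
    also have "\<dots> = integral\<^sup>L \<mu> ?E + c" using Eint prob_space by simp
    finally show ?thesis by (simp add: c_def)
  qed
  \<comment> \<open>The number of words is fixed, so the rounding error vanishes as M tends to
    infinity.\<close>
  have "(\<lambda>M. integral\<^sup>L \<mu> ?E + real (card ?R) * (2 * sqrt (1 / real M) + 1 / real M))
      \<longlonglongrightarrow> integral\<^sup>L \<mu> ?E + real (card ?R) * (2 * sqrt 0 + 0)"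
    by (intro tendsto_intros lim_const_over_n)
  then have "real n * rate f \<mu> X \<le> integral\<^sup>L \<mu> ?E + real (card ?R) * (2 * sqrt 0 + 0)"
    by (rule LIMSEQ_le_const) (use main in blast)
  then show ?thesis by simp
qed

text \<open>This is \<open>rate_le_kernel_ent\<close> divided by n, with n tending to infinity under
  the integral. The maximal entropy per letter, \<open>ln (card (range X))\<close>,
  dominates.\<close>

lemma rate_le_kernel_rate:
  fixes X :: "'a \<Rightarrow> 'b"
  assumes comp: "compact (UNIV :: 'a set)" and X: "simple_function borel X"
  shows "integrable \<mu> (\<lambda>x. rate f (\<kappa> x) X)" "rate f \<mu> X \<le> (\<integral>x. rate f (\<kappa> x) X \<partial>\<mu>)"
proof -
  let ?a = "\<lambda>n x. ent (\<kappa> x) (word f n X) / real n"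
  let ?B = "ln (card (range X))"
  have W: "simple_function borel (word f n X)" for n using simple_word X by (simp add: simple_iff)
  have am: "?a n \<in> borel_measurable \<mu>" for n
    using ent_kernel_meas[OF W[of n]] by (simp add: meas_cong)
  have rm: "(\<lambda>x. rate f (\<kappa> x) X) \<in> borel_measurable \<mu>"
    unfolding rate_def by (intro borel_measurable_cINF_real am) auto
  have lim: "AE x in \<mu>. (\<lambda>n. ?a n x) \<longlonglongrightarrow> rate f (\<kappa> x) X \<and> (\<forall>n. norm (?a n x) \<le> ?B)"
    using kernel_invariant[OF comp]
  proof eventually_elim
    case (elim x)
    interpret K: inv_sys f "\<kappa> x" using f_borel elim by (rule inv_sys.intro)
    have XK: "simple_function (\<kappa> x) X" using X by (simp add: K.simple_iff)
    have "finite (range X)" using simple_functionD(1)[OF X] by simp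
    then have B0: "0 \<le> ?B" by (simp add: Suc_leI card_gt_0_iff)
    have "norm (?a n x) \<le> ?B" for n
      using K.ent_word_le[OF XK, of n] K.ent_nonneg[of "word f n X"] B0
      by (cases "n = 0") (auto simp: field_simps)
    then show ?case using K.rate_tendsto[OF XK] by blast
  qed
  have l1: "AE x in \<mu>. (\<lambda>n. ?a n x) \<longlonglongrightarrow> rate f (\<kappa> x) X" using lim by eventually_elim blast
  have l2: "AE x in \<mu>. norm (?a n x) \<le> ?B" for n using lim by eventually_elim blast
  show "integrable \<mu> (\<lambda>x. rate f (\<kappa> x) X)"
    by (rule integrable_dominated_convergence[where w = "\<lambda>_. ?B" and s = ?a, OF rm am _ l1 l2]) simp
  have "(\<lambda>n. \<integral>x. ?a n x \<partial>\<mu>) \<longlonglongrightarrow> (\<integral>x. rate f (\<kappa> x) X \<partial>\<mu>)"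
    by (rule integral_dominated_convergence[where w = "\<lambda>_. ?B" and s = ?a, OF rm am _ l1 l2]) simp
  moreover have "rate f \<mu> X \<le> (\<integral>x. ?a n x \<partial>\<mu>)" if "n \<ge> 1" for n
    using rate_le_kernel_ent[OF X that] that by (simp add: field_simps)
  ultimately show "rate f \<mu> X \<le> (\<integral>x. rate f (\<kappa> x) X \<partial>\<mu>)"
    by (intro LIMSEQ_le_const) auto
qed

end

subsection \<open>Equilibrium states\<close>

theorem theorem3p1:
  fixes f :: "'a::metric_space \<Rightarrow> 'a" and \<phi> \<psi> :: "'a \<Rightarrow> real"
  assumes "compact (UNIV :: 'a set)"
    and "continuous_on UNIV f"
    and "top_entropy f < \<infinity>"
    and "continuous_on UNIV \<phi>"
    and "continuous_on UNIV \<psi>"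
    and "\<And>x. \<psi> x > 0"
  shows "convex_measures (equilibrium_states f \<psi> \<phi>)
    \<and> extreme_measures (equilibrium_states f \<psi> \<phi>) =
          {\<mu> \<in> equilibrium_states f \<psi> \<phi>. ergodic f \<mu>}
    \<and> (equilibrium_states f \<psi> \<phi> \<noteq> {} \<longrightarrow> (\<exists>\<mu>\<in>equilibrium_states f \<psi> \<phi>. ergodic f \<mu>))"
proof (cases "equilibrium_states f \<psi> \<phi> = {}")
  case True
  then show ?thesis by (simp add: convex_measures_def extreme_measures_def)
next
  case False
  let ?S = "equilibrium_states f \<psi> \<phi>"
  note comp = assms(1) and contf = assms(2) and cont\<phi> = assms(4) and cont\<psi> = assms(5) and \<psi>pos = assms(6)
  have fb: "f \<in> borel \<rightarrow>\<^sub>M borel" by (rule borel_measurable_continuous_onI[OF contf])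
  have \<phi>b: "\<phi> \<in> borel_measurable borel" by (rule borel_measurable_continuous_onI[OF cont\<phi>])
  have \<psi>b: "\<psi> \<in> borel_measurable borel" by (rule borel_measurable_continuous_onI[OF cont\<psi>])
  have "bounded (range \<phi>)" "bounded (range \<psi>)"
    by (intro compact_imp_bounded compact_continuous_image cont\<phi> cont\<psi> comp)+
  then obtain B1 B2 where B1: "\<And>x. \<bar>\<phi> x\<bar> \<le> B1" and B2: "\<And>x. \<bar>\<psi> x\<bar> \<le> B2"
    by (auto simp: bounded_iff)
  have isys: "inv_sys f \<nu>" if "\<nu> \<in> invariant_measures f" for \<nu> using fb that by (rule inv_sys.intro)

  obtain \<beta>\<^sub>0 where \<beta>\<^sub>0: "top_entropy f < ereal \<beta>\<^sub>0" using ereal_dense2[OF assms(3)] by blast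
  define h where "h \<nu> = real_of_ereal (measure_entropy f \<nu>)" for \<nu>
  \<comment> \<open>The topological entropy gives the bound from above, and the rate of a constant
    function excludes -\<infinity>.\<close>
  have h: "measure_entropy f \<nu> = ereal (h \<nu>)" if \<nu>: "\<nu> \<in> invariant_measures f" for \<nu>
  proof -
    interpret inv_sys f \<nu> by (rule isys[OF \<nu>])
    have "measure_entropy f \<nu> \<le> ereal \<beta>\<^sub>0" by (rule measure_entropy_le_top_entropy[OF comp contf \<nu> \<beta>\<^sub>0])
    moreover have "ereal (rate f \<nu> (\<lambda>_. ())) \<le> measure_entropy f \<nu>" by (rule rate_le_measure_entropy) simp
    ultimately show ?thesis unfolding h_def by (cases "measure_entropy f \<nu>") auto
  qed
  obtain \<mu>\<^sub>0 where "\<mu>\<^sub>0 \<in> ?S" using False by blast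
  then have \<mu>0: "\<mu>\<^sub>0 \<in> invariant_measures f"
    "induced_pressure f \<psi> \<phi> = (measure_entropy f \<mu>\<^sub>0 + ereal (\<integral>x. \<phi> x \<partial>\<mu>\<^sub>0)) / ereal (\<integral>x. \<psi> x \<partial>\<mu>\<^sub>0)"
    by (auto simp: equilibrium_states_def)
  have \<psi>int: "integral\<^sup>L \<nu> \<psi> > 0" if \<nu>: "\<nu> \<in> invariant_measures f" for \<nu>
  proof -
    interpret inv_sys f \<nu> by (rule isys[OF \<nu>])
    have "integral\<^sup>L \<nu> \<psi> > integral\<^sup>L \<nu> (\<lambda>_. 0)"
      by (rule integral_less_AE_space)
        (use borel_bounded_integrable[OF \<psi>b B2] \<psi>pos emeasure_space_1 in auto)
    then show ?thesis by simp
  qed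
  \<comment> \<open>The equilibrium state at hand shows that the pressure is a real number: its
    quotient has a finite numerator and a positive denominator.\<close>
  define P where "P = (h \<mu>\<^sub>0 + integral\<^sup>L \<mu>\<^sub>0 \<phi>) / integral\<^sup>L \<mu>\<^sub>0 \<psi>"
  have P: "induced_pressure f \<psi> \<phi> = ereal P"
    using \<mu>0(2) \<psi>int[OF \<mu>0(1)] by (simp add: h[OF \<mu>0(1)] P_def)
  define g where "g x = \<phi> x - P * \<psi> x" for x
  have gb: "g \<in> borel_measurable borel" unfolding g_def[abs_def] using \<phi>b \<psi>b by measurable
  have gB: "\<bar>g x\<bar> \<le> B1 + \<bar>P\<bar> * B2" for x
  proof -
    have "\<bar>g x\<bar> \<le> \<bar>\<phi> x\<bar> + \<bar>P\<bar> * \<bar>\<psi> x\<bar>" unfolding g_def by (metis abs_mult abs_triangle_ineq4)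
    also have "\<dots> \<le> B1 + \<bar>P\<bar> * B2" by (intro add_mono B1 mult_left_mono B2) simp
    finally show ?thesis .
  qed
  have gint: "integral\<^sup>L \<nu> (\<lambda>x. \<phi> x - \<beta> * \<psi> x) = integral\<^sup>L \<nu> \<phi> - \<beta> * integral\<^sup>L \<nu> \<psi>" if \<nu>: "\<nu> \<in> invariant_measures f" for \<nu> \<beta>
  proof -
    interpret inv_sys f \<nu> by (rule isys[OF \<nu>])
    show ?thesis using borel_bounded_integrable[OF \<phi>b B1] borel_bounded_integrable[OF \<psi>b B2] by simp
  qed
  \<comment> \<open>Otherwise the quotient Q of \<nu> would exceed P. The variational bound holds
    strictly above the pressure, so it is applied to a \<beta> between P and Q.\<close>
  have var: "h \<nu> + integral\<^sup>L \<nu> g \<le> 0" if \<nu>: "\<nu> \<in> invariant_measures f" for \<nu>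
  proof (rule ccontr)
    assume "\<not> ?thesis"
    then have gt: "P * integral\<^sup>L \<nu> \<psi> < h \<nu> + integral\<^sup>L \<nu> \<phi>"
      using gint[OF \<nu>, of P] unfolding g_def[abs_def] by simp
    define Q where "Q = (h \<nu> + integral\<^sup>L \<nu> \<phi>) / integral\<^sup>L \<nu> \<psi>"
    have Q: "Q * integral\<^sup>L \<nu> \<psi> = h \<nu> + integral\<^sup>L \<nu> \<phi>" using \<psi>int[OF \<nu>] by (simp add: Q_def)
    with gt have "P < Q" using \<psi>int[OF \<nu>] by (metis mult_less_cancel_right_pos)
    define \<beta> where "\<beta> = (P + Q) / 2"
    have \<beta>: "P < \<beta>" "\<beta> < Q" using \<open>P < Q\<close> by (auto simp: \<beta>_def)
    have "measure_entropy f \<nu> \<le> ereal (- (\<integral>x. \<phi> x - \<beta> * \<psi> x \<partial>\<nu>))"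
      by (rule induced_pressure_variational[OF comp contf cont\<phi> cont\<psi> \<psi>pos \<nu>]) (simp add: P \<beta>)
    then have "h \<nu> + integral\<^sup>L \<nu> \<phi> \<le> \<beta> * integral\<^sup>L \<nu> \<psi>" by (simp add: h[OF \<nu>] gint[OF \<nu>])
    moreover have "\<beta> * integral\<^sup>L \<nu> \<psi> < Q * integral\<^sup>L \<nu> \<psi>"
      using \<beta>(2) \<psi>int[OF \<nu>] by (rule mult_strict_right_mono)
    ultimately show False using Q by simp
  qed
  have S_iff: "\<nu> \<in> ?S \<longleftrightarrow> \<nu> \<in> invariant_measures f \<and> h \<nu> + integral\<^sup>L \<nu> g = 0" for \<nu>
  proof (cases "\<nu> \<in> invariant_measures f")
    case True
    have "induced_pressure f \<psi> \<phi> = (measure_entropy f \<nu> + ereal (\<integral>x. \<phi> x \<partial>\<nu>)) / ereal (\<integral>x. \<psi> x \<partial>\<nu>)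
        \<longleftrightarrow> P = (h \<nu> + integral\<^sup>L \<nu> \<phi>) / integral\<^sup>L \<nu> \<psi>"
      using \<psi>int[OF True] by (simp add: P h[OF True])
    also have "\<dots> \<longleftrightarrow> h \<nu> + integral\<^sup>L \<nu> g = 0"
      using \<psi>int[OF True] gint[OF True, of P] unfolding g_def[abs_def] by (auto simp: field_simps)
    finally show ?thesis using True by (simp add: equilibrium_states_def)
  qed (simp add: equilibrium_states_def)
  have mix: "mix_measure t \<mu> \<nu> \<in> invariant_measures f"
    "h (mix_measure t \<mu> \<nu>) + integral\<^sup>L (mix_measure t \<mu> \<nu>) g
      = (1 - t) * (h \<mu> + integral\<^sup>L \<mu> g) + t * (h \<nu> + integral\<^sup>L \<nu> g)"
    if \<mu>: "\<mu> \<in> invariant_measures f" and \<nu>: "\<nu> \<in> invariant_measures f" and t: "t \<in> {0..1}" for \<mu> \<nu> t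
  proof -
    interpret \<mu>: inv_sys f \<mu> by (rule isys[OF \<mu>])
    interpret \<nu>: inv_sys f \<nu> by (rule isys[OF \<nu>])
    show "mix_measure t \<mu> \<nu> \<in> invariant_measures f" by (rule mix_measure_invariant[OF fb \<mu> \<nu> t])
    have "h (mix_measure t \<mu> \<nu>) = (1 - t) * h \<mu> + t * h \<nu>"
      using measure_entropy_mixture[OF fb \<mu> \<nu> t h[OF \<mu>] h[OF \<nu>]] by (simp add: h_def)
    moreover have "integral\<^sup>L (mix_measure t \<mu> \<nu>) g = (1 - t) * integral\<^sup>L \<mu> g + t * integral\<^sup>L \<nu> g"
      by (rule integral_mix_measure[OF \<mu>.prob_space_axioms \<nu>.prob_space_axioms _ t _ gB])
        (use gb in \<open>auto simp: \<mu>.sets_\<mu> \<nu>.sets_\<mu> \<mu>.meas_cong\<close>)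
    ultimately show "h (mix_measure t \<mu> \<nu>) + integral\<^sup>L (mix_measure t \<mu> \<nu>) g
      = (1 - t) * (h \<mu> + integral\<^sup>L \<mu> g) + t * (h \<nu> + integral\<^sup>L \<nu> g)"
      by (simp add: algebra_simps)
  qed
  have convex: "convex_measures ?S"
    unfolding convex_measures_def
  proof (intro ballI)
    fix \<mu> \<nu> and t :: real assume "\<mu> \<in> ?S" "\<nu> \<in> ?S" and t: "t \<in> {0..1}"
    then show "mix_measure t \<mu> \<nu> \<in> ?S" using mix[of \<mu> \<nu> t] by (simp add: S_iff)
  qed
  have erg: "ergodic f \<mu>" if ext: "\<mu> \<in> extreme_measures ?S" for \<mu>
  proof (rule ccontr)
    assume notE: "\<not> ergodic f \<mu>"
    have \<mu>S: "\<mu> \<in> ?S" using ext by (simp add: extreme_measures_def)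
    then have \<mu>: "\<mu> \<in> invariant_measures f" "h \<mu> + integral\<^sup>L \<mu> g = 0" by (auto simp: S_iff)
    interpret \<mu>: inv_sys f \<mu> by (rule isys[OF \<mu>(1)])
    obtain A where A: "A \<in> sets borel" "f -` A = A" "measure \<mu> A \<noteq> 0" "measure \<mu> A \<noteq> 1"
      using notE \<mu>(1) by (auto simp: ergodic_def)
    \<comment> \<open>\<open>mix_measure\<close> gives weight \<open>1 - t\<close> to its first
      component, so t is the measure of the complement of A.\<close>
    define t where "t = 1 - measure \<mu> A"
    have tA: "measure \<mu> (- A) = t"
      using \<mu>.prob_compl[of A] A(1) by (simp add: t_def \<mu>.space_UNIV \<mu>.sets_\<mu> Compl_eq_Diff_UNIV)
    have t01: "0 < t" "t < 1" using A \<mu>.prob_le_1[of A] measure_nonneg[of \<mu> A] by (auto simp: t_def order.strict_iff_order)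
    have AI: "A \<in> sets (inv_alg f)" "- A \<in> sets (inv_alg f)"
      using A by (auto simp: sets_inv_alg vimage_Compl)
    have Ab: "- A \<in> sets borel" using A(1) by simp
    have pA: "measure \<mu> A > 0" "measure \<mu> (- A) > 0" using t01 tA by (auto simp: t_def)
    let ?\<nu>1 = "uniform_measure \<mu> A" and ?\<nu>2 = "uniform_measure \<mu> (- A)"
    have \<nu>: "?\<nu>1 \<in> invariant_measures f" "?\<nu>2 \<in> invariant_measures f"
      by (intro \<mu>.uniform_measure_invariant AI pA)+
    interpret \<nu>1: inv_sys f ?\<nu>1 by (rule isys[OF \<nu>(1)])
    interpret \<nu>2: inv_sys f ?\<nu>2 by (rule isys[OF \<nu>(2)])
    have eq: "\<mu> = mix_measure t ?\<nu>1 ?\<nu>2"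
    proof (rule measure_eqI)
      interpret M: inv_sys f "mix_measure t ?\<nu>1 ?\<nu>2" by (rule isys[OF mix(1)[OF \<nu>]]) (use t01 in auto)
      show "sets \<mu> = sets (mix_measure t ?\<nu>1 ?\<nu>2)" by (simp add: \<mu>.sets_\<mu> M.sets_\<mu>)
      fix B assume "B \<in> sets \<mu>"
      then have B: "B \<in> sets borel" by (simp add: \<mu>.sets_\<mu>)
      have "measure (mix_measure t ?\<nu>1 ?\<nu>2) B = (1 - t) * measure ?\<nu>1 B + t * measure ?\<nu>2 B"
        by (rule measure_mix_measure[OF \<nu>1.prob_space_axioms \<nu>2.prob_space_axioms]) (use B t01 in \<open>auto simp: \<mu>.sets_\<mu>\<close>)
      also have "\<dots> = measure \<mu> (A \<inter> B) + measure \<mu> (- A \<inter> B)"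
        using \<mu>.uniform_measure_meas[OF A(1) pA(1) B] \<mu>.uniform_measure_meas[OF Ab pA(2) B] t01 tA pA
        by (simp add: t_def)
      also have "\<dots> = measure \<mu> ((A \<inter> B) \<union> (- A \<inter> B))"
        by (rule \<mu>.finite_measure_Union[symmetric]) (use A B in \<open>auto simp: \<mu>.sets_\<mu>\<close>)
      also have "(A \<inter> B) \<union> (- A \<inter> B) = B" by auto
      finally show "emeasure \<mu> B = emeasure (mix_measure t ?\<nu>1 ?\<nu>2) B"
        by (simp add: \<mu>.emeasure_eq_measure M.emeasure_eq_measure)
    qed
    \<comment> \<open>Two nonpositive terms with sum 0 both vanish, so the two halves of \<mu> are
      equilibrium states again.\<close>
    have "(1 - t) * (h ?\<nu>1 + integral\<^sup>L ?\<nu>1 g) + t * (h ?\<nu>2 + integral\<^sup>L ?\<nu>2 g) = 0"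
      using mix(2)[OF \<nu>, of t] \<mu>(2) t01 unfolding eq[symmetric] by simp
    moreover have "(1 - t) * (h ?\<nu>1 + integral\<^sup>L ?\<nu>1 g) \<le> 0" "t * (h ?\<nu>2 + integral\<^sup>L ?\<nu>2 g) \<le> 0"
      using var[OF \<nu>(1)] var[OF \<nu>(2)] t01 by (auto intro: mult_nonneg_nonpos)
    ultimately have "(1 - t) * (h ?\<nu>1 + integral\<^sup>L ?\<nu>1 g) = 0" "t * (h ?\<nu>2 + integral\<^sup>L ?\<nu>2 g) = 0"
      by linarith+
    then have "?\<nu>1 \<in> ?S" "?\<nu>2 \<in> ?S" using \<nu> t01 by (auto simp: S_iff)
    moreover have "?\<nu>1 \<noteq> ?\<nu>2"
    proof
      assume "?\<nu>1 = ?\<nu>2"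
      then have "measure ?\<nu>1 A = measure ?\<nu>2 A" by simp
      then show False
        using \<mu>.uniform_measure_meas[OF A(1) pA(1) A(1)] \<mu>.uniform_measure_meas[OF Ab pA(2) A(1)] pA by simp
    qed
    ultimately show False using ext eq t01 unfolding extreme_measures_def by auto
  qed
  have ext: "\<mu> \<in> extreme_measures ?S" if \<mu>S: "\<mu> \<in> ?S" and E: "ergodic f \<mu>" for \<mu>
    unfolding extreme_measures_def
  proof (intro CollectI conjI \<mu>S ballI impI notI)
    fix \<nu>1 \<nu>2 t assume "\<nu>1 \<in> ?S" "\<nu>2 \<in> ?S" and t: "t \<in> {0<..<1}" and ne: "\<nu>1 \<noteq> \<nu>2" and eq: "\<mu> = mix_measure t \<nu>1 \<nu>2"
    then have \<nu>: "\<nu>1 \<in> invariant_measures f" "\<nu>2 \<in> invariant_measures f" by (auto simp: S_iff)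
    interpret \<nu>1: inv_sys f \<nu>1 by (rule isys[OF \<nu>(1)])
    interpret \<nu>2: inv_sys f \<nu>2 by (rule isys[OF \<nu>(2)])
    have \<mu>: "inv_sys f \<mu>" using \<mu>S by (intro isys) (simp add: S_iff)
    have m: "measure \<mu> N = (1 - t) * measure \<nu>1 N + t * measure \<nu>2 N" if "N \<in> sets borel" for N
      unfolding eq by (rule measure_mix_measure[OF \<nu>1.prob_space_axioms \<nu>2.prob_space_axioms])
        (use that t in \<open>auto simp: \<nu>1.sets_\<mu> \<nu>2.sets_\<mu>\<close>)
    \<comment> \<open>Both weights are positive, so a \<mu>-null set is null for each component, and
      ergodicity then makes both components equal to \<mu>.\<close>
    have "measure \<nu>1 N = 0 \<and> measure \<nu>2 N = 0" if N: "N \<in> sets borel" "measure \<mu> N = 0" for N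
    proof -
      have "0 \<le> (1 - t) * measure \<nu>1 N" "0 \<le> t * measure \<nu>2 N" using t by auto
      then have "(1 - t) * measure \<nu>1 N = 0" "t * measure \<nu>2 N = 0" using m[OF N(1)] N(2) by linarith+
      then show ?thesis using t by auto
    qed
    then have "\<nu>1 = \<mu>" "\<nu>2 = \<mu>"
      by (auto intro!: ergodic_absolutely_continuous_eq[OF \<mu> _ E] \<nu>1.inv_sys_axioms \<nu>2.inv_sys_axioms)
    then show False using ne by simp
  qed
  have "\<exists>\<mu>\<in>?S. ergodic f \<mu>"
  proof -
    have \<mu>: "h \<mu>\<^sub>0 + integral\<^sup>L \<mu>\<^sub>0 g = 0" using \<open>\<mu>\<^sub>0 \<in> ?S\<close> by (simp add: S_iff)
    obtain \<kappa> where "inv_kernel f \<mu>\<^sub>0 \<kappa>" using exists_inv_kernel[OF comp isys[OF \<mu>0(1)]] by blast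
    then interpret inv_kernel f \<mu>\<^sub>0 \<kappa> .
    have "\<exists>X :: 'a \<Rightarrow> 'a set. simple_function borel X \<and> h \<mu>\<^sub>0 - inverse (real (Suc k)) < rate f \<mu>\<^sub>0 X" for k
    proof (rule ccontr)
      assume *: "\<not> ?thesis"
      have "measure_entropy f \<mu>\<^sub>0 \<le> ereal (h \<mu>\<^sub>0 - inverse (real (Suc k)))"
      proof (rule measure_entropy_le)
        fix \<xi> :: "'a set set" assume "finite \<xi>" "\<xi> \<subseteq> sets borel" "partition_on UNIV \<xi>"
        then have "simple_function borel (cell \<xi>)" using simple_cell by (simp add: simple_iff)
        then show "ereal (rate f \<mu>\<^sub>0 (cell \<xi>)) \<le> ereal (h \<mu>\<^sub>0 - inverse (real (Suc k)))"
          using * by (auto simp: not_less)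
      qed
      then show False by (simp add: h[OF \<mu>0(1)])
    qed
    then obtain X :: "nat \<Rightarrow> 'a \<Rightarrow> 'a set" where X: "\<And>k. simple_function borel (X k)"
      "\<And>k. h \<mu>\<^sub>0 - inverse (real (Suc k)) < rate f \<mu>\<^sub>0 (X k)" by metis
    \<comment> \<open>An upper bound for the defect \<open>- (h (\<kappa> x) + integral g)\<close>
      of \<open>\<kappa> x\<close>, which is nonnegative by \<open>var\<close>. The choice of
      \<open>X k\<close> makes its mean at most \<open>inverse (Suc k)\<close>.\<close>
    define u where "u k x = - (rate f (\<kappa> x) (X k) + integral\<^sup>L (\<kappa> x) g)" for k x
    note gk = kernel_integral[OF gb gB]
    have gki: "integrable \<mu>\<^sub>0 (\<lambda>x. integral\<^sup>L (\<kappa> x) g)"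
      by (rule integrable_const_bound[of _ "B1 + \<bar>P\<bar> * B2"]) (use gk in auto)
    have uint: "integrable \<mu>\<^sub>0 (u k)" for k
      unfolding u_def[abs_def] using rate_le_kernel_rate(1)[OF comp X(1)[of k]] gki by simp
    have ule: "integral\<^sup>L \<mu>\<^sub>0 (u k) \<le> inverse (real (Suc k))" for k
    proof -
      have "integral\<^sup>L \<mu>\<^sub>0 (u k) = - ((\<integral>x. rate f (\<kappa> x) (X k) \<partial>\<mu>\<^sub>0) + integral\<^sup>L \<mu>\<^sub>0 g)"
        unfolding u_def[abs_def] using rate_le_kernel_rate(1)[OF comp X(1)[of k]] gki gk(2) by simp
      then show ?thesis using rate_le_kernel_rate(2)[OF comp X(1)[of k]] X(2)[of k] \<mu> by linarith
    qed
    have upos: "AE x in \<mu>\<^sub>0. \<forall>k. 0 \<le> u k x"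
      using kernel_invariant[OF comp]
    proof eventually_elim
      case (elim x)
      interpret K: inv_sys f "\<kappa> x" by (rule isys[OF elim])
      have "rate f (\<kappa> x) (X k) \<le> h (\<kappa> x)" for k
        using K.rate_le_measure_entropy[of "X k"] X(1)[of k] by (simp add: K.simple_iff h[OF elim])
      then show ?case using var[OF elim] unfolding u_def by (smt (verit))
    qed
    \<comment> \<open>If all \<open>u k\<close> are at least \<open>inverse (Suc m)\<close> on D,
      then \<open>prob D * inverse (Suc m)\<close> lies below the mean of every \<open>u k\<close>
      and so is 0. The infimum over k is thus almost surely 0, even though no single
      \<open>X k\<close> need be optimal.\<close>
    have small: "AE x in \<mu>\<^sub>0. \<exists>k. u k x < inverse (real (Suc m))" for m
    proof -
      define D where "D = {x. \<forall>k. inverse (real (Suc m)) \<le> u k x}"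
      have Dm: "D \<in> events"
      proof -
        have [measurable]: "u k \<in> borel_measurable \<mu>\<^sub>0" for k using uint by (rule borel_measurable_integrable)
        have "{x \<in> space \<mu>\<^sub>0. \<forall>k. inverse (real (Suc m)) \<le> u k x} \<in> events" by measurable
        then show ?thesis by (simp add: D_def space_UNIV)
      qed
      have "prob D * inverse (real (Suc m)) \<le> inverse (real (Suc k))" for k
      proof -
        have "(\<integral>x. indicator D x * inverse (real (Suc m)) \<partial>\<mu>\<^sub>0) \<le> integral\<^sup>L \<mu>\<^sub>0 (u k)"
        proof (rule integral_mono_AE[OF _ uint])
          show "integrable \<mu>\<^sub>0 (\<lambda>x. indicator D x * inverse (real (Suc m)))"
            using Dm by (intro integrable_mult_left) (simp add: integrable_indicator_iff emeasure_eq_measure)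
          show "AE x in \<mu>\<^sub>0. indicator D x * inverse (real (Suc m)) \<le> u k x"
            using upos by eventually_elim (auto simp: D_def indicator_def)
        qed
        then show ?thesis using ule[of k] Dm by (simp add: space_UNIV)
      qed
      then have "prob D * inverse (real (Suc m)) \<le> 0"
        by (intro LIMSEQ_le_const[OF LIMSEQ_inverse_real_of_nat]) blast
      then have "prob D = 0" by (simp add: mult_le_0_iff measure_le_0_iff)
      then have "AE x in \<mu>\<^sub>0. x \<notin> D" using prob_eq_0[OF Dm] by simp
      then show ?thesis by eventually_elim (auto simp: D_def not_le)
    qed
    then have "AE x in \<mu>\<^sub>0. \<forall>m. \<exists>k. u k x < inverse (real (Suc m))" unfolding AE_all_countable by blast
    with kernel_invariant[OF comp] kernel_ergodic[OF comp]
    have "AE x in \<mu>\<^sub>0. \<kappa> x \<in> ?S \<and> ergodic f (\<kappa> x)"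
    proof eventually_elim
      case (elim x)
      interpret K: inv_sys f "\<kappa> x" by (rule isys[OF elim(1)])
      have "0 \<le> h (\<kappa> x) + integral\<^sup>L (\<kappa> x) g"
      proof (rule ccontr)
        assume "\<not> ?thesis"
        then have "0 < - (h (\<kappa> x) + integral\<^sup>L (\<kappa> x) g)" by simp
        from reals_Archimedean[OF this] obtain m where m: "inverse (real (Suc m)) < - (h (\<kappa> x) + integral\<^sup>L (\<kappa> x) g)" by blast
        obtain k where "u k x < inverse (real (Suc m))" using elim(3) by blast
        moreover have "rate f (\<kappa> x) (X k) \<le> h (\<kappa> x)"
          using K.rate_le_measure_entropy[of "X k"] X(1)[of k] by (simp add: K.simple_iff h[OF elim(1)])
        ultimately show False using m unfolding u_def by linarith
      qed
      then show ?case using var[OF elim(1)] elim(1,2) by (simp add: S_iff)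
    qed
    then have ae: "AE x in \<mu>\<^sub>0. \<kappa> x \<in> ?S \<and> ergodic f (\<kappa> x)" .
    show ?thesis
    proof (rule ccontr)
      assume none: "\<not> ?thesis"
      from ae have "AE x in \<mu>\<^sub>0. False"
      proof eventually_elim
        case (elim x)
        with none show False by blast
      qed
      then show False by (simp add: AE_False)
    qed
  qed
  moreover have "extreme_measures ?S \<subseteq> ?S" by (auto simp: extreme_measures_def)
  then have "extreme_measures ?S = {\<mu> \<in> ?S. ergodic f \<mu>}" using erg ext by blast
  ultimately show ?thesis using convex by blast
qed

end
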